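(* Let $V,U\ge 0$ be independent random variables with $\mathbb{E}[V]=\mathbb{E}[U]=1$, variances satisfying $0<\sigma_V^2+\sigma_U^2<\infty$, and such that for some $\delta_0>0$ the functions $z\mapsto \mathbb{E}[e^{zV}]$ and $z\mapsto\mathbb{E}[e^{zU}]$ are analytic in an open strip containing $-\delta_0\le \mathrm{Re}(z)\le\delta_0$. Assume moreover that the separation assumption (A) of the context holds. Let $\rho_n\in(0,1)$, $n=1,2,\dots$, be such that there are fixed $0<\beta_1\le\beta_2<\infty$ with $(1-\rho_n)\sqrt n\in[\beta_1,\beta_2]$ for all $n$. Let $W_n$ be the steady-state waiting time of the nearly deterministic $\mathrm{GI}_n/\mathrm{G}_n/1$ queue built from $V,U,\rho_n$. For $n$ sufficiently large, let $\zeta_{sp}$ be the saddle point on the negative real axis of $h(\zeta)=\log\psi(-\zeta;\rho_n)$, and put $$\sigma_n=\big(h''(\zeta_{sp})\big)^{1/2},\qquad \beta_n=-\zeta_{sp}\,\sigma_n\sqrt n,\qquad d_2=-\frac{h'''(\zeta_{sp})}{6h''(\zeta_{sp})}.$$ Then $d_2=O(1)$ as a function of $n$, and, uniformly in any bounded set of complex $s$ with $\mathrm{Re}(s)\ge-\frac12\beta_n$, $$\log\Big(\mathbb{E}\Big[\exp\Big(-s\,\frac{\sqrt n}{\sigma_n}\,W_n\Big)\Big]\Big)=\log\Big(\mathbb{E}\big[e^{-R_nM_{B_n}}\big]\Big)+O\Big(\frac1n\Big),\qquad n\to\infty,$$ where $$B_n=\frac{\beta_n}{1+\beta_n\varphi_n},\qquad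 R_n=R_n(s)=\frac{s}{(1+\beta_n\varphi_n)(1+(s+\beta_n)\varphi_n)},\qquad \varphi_n=\frac{d_2}{\sigma_n\sqrt n}=O(1/\sqrt n).$$ (Uniformity means: for every bounded $S\subset\mathbb{C}$ there are $K<\infty$ and $n_0$ such that for all $n\ge n_0$ and all $s\in S$ with $\mathrm{Re}(s)\ge-\frac12\beta_n$ both sides are defined and the two logarithms differ by at most $K/n$ in modulus.)
   Context: Nearly deterministic $\mathrm{GI}_n/\mathrm{G}_n/1$ queue: $V_n=\frac1n\sum_{k=1}^n V_{n,k}$ and $U_n=\frac1n\sum_{k=1}^nU_{n,k}$, where the $V_{n,k}$ are i.i.d. copies of $V$, the $U_{n,k}$ are i.i.d. copies of $U$, and all of these are independent. The steady-state waiting time $W_n\ge0$ is the (finite) random variable whose distribution is the stationary solution of $W_n\stackrel{d}{=}\big(W_n+V_n-\frac1{\rho_n}U_n\big)^+$, where $x^+=\max\{0,x\}$ and on the right-hand side $W_n,V_n,U_n$ are independent. For $\rho\in(0,1]$ let $\psi(s)=\psi(s;\rho)=\mathbb{E}\big[e^{s(V-\frac1\rho U)}\big]$. Assumption (A): there are $\delta>0$ (with $\mathbb{E}[e^{\delta V}]<\infty$, so that the quantities below are defined) and $\varepsilon>0$ such that for all $\rho\in[\frac12,1)$, all $x\in[-\delta,0)$ and all $y\in\mathbb{R}$ with $|y|>\delta$ one has $|\psi(-x+iy;\rho)|<\psi(-x;\rho)-\varepsilon$. Saddle point: $h(\zeta)=\log\psi(-\zeta;\rho_n)$ is, on a sufficiently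 small fixed interval $[-\delta',0]$, a convex function with $h(0)=0$, $h'(0)=\frac1{\rho_n}-1>0$; for $\rho_n$ sufficiently close to 1 (hence $n$ sufficiently large) it has a unique point $\zeta_{sp}\in[-\delta',0]$ with $h'(\zeta_{sp})=0$. This $\zeta_{sp}$ (depending on $n$) is the saddle point. Gaussian random walk: for $\beta>0$, $M_\beta=\max_{k\ge0}S_k$, where $S_0=0$ and $S_k$ is the sum of $k$ i.i.d. normal random variables with mean $-\beta$ and variance 1. Logarithms of transforms: for $X=\frac{\sqrt n}{\sigma_n}W_n$ (with $b=\beta_n$) and for $X=M_\beta$ (with $b=\beta$), $\log(\mathbb{E}[e^{-sX}])$ denotes the branch that is analytic in $s$ on the half-plane $\mathrm{Re}(s)>-b$ (where the transform is analytic and zero-free) and vanishes at $s=0$; $\log(\mathbb{E}[e^{-R_nM_{B_n}}])$ is this function for $M_{B_n}$ evaluated at the argument $R_n(s)$. *)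

theory Defs
  imports
    "HOL-Probability.Probability"
    "HOL-Complex_Analysis.Complex_Analysis"
    "HOL-Library.Landau_Symbols"
begin

text \<open>
  The Bochner integral is \<open>0\<close> where it does not exist, so existence of the transform is required
  separately. The strip is allowed to be asymmetric.
\<close>

definition mgf_analytic_near_strip :: "'a measure \<Rightarrow> ('a \<Rightarrow> real) \<Rightarrow> real \<Rightarrow> bool" where
  "mgf_analytic_near_strip M X \<delta> \<longleftrightarrow>
     (\<exists>a b. \<delta> < a \<and> \<delta> < b \<and>
        (\<forall>z. - a < Re z \<and> Re z < b \<longrightarrow>
           integrable M (\<lambda>\<omega>. exp (z * complex_of_real (X \<omega>)))) \<and>
        (\<lambda>z. \<integral>\<omega>. exp (z * complex_of_real (X \<omega>)) \<partial>M) analytic_on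
          {z. - a < Re z \<and> Re z < b})"

definition psi :: "'a measure \<Rightarrow> ('a \<Rightarrow> real) \<Rightarrow> ('a \<Rightarrow> real) \<Rightarrow> real \<Rightarrow> complex \<Rightarrow> complex" where
  "psi M V U \<rho> s = (\<integral>\<omega>. exp (s * complex_of_real (V \<omega> - U \<omega> / \<rho>)) \<partial>M)"

text \<open>On the real axis \<^const>\<open>psi\<close> is real and positive, so this is a real function of a real
  argument.\<close>

definition log_psi :: "'a measure \<Rightarrow> ('a \<Rightarrow> real) \<Rightarrow> ('a \<Rightarrow> real) \<Rightarrow> real \<Rightarrow> real \<Rightarrow> real" where
  "log_psi M V U \<rho> \<zeta> = ln (Re (psi M V U \<rho> (complex_of_real (- \<zeta>))))"

definition separation ::
  "'a measure \<Rightarrow> ('a \<Rightarrow> real) \<Rightarrow> ('a \<Rightarrow> real) \<Rightarrow> real \<Rightarrow> real \<Rightarrow> bool" where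
  "separation M V U \<delta> \<epsilon> \<longleftrightarrow>
     integrable M (\<lambda>\<omega>. exp (\<delta> * V \<omega>)) \<and>
     (\<forall>\<rho>\<in>{1/2..<1}. \<forall>x\<in>{-\<delta>..<0}. \<forall>y. \<bar>y\<bar> > \<delta> \<longrightarrow>
        cmod (psi M V U \<rho> (Complex (- x) y)) < Re (psi M V U \<rho> (complex_of_real (- x))) - \<epsilon>)"

definition is_saddle_point :: "real \<Rightarrow> (real \<Rightarrow> real) \<Rightarrow> real \<Rightarrow> bool" where
  "is_saddle_point \<delta> h \<zeta> \<longleftrightarrow> \<zeta> \<in> {-\<delta>..0} \<and> (h has_real_derivative 0) (at \<zeta>)"

definition saddle_point :: "real \<Rightarrow> (real \<Rightarrow> real) \<Rightarrow> real" where
  "saddle_point \<delta> h = (THE \<zeta>. is_saddle_point \<delta> h \<zeta>)"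

text \<open>The law of the mean of \<open>n\<close> independent variables with common law \<open>\<mu>\<close>.\<close>

definition iid_mean_law :: "nat \<Rightarrow> real measure \<Rightarrow> real measure" where
  "iid_mean_law n \<mu> = distr (\<Pi>\<^sub>M k\<in>{1..n}. \<mu>) borel (\<lambda>x. (\<Sum>k=1..n. x k) / real n)"

text \<open>
  \<open>W\<close> has the law \<open>\<nu>\<close> of a stationary solution of the Lindley recursion of the nearly deterministic
  queue. The product measure makes the three variables on the right-hand side independent. For
  \<open>\<rho> < 1\<close> and service and interarrival means equal to \<open>1\<close> the drift is negative, so \<open>\<nu>\<close> is unique.
\<close>

definition steady_state_waiting_time ::
  "'a measure \<Rightarrow> ('a \<Rightarrow> real) \<Rightarrow> ('a \<Rightarrow> real) \<Rightarrow> nat \<Rightarrow> real \<Rightarrow> ('a \<Rightarrow> real) \<Rightarrow> bool" where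
  "steady_state_waiting_time M V U n \<rho> W \<longleftrightarrow>
     W \<in> borel_measurable M \<and> (AE \<omega> in M. 0 \<le> W \<omega>) \<and>
     (let \<nu> = distr M borel W;
          \<nu>V = iid_mean_law n (distr M borel V);
          \<nu>U = iid_mean_law n (distr M borel U)
      in \<nu> = distr (\<nu> \<Otimes>\<^sub>M (\<nu>V \<Otimes>\<^sub>M \<nu>U)) borel (\<lambda>(w, v, u). max 0 (w + v - u / \<rho>)))"

definition gaussian_steps :: "real \<Rightarrow> (nat \<Rightarrow> real) measure" where
  "gaussian_steps \<beta> = (\<Pi>\<^sub>M k\<in>UNIV. density lborel (\<lambda>x. ennreal (normal_density (- \<beta>) 1 x)))"

text \<open>
  For \<open>\<beta> > 0\<close> the partial sums tend to \<open>- \<infinity>\<close> almost surely under \<^term>\<open>gaussian_steps \<beta>\<close>,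
  so the supremum is almost surely finite and attained.
\<close>

definition walk_max :: "(nat \<Rightarrow> real) \<Rightarrow> real" where
  "walk_max x = (SUP k. \<Sum>i<k. x i)"

text \<open>
  \<open>L\<close> is the logarithm of the transform \<open>E (exp (- s X))\<close> on the half-plane \<open>Re s > - b\<close>, holomorphic
  and zero at the origin. For \<open>b > 0\<close> these conditions determine \<open>L\<close> on the half-plane; that such an
  \<open>L\<close> exists includes that the transform exists, is analytic and has no zero there.
\<close>

definition is_log_transform ::
  "'a measure \<Rightarrow> ('a \<Rightarrow> real) \<Rightarrow> real \<Rightarrow> (complex \<Rightarrow> complex) \<Rightarrow> bool" where
  "is_log_transform M X b L \<longleftrightarrow>
     L holomorphic_on {s. - b < Re s} \<and> L 0 = 0 \<and>
     (\<forall>s. - b < Re s \<longrightarrow>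
        integrable M (\<lambda>\<omega>. exp (- s * complex_of_real (X \<omega>))) \<and>
        exp (L s) = (\<integral>\<omega>. exp (- s * complex_of_real (X \<omega>)) \<partial>M))"

end

theory Submission
  imports Defs "HOL-Real_Asymp.Real_Asymp"
begin

text \<open>
  Both waiting times are stationary under a Lindley recursion \<open>W = (W + X)\<^sup>+\<close> in law. By
  Wiener--Hopf factorization and Liouville's theorem the logarithm of the transform is Spitzer's
  series, and closing contours turns it into Pollaczek's integral: up to the factor \<open>2 \<pi> i\<close>,
  \<open>log E exp (- s W)\<close> is the integral of \<open>log (1 - E exp (- u X)) (1 / (u - s) - 1 / u)\<close> along any
  vertical line on which \<open>E exp (- u X)\<close> has modulus below \<open>1\<close>.

  For the queue the line is taken through the saddle point. Let \<open>t\<close> be the distance to the saddle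
  point in units of \<open>1 / (\<sigma> sqrt n)\<close>, so that the origin sits at \<open>t = \<beta>\<close>. Then
  \<open>n h = t\<^sup>2 / 2 - \<phi> t\<^sup>3 + const + O (t ^ 4 / n)\<close>, and up to an error of the same order this equals
  \<open>(T t)\<^sup>2 / 2 - (T \<beta>)\<^sup>2 / 2\<close> with the Moebius map \<open>T t = t / (1 + \<phi> t)\<close>. This is the exponent of the
  Gaussian walk with drift \<open>- T \<beta> = - B\<close>, and \<open>T (s + \<beta>) = R + B\<close>. Since the kernel of Pollaczek's
  integral is the differential of the logarithm of a cross-ratio, it is invariant under \<open>T\<close>. Hence
  the parts \<open>\<bar>t\<bar> \<le> n powr (1 / 8)\<close> of the two integrals differ by \<open>O (1 / n)\<close>. The remaining parts are
  smaller than any power of \<open>1 / n\<close> by assumption (A), which doubling of the frequency extends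
  down to frequencies near \<open>0\<close>.
\<close>

section \<open>Exponential moments\<close>

text \<open>The obstacle is the singularity of the logarithm: both transforms must stay in a disc of
  radius \<open>q < 1\<close> that is the same for all n. On the saddle line this holds because n
  \<zeta>^2 is bounded below, a consequence of (1 - \<rho>) sqrt n \<ge> \<beta>_1, and for the
  Gaussian walk because its drift is bounded below in modulus.

  The cubic term is never treated as a perturbation. It is absorbed into the change of variable, and
  the quartic remainder is weighed against \<open>exp (- (c0 * y\<^sup>2))\<close>, so the
  integrands differ by O(1/n) pointwise on the whole middle part.

  The cutoff Y = n^(1/8) balances two demands. The Moebius image of the segment bends away from the
  imaginary axis by about \<phi> Y^2 with \<phi> = O(n^(-1/2)), which must be small against the
  distance to the poles; and exp (- c0 Y^2) must be O(1/n). Any exponent strictly between 0 and 1/4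
  would serve.

  Exponential moments of the waiting time are not given. They are extracted from stationarity,
  before any transform of it can be used.\<close>

lemma power_le_exp: 
  fixes x \<eta> :: real assumes "0 < \<eta>" "0 \<le> x"
  shows "x ^ k \<le> fact k / \<eta> ^ k * exp (\<eta> * x)"
proof -
  have s: "(\<lambda>n. (\<eta> * x) ^ n / fact n) sums exp (\<eta> * x)"
    using exp_converges[of "\<eta> * x"] by (simp add: divide_inverse mult.commute)
  have "(\<eta> * x) ^ k / fact k \<le> exp (\<eta> * x)"
    using sum_le_suminf[OF sums_summable[OF s], of "{k}"] sums_unique[OF s] assms by simp
  thus ?thesis using assms by (simp add: field_simps power_mult_distrib)
qed

text \<open>The margin \<open>\<eta>\<close> to both ends pays for the power:
  \<open>\<eta> * \<bar>x\<bar> + v * x\<close> is at most \<open>a * x\<close> for negative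
  \<open>x\<close> and at most \<open>b * x\<close> otherwise.\<close>

lemma exp_abs_weight_bound:
  fixes x v a b :: real
  assumes "a + \<eta> \<le> v" "v \<le> b - \<eta>" "0 < \<eta>"
  shows "\<bar>x\<bar> ^ k * exp (v * x) \<le> fact k / \<eta> ^ k * (exp (a * x) + exp (b * x))"
proof -
  have "\<eta> * \<bar>x\<bar> + v * x \<le> max (a * x) (b * x)"
  proof (cases "x \<ge> 0")
    case True
    have "(\<eta> + v) * x \<le> b * x" using True assms by (intro mult_right_mono) auto
    thus ?thesis using True by (simp add: algebra_simps)
  next
    case False
    have "(v - \<eta>) * x \<le> a * x" using False assms by (intro mult_right_mono_neg) auto
    thus ?thesis using False by (simp add: algebra_simps)
  qed
  hence "exp (\<eta> * \<bar>x\<bar>) * exp (v * x) \<le> exp (a * x) + exp (b * x)"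
    by (smt (verit) exp_add exp_le_cancel_iff exp_gt_zero)
  hence "fact k / \<eta> ^ k * (exp (\<eta> * \<bar>x\<bar>) * exp (v * x)) \<le> fact k / \<eta> ^ k * (exp (a * x) + exp (b * x))"
    using assms by (intro mult_left_mono) auto
  moreover have "\<bar>x\<bar> ^ k * exp (v * x) \<le> fact k / \<eta> ^ k * exp (\<eta> * \<bar>x\<bar>) * exp (v * x)"
    using power_le_exp[of \<eta> "\<bar>x\<bar>" k] assms by (intro mult_right_mono) auto
  ultimately show ?thesis by (simp add: mult.assoc)
qed

lemma integrable_power_exp:
  fixes f :: "'a \<Rightarrow> real"
  assumes [measurable]: "f \<in> borel_measurable M"
    and ia: "integrable M (\<lambda>x. exp (a * f x))" and ib: "integrable M (\<lambda>x. exp (b * f x))"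
    and "a < Re s" "Re s < b"
  shows "integrable M (\<lambda>x. of_real (f x) ^ k * exp (s * of_real (f x)))"
proof -
  define \<eta> where "\<eta> = min (Re s - a) (b - Re s)"
  have \<eta>: "0 < \<eta>" "a + \<eta> \<le> Re s" "Re s \<le> b - \<eta>" using assms by (auto simp: \<eta>_def)
  show ?thesis
  proof (rule Bochner_Integration.integrable_bound)
    show "integrable M (\<lambda>x. fact k / \<eta> ^ k * (exp (a * f x) + exp (b * f x)))"
      using ia ib by auto
    show "AE x in M. norm (complex_of_real (f x) ^ k * exp (s * of_real (f x)))
             \<le> norm (fact k / \<eta> ^ k * (exp (a * f x) + exp (b * f x)))"
    proof (rule AE_I2)
      fix x
      have "norm (complex_of_real (f x) ^ k * exp (s * of_real (f x))) = \<bar>f x\<bar> ^ k * exp (Re s * f x)"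
        by (simp add: norm_mult norm_power)
      also have "\<dots> \<le> fact k / \<eta> ^ k * (exp (a * f x) + exp (b * f x))"
        by (rule exp_abs_weight_bound) (use \<eta> in auto)
      also have "\<dots> \<le> norm (fact k / \<eta> ^ k * (exp (a * f x) + exp (b * f x)))" unfolding real_norm_def by (rule abs_ge_self)
      finally show "norm (complex_of_real (f x) ^ k * exp (s * of_real (f x)))
             \<le> norm (fact k / \<eta> ^ k * (exp (a * f x) + exp (b * f x)))" .
    qed
  qed measurable
qed

lemma has_field_derivative_if_quadratic_error:
  fixes F :: "complex \<Rightarrow> complex"
  assumes "0 < \<eta>" and err: "\<And>h. cmod h < \<eta> \<Longrightarrow> cmod (F (s + h) - F s - h * D) \<le> C * (cmod h)\<^sup>2"
  shows "(F has_field_derivative D) (at s)"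
  unfolding has_field_derivative_iff
proof (rule Lim_null[THEN iffD2], rule Lim_null_comparison)
  show "\<forall>\<^sub>F z in at s. cmod ((F z - F s) / (z - s) - D) \<le> C * cmod (z - s)"
    unfolding eventually_at
  proof (intro exI conjI ballI impI)
    show "0 < \<eta>" by fact
    fix z assume z: "z \<in> UNIV" "z \<noteq> s \<and> dist z s < \<eta>"
    have "cmod (F (s + (z - s)) - F s - (z - s) * D) \<le> C * (cmod (z - s))\<^sup>2"
      by (rule err) (use z in \<open>auto simp: dist_norm\<close>)
    moreover have "(F z - F s) / (z - s) - D = (F z - F s - (z - s) * D) / (z - s)"
      using z by (simp add: field_simps)
    ultimately show "cmod ((F z - F s) / (z - s) - D) \<le> C * cmod (z - s)"
      using z by (simp add: norm_divide divide_le_eq power2_eq_square mult.assoc)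
  qed
  show "((\<lambda>z. C * cmod (z - s)) \<longlongrightarrow> 0) (at s)"
    by (rule tendsto_eq_intros refl | simp)+
qed

text \<open>Differentiation under the integral. The power \<open>k\<close> is carried along so that
  one statement yields the derivatives of all orders.\<close>

lemma has_field_derivative_exp_moment:
  fixes f :: "'a \<Rightarrow> real"
  assumes [measurable]: "f \<in> borel_measurable M"
    and ia: "integrable M (\<lambda>x. exp (a * f x))" and ib: "integrable M (\<lambda>x. exp (b * f x))"
    and s: "a < Re s" "Re s < b"
  shows "((\<lambda>s. \<integral>x. of_real (f x) ^ k * exp (s * of_real (f x)) \<partial>M) has_field_derivative
      (\<integral>x. of_real (f x) ^ Suc k * exp (s * of_real (f x)) \<partial>M)) (at s)"
proof -
  \<comment> \<open>Half of the distance to the boundary of the strip: one \<open>\<eta>\<close>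
    absorbs the increment \<open>h\<close> in the exponent, the other the power \<open>k + 2\<close>
    in \<open>exp_abs_weight_bound\<close>.\<close>
  define \<eta> where "\<eta> = min (Re s - a) (b - Re s) / 2"
  have \<eta>: "0 < \<eta>" "a + \<eta> + \<eta> \<le> Re s" "Re s \<le> b - \<eta> - \<eta>"
    using assms by (auto simp: \<eta>_def min_def field_simps)
  define g where "g = (\<lambda>x. fact (k + 2) / \<eta> ^ (k + 2) * (exp (a * f x) + exp (b * f x)))"
  have ig: "integrable M g" unfolding g_def using ia ib by auto
  show ?thesis
  proof (rule has_field_derivative_if_quadratic_error[where \<eta> = \<eta> and C = "2 * integral\<^sup>L M g"])
    fix h assume h: "cmod h < \<eta>"
    have "\<bar>Re h\<bar> < \<eta>" using h abs_Re_le_cmod[of h] by linarith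
    hence sh: "a < Re (s + h)" "Re (s + h) < b" using \<eta> by auto
    define E where "E = (\<lambda>x. of_real (f x) ^ k * exp ((s + h) * of_real (f x)) - 
       of_real (f x) ^ k * exp (s * of_real (f x)) - h * (of_real (f x) ^ Suc k * exp (s * of_real (f x))))"
    have i1: "integrable M (\<lambda>x. of_real (f x) ^ k * exp ((s + h) * of_real (f x)))"
      by (rule integrable_power_exp[OF _ ia ib sh]) auto
    have i2: "integrable M (\<lambda>x. of_real (f x) ^ k * exp (s * of_real (f x)))"
         "integrable M (\<lambda>x. of_real (f x) ^ Suc k * exp (s * of_real (f x)))"
      by (rule integrable_power_exp[OF _ ia ib s], simp)+
    have iE: "integrable M E" unfolding E_def
      by (intro Bochner_Integration.integrable_diff integrable_mult_right i1 i2)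
    have eq: "(\<integral>x. of_real (f x) ^ k * exp ((s + h) * of_real (f x)) \<partial>M) - 
       (\<integral>x. of_real (f x) ^ k * exp (s * of_real (f x)) \<partial>M) - h * (\<integral>x. of_real (f x) ^ Suc k * exp (s * of_real (f x)) \<partial>M)
       = integral\<^sup>L M E"
      unfolding E_def using i1 i2 
      by (subst Bochner_Integration.integral_diff, intro Bochner_Integration.integrable_diff integrable_mult_right i1 i2,
          intro integrable_mult_right i2, subst Bochner_Integration.integral_diff, intro i1, intro i2, simp)
    have "cmod (E x) \<le> (cmod h)\<^sup>2 * (2 * g x)" for x
    proof -
      have "E x = of_real (f x) ^ k * exp (s * of_real (f x)) * (exp (h * of_real (f x)) - (\<Sum>i\<le>1. (h * of_real (f x)) ^ i / fact i))"
        by (simp add: E_def algebra_simps exp_add)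
      hence "cmod (E x) = \<bar>f x\<bar> ^ k * exp (Re s * f x) * cmod (exp (h * of_real (f x)) - (\<Sum>i\<le>1. (h * of_real (f x)) ^ i / fact i))"
        by (simp add: norm_mult norm_power del: sum.atMost_Suc)
      also have "\<dots> \<le> \<bar>f x\<bar> ^ k * exp (Re s * f x) * (exp \<bar>Re (h * of_real (f x))\<bar> * cmod (h * of_real (f x)) ^ (Suc 1) / fact 1)"
        by (intro mult_left_mono Taylor_exp) auto
      also have "\<dots> = (cmod h)\<^sup>2 * (\<bar>f x\<bar> ^ (k + 2) * exp (Re s * f x) * exp (\<bar>Re h\<bar> * \<bar>f x\<bar>))"
        by (simp add: norm_mult power2_eq_square abs_mult)
      also have "\<bar>f x\<bar> ^ (k + 2) * exp (Re s * f x) * exp (\<bar>Re h\<bar> * \<bar>f x\<bar>) \<le> 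
          \<bar>f x\<bar> ^ (k + 2) * exp (Re s * f x) * (exp (\<eta> * f x) + exp (- \<eta> * f x))"
      proof (intro mult_left_mono)
        have "\<bar>Re h\<bar> * \<bar>f x\<bar> \<le> \<eta> * \<bar>f x\<bar>" using \<open>\<bar>Re h\<bar> < \<eta>\<close> by (intro mult_right_mono) auto
        hence "exp (\<bar>Re h\<bar> * \<bar>f x\<bar>) \<le> exp (\<eta> * \<bar>f x\<bar>)" by simp
        also have "\<dots> \<le> exp (\<eta> * f x) + exp (- \<eta> * f x)" by (cases "f x \<ge> 0") auto
        finally show "exp (\<bar>Re h\<bar> * \<bar>f x\<bar>) \<le> exp (\<eta> * f x) + exp (- \<eta> * f x)" .
      qed auto
      also have "\<dots> = \<bar>f x\<bar> ^ (k + 2) * exp ((Re s + \<eta>) * f x) + \<bar>f x\<bar> ^ (k + 2) * exp ((Re s - \<eta>) * f x)"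
        by (simp add: algebra_simps exp_add exp_diff exp_minus divide_inverse)
      also have "\<dots> \<le> g x + g x" unfolding g_def
        by (intro add_mono exp_abs_weight_bound) (use \<eta> in auto)
      finally show ?thesis by (simp add: mult_left_mono)
    qed
    hence "cmod (integral\<^sup>L M E) \<le> (\<integral>x. (cmod h)\<^sup>2 * (2 * g x) \<partial>M)"
      using iE ig by (intro order_trans[OF integral_norm_bound] integral_mono) auto
    also have "\<dots> = 2 * integral\<^sup>L M g * (cmod h)\<^sup>2" using ig by simp
    finally show "cmod ((\<integral>x. of_real (f x) ^ k * exp ((s + h) * of_real (f x)) \<partial>M) - 
       (\<integral>x. of_real (f x) ^ k * exp (s * of_real (f x)) \<partial>M) - h * (\<integral>x. of_real (f x) ^ Suc k * exp (s * of_real (f x)) \<partial>M))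
      \<le> 2 * integral\<^sup>L M g * (cmod h)\<^sup>2" unfolding eq .
  qed (use \<eta> in auto)
qed

lemma holomorphic_on_exp_moment:
  fixes f :: "'a \<Rightarrow> real"
  assumes "f \<in> borel_measurable M"
    and "integrable M (\<lambda>x. exp (a * f x))" and "integrable M (\<lambda>x. exp (b * f x))"
  shows "(\<lambda>s. \<integral>x. exp (s * of_real (f x)) \<partial>M) holomorphic_on {s. a < Re s \<and> Re s < b}"
proof (rule holomorphic_onI)
  fix s assume "s \<in> {s. a < Re s \<and> Re s < b}"
  hence "a < Re s" "Re s < b" by auto
  from has_field_derivative_exp_moment[OF assms this, of 0]
  show "(\<lambda>s. \<integral>x. exp (s * of_real (f x)) \<partial>M) field_differentiable at s within {s. a < Re s \<and> Re s < b}"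
    by (auto simp: field_differentiable_def intro: has_field_derivative_at_within)
qed

lemma (in finite_measure) integrable_exp_le_nonneg:
  fixes f :: "'a \<Rightarrow> real"
  assumes [measurable]: "f \<in> borel_measurable M" and nn: "AE x in M. 0 \<le> f x"
    and ib: "integrable M (\<lambda>x. exp (b * f x))" and s: "Re s \<le> b"
  shows "integrable M (\<lambda>x. exp (s * of_real (f x)))"
proof (rule Bochner_Integration.integrable_bound[OF ib])
  show "AE x in M. norm (exp (s * of_real (f x))) \<le> norm (exp (b * f x))"
    using nn by eventually_elim (use s in \<open>simp add: mult_right_mono\<close>)
qed measurable

lemma (in finite_measure) holomorphic_on_exp_moment_nonneg:
  fixes f :: "'a \<Rightarrow> real"
  assumes [measurable]: "f \<in> borel_measurable M" and nn: "AE x in M. 0 \<le> f x"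
    and ib: "integrable M (\<lambda>x. exp (b * f x))"
  shows "(\<lambda>s. \<integral>x. exp (s * of_real (f x)) \<partial>M) holomorphic_on {s. Re s < b}"
proof (rule holomorphic_onI)
  fix s assume "s \<in> {s. Re s < b}"
  hence s: "Re s < b" by simp
  \<comment> \<open>Since \<open>f\<close> is nonnegative, every exponent below \<open>b\<close> is
    integrable, and the left end of the strip may be put anywhere below \<open>Re s\<close>.\<close>
  have ia: "integrable M (\<lambda>x. exp ((Re s - 1) * f x))"
  proof (rule Bochner_Integration.integrable_bound[OF ib])
    show "AE x in M. norm (exp ((Re s - 1) * f x)) \<le> norm (exp (b * f x))"
      using nn by eventually_elim (use s in \<open>simp add: mult_right_mono\<close>)
  qed measurable
  show "(\<lambda>s. \<integral>x. exp (s * of_real (f x)) \<partial>M) field_differentiable at s within {s. Re s < b}"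
    using has_field_derivative_exp_moment[OF assms(1) ia ib, of s 0] s
    by (auto simp: field_differentiable_def intro: has_field_derivative_at_within)
qed

section \<open>The Lindley recursion and Spitzer's series\<close>

lemma (in pair_sigma_finite)
  fixes f :: "'a \<Rightarrow> 'c :: {real_normed_field, banach, second_countable_topology}"
  assumes f: "integrable M1 f" and g: "integrable M2 g"
  shows integrable_pair_mult: "integrable (M1 \<Otimes>\<^sub>M M2) (\<lambda>(x, y). f x * g y)"
    and integral_pair_mult:
      "(\<integral>z. (case z of (x, y) \<Rightarrow> f x * g y) \<partial>(M1 \<Otimes>\<^sub>M M2)) = integral\<^sup>L M1 f * integral\<^sup>L M2 g"
proof -
  have [measurable]: "f \<in> borel_measurable M1" "g \<in> borel_measurable M2"
    using f g by auto
  show 1: "integrable (M1 \<Otimes>\<^sub>M M2) (\<lambda>(x, y). f x * g y)"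
  proof (rule Fubini_integrable)
    show "integrable M1 (\<lambda>x. \<integral>y. norm (case (x, y) of (x, y) \<Rightarrow> f x * g y) \<partial>M2)"
      using f g by (simp add: norm_mult)
    show "AE x in M1. integrable M2 (\<lambda>y. case (x, y) of (x, y) \<Rightarrow> f x * g y)"
      using g by auto
  qed measurable
  show "(\<integral>z. (case z of (x, y) \<Rightarrow> f x * g y) \<partial>(M1 \<Otimes>\<^sub>M M2)) = integral\<^sup>L M1 f * integral\<^sup>L M2 g"
    using integral_fst'[OF 1] f g by simp
qed

text \<open>The Weierstrass test gives uniform convergence on all of \<open>A\<close>, and locally
  uniform limits of holomorphic functions are holomorphic.\<close>

lemma holomorphic_on_suminf:
  fixes f :: "nat \<Rightarrow> complex \<Rightarrow> complex"
  assumes "open A" and hol: "\<And>n. f n holomorphic_on A"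
    and bnd: "\<And>n x. x \<in> A \<Longrightarrow> norm (f n x) \<le> b n" and "summable b"
  shows "(\<lambda>x. \<Sum>n. f n x) holomorphic_on A"
proof (rule holomorphic_uniform_sequence[OF \<open>open A\<close>])
  show "(\<lambda>x. \<Sum>i<n. f i x) holomorphic_on A" for n
    by (intro holomorphic_on_sum hol)
  have ul: "uniform_limit A (\<lambda>n x. \<Sum>i<n. f i x) (\<lambda>x. \<Sum>n. f n x) sequentially"
    using bnd \<open>summable b\<close> by (rule Weierstrass_m_test)
  fix x assume "x \<in> A"
  then obtain d where "0 < d" "cball x d \<subseteq> A"
    using \<open>open A\<close> open_contains_cball by blast
  thus "\<exists>d>0. cball x d \<subseteq> A \<and>
        uniform_limit (cball x d) (\<lambda>n x. \<Sum>i<n. f i x) (\<lambda>x. \<Sum>n. f n x) sequentially"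
    using uniform_limit_on_subset[OF ul] by blast
qed

section \<open>Convolution powers: the laws of the partial sums\<close>

abbreviation conv_power :: "real measure \<Rightarrow> nat \<Rightarrow> real measure" where
  "conv_power \<mu> k \<equiv> ((\<star>) \<mu> ^^ k) (return borel 0)"

lemma prob_space_convolution:
  fixes \<mu> \<nu> :: "real measure"
  assumes "prob_space \<mu>" "prob_space \<nu>" "sets \<mu> = sets borel" "sets \<nu> = sets borel"
  shows "prob_space (\<mu> \<star> \<nu>)"
proof -
  interpret A: prob_space \<mu> by fact
  interpret B: prob_space \<nu> by fact
  interpret pair_prob_space \<mu> \<nu> ..
  note [measurable_cong] = assms(3,4)
  show ?thesis unfolding convolution_def by (rule prob_space_distr) measurable
qed

lemma prob_space_conv_power:
  assumes "prob_space \<mu>" "sets \<mu> = sets borel"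
  shows "prob_space (conv_power \<mu> k)" and "sets (conv_power \<mu> k) = sets borel"
proof -
  have "prob_space (conv_power \<mu> k) \<and> sets (conv_power \<mu> k) = sets borel"
  proof (induction k)
    case (Suc k)
    thus ?case using prob_space_convolution[of \<mu> "conv_power \<mu> k"] assms by simp
  qed (auto intro: prob_space_return)
  thus "prob_space (conv_power \<mu> k)" "sets (conv_power \<mu> k) = sets borel" by auto
qed

lemma exp_convolution:
  fixes z :: "'a :: {real_normed_field, banach, second_countable_topology}"
  assumes "prob_space \<mu>" "prob_space \<nu>" "sets \<mu> = sets borel" "sets \<nu> = sets borel"
    and "integrable \<mu> (\<lambda>x. exp (z * of_real x))" "integrable \<nu> (\<lambda>x. exp (z * of_real x))"
  shows "integrable (\<mu> \<star> \<nu>) (\<lambda>x. exp (z * of_real x))"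
    and "(\<integral>x. exp (z * of_real x) \<partial>(\<mu> \<star> \<nu>)) = (\<integral>x. exp (z * of_real x) \<partial>\<mu>) * (\<integral>x. exp (z * of_real x) \<partial>\<nu>)"
proof -
  interpret A: prob_space \<mu> by fact
  interpret B: prob_space \<nu> by fact
  interpret pair_prob_space \<mu> \<nu> ..
  note [measurable_cong] = assms(3,4)
  have e: "(\<lambda>p. exp (z * of_real (case p of (x, y) \<Rightarrow> x + y))) = (\<lambda>(x, y). exp (z * of_real x) * exp (z * of_real y))"
    by (auto simp: fun_eq_iff exp_add algebra_simps)
  show "integrable (\<mu> \<star> \<nu>) (\<lambda>x. exp (z * of_real x))"
    unfolding convolution_def using integrable_pair_mult[OF assms(5,6)]
    by (subst integrable_distr_eq) (simp_all add: e)
  show "(\<integral>x. exp (z * of_real x) \<partial>(\<mu> \<star> \<nu>)) = (\<integral>x. exp (z * of_real x) \<partial>\<mu>) * (\<integral>x. exp (z * of_real x) \<partial>\<nu>)"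
    unfolding convolution_def using integral_pair_mult[OF assms(5,6)]
    by (subst integral_distr) (simp_all add: e)
qed

text \<open>The type of \<open>z\<close> stays open because both instances are wanted: the real one
  bounds the terms of Spitzer's series, the complex one evaluates them.\<close>

lemma exp_conv_power:
  fixes z :: "'a :: {real_normed_field, banach, second_countable_topology}"
  assumes "prob_space \<mu>" "sets \<mu> = sets borel" "integrable \<mu> (\<lambda>x. exp (z * of_real x))"
  shows "integrable (conv_power \<mu> k) (\<lambda>x. exp (z * of_real x))"
    and "(\<integral>x. exp (z * of_real x) \<partial>conv_power \<mu> k) = (\<integral>x. exp (z * of_real x) \<partial>\<mu>) ^ k"
proof -
  have "integrable (conv_power \<mu> k) (\<lambda>x. exp (z * of_real x)) \<and>
     (\<integral>x. exp (z * of_real x) \<partial>conv_power \<mu> k) = (\<integral>x. exp (z * of_real x) \<partial>\<mu>) ^ k"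
  proof (induction k)
    case 0
    have "integrable (return borel 0) (\<lambda>x :: real. exp (z * of_real x))"
      by (rule integrable_cong_AE_imp[of "return borel 0" "\<lambda>_. 1"])
         (auto simp: AE_return intro!: finite_measure.integrable_const prob_space.finite_measure prob_space_return)
    moreover have "(\<integral>x. exp (z * of_real x) \<partial>return borel (0 :: real)) = 1"
      by (subst integral_return) auto
    ultimately show ?case by simp
  next
    case (Suc k)
    with exp_convolution[OF assms(1) prob_space_conv_power(1)[OF assms(1,2)] assms(2)
        prob_space_conv_power(2)[OF assms(1,2)] assms(3), of k]
    show ?case by simp
  qed
  thus "integrable (conv_power \<mu> k) (\<lambda>x. exp (z * of_real x))"
    "(\<integral>x. exp (z * of_real x) \<partial>conv_power \<mu> k) = (\<integral>x. exp (z * of_real x) \<partial>\<mu>) ^ k" by auto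
qed

text \<open>Only laws enter, so the same results serve the queue, where a waiting time is given, and
  the Gaussian walk, where it is constructed. The right end \<open>c\<^sub>1\<close> of the strip
  controls the positive parts of the partial sums, the left end \<open>c\<^sub>2\<close> their
  negative parts; between them lies the overlap of the two half-planes of the Wiener-Hopf
  method.\<close>

locale lindley_stationary = step: prob_space \<mu> + wait: prob_space \<nu>
  for \<mu> \<nu> :: "real measure" +
  fixes c\<^sub>1 c\<^sub>2 :: real
  assumes sets_step [measurable_cong]: "sets \<mu> = sets borel"
    and sets_wait [measurable_cong]: "sets \<nu> = sets borel"
    and wait_nonneg: "AE w in \<nu>. 0 \<le> w"
    and stationary: "\<nu> = distr (\<nu> \<Otimes>\<^sub>M \<mu>) borel (\<lambda>(w, x). max 0 (w + x))"
    and strip: "0 < c\<^sub>2" "c\<^sub>2 < c\<^sub>1"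
    and step_exp: "\<And>\<theta>. c\<^sub>2 \<le> \<theta> \<Longrightarrow> \<theta> \<le> c\<^sub>1 \<Longrightarrow> integrable \<mu> (\<lambda>x. exp (\<theta> * x))"
    and step_exp_less_1: "\<And>\<theta>. c\<^sub>2 \<le> \<theta> \<Longrightarrow> \<theta> \<le> c\<^sub>1 \<Longrightarrow> (\<integral>x. exp (\<theta> * x) \<partial>\<mu>) < 1"
begin

sublocale pair: pair_prob_space \<nu> \<mu> ..

text \<open>
  The stationary mean of the truncation \<open>min K (q ^ k * exp (c\<^sub>1 * w) + C * (1 - q ^ k))\<close> is
  nondecreasing in \<open>k\<close>, and as \<open>k\<close> tends to infinity it tends to \<open>min K C\<close>.
\<close>

lemma integrable_wait_exp: "integrable \<nu> (\<lambda>w. exp (c\<^sub>1 * w))"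
proof -
  define q where "q = (\<integral>x. exp (c\<^sub>1 * x) \<partial>\<mu>)"
  have ie: "integrable \<mu> (\<lambda>x. exp (c\<^sub>1 * x))" and q: "0 \<le> q" "q < 1"
    using step_exp[of c\<^sub>1] step_exp_less_1[of c\<^sub>1] strip by (auto simp: q_def)
  \<comment> \<open>From \<open>exp (c\<^sub>1 * max 0 (w + x)) \<le> exp (c\<^sub>1 * w) * exp
    (c\<^sub>1 * x) + 1\<close>, a step acts in the mean like the map sending y to q y + 1, whose
    fixed point is \<open>C\<close>.\<close>
  define C where "C = 1 / (1 - q)"
  have C: "0 \<le> C" "1 = C * (1 - q)" using q by (auto simp: C_def)
  \<comment> \<open>Without the cap \<open>K\<close> the argument would be circular: the mean of
    \<open>exp (c\<^sub>1 * w)\<close> is not yet known to be finite.\<close>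
  define f where "f = (\<lambda>K k w. min K (q ^ k * exp (c\<^sub>1 * w) + C * (1 - q ^ k)))"
  have fm [measurable]: "f K k \<in> borel_measurable borel" for K k unfolding f_def by measurable
  have f0: "0 \<le> f K k w" if "0 \<le> K" for K k w
    unfolding f_def using that q C by (auto simp: power_le_one)
  have fK: "f K k w \<le> K" for K k w by (simp add: f_def)
  have fi: "integrable N (\<lambda>x. f K k (h x))" 
    if "prob_space N" "h \<in> borel_measurable N" "0 \<le> K" for K k N and h :: "_ \<Rightarrow> real"
  proof -
    interpret prob_space N by fact
    note [measurable] = that(2)
    show ?thesis using f0[OF that(3)] fK by (intro integrable_const_bound[of _ K]) auto
  qed
  have step_le: "(\<integral>w. f K k w \<partial>\<nu>) \<le> (\<integral>w. f K (Suc k) w \<partial>\<nu>)" if K: "0 \<le> K" for K k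
  proof -
    have inner: "(\<integral>x. f K k (max 0 (w + x)) \<partial>\<mu>) \<le> f K (Suc k) w" for w
    proof -
      have i: "integrable \<mu> (\<lambda>x. f K k (max 0 (w + x)))"
        by (rule fi[OF _ _ K]) (auto intro: step.prob_space_axioms)
      have "(\<integral>x. f K k (max 0 (w + x)) \<partial>\<mu>) \<le> (\<integral>x. K \<partial>\<mu>)"
        using i fK by (intro integral_mono) auto
      hence 1: "(\<integral>x. f K k (max 0 (w + x)) \<partial>\<mu>) \<le> K" by (simp add: step.prob_space)
      have ii: "integrable \<mu> (\<lambda>x. q ^ k * (exp (c\<^sub>1 * w) * exp (c\<^sub>1 * x) + 1) + C * (1 - q ^ k))"
        using ie by auto
      have "(\<integral>x. f K k (max 0 (w + x)) \<partial>\<mu>) \<le> (\<integral>x. q ^ k * (exp (c\<^sub>1 * w) * exp (c\<^sub>1 * x) + 1) + C * (1 - q ^ k) \<partial>\<mu>)"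
      proof (intro integral_mono i ii)
        fix x
        have "exp (c\<^sub>1 * max 0 (w + x)) \<le> exp (c\<^sub>1 * w) * exp (c\<^sub>1 * x) + 1"
          by (simp add: max_def exp_add[symmetric] algebra_simps)
        hence "q ^ k * exp (c\<^sub>1 * max 0 (w + x)) \<le> q ^ k * (exp (c\<^sub>1 * w) * exp (c\<^sub>1 * x) + 1)"
          using q by (intro mult_left_mono) auto
        thus "f K k (max 0 (w + x)) \<le> q ^ k * (exp (c\<^sub>1 * w) * exp (c\<^sub>1 * x) + 1) + C * (1 - q ^ k)"
          by (simp add: f_def)
      qed
      also have "\<dots> = q ^ k * (exp (c\<^sub>1 * w) * q + 1) + C * (1 - q ^ k)"
        using ie by (simp add: q_def step.prob_space)
      also have "\<dots> = q ^ Suc k * exp (c\<^sub>1 * w) + q ^ k * (C * (1 - q)) + C * (1 - q ^ k)"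
        unfolding C(2)[symmetric] by (simp add: algebra_simps)
      also have "\<dots> = q ^ Suc k * exp (c\<^sub>1 * w) + C * (1 - q ^ Suc k)"
        by (simp add: algebra_simps)
      finally show ?thesis using 1 by (simp add: f_def)
    qed
    have i2: "integrable (\<nu> \<Otimes>\<^sub>M \<mu>) (\<lambda>p. f K k (case p of (w, x) \<Rightarrow> max 0 (w + x)))"
      by (rule fi[OF _ _ K]) (auto intro: pair.prob_space_axioms)
    have "(\<integral>w. f K k w \<partial>\<nu>) = (\<integral>w. f K k w \<partial>distr (\<nu> \<Otimes>\<^sub>M \<mu>) borel (\<lambda>(w, x). max 0 (w + x)))"
      using stationary by simp
    also have "\<dots> = (\<integral>p. f K k (case p of (w, x) \<Rightarrow> max 0 (w + x)) \<partial>(\<nu> \<Otimes>\<^sub>M \<mu>))"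
      by (rule integral_distr) auto
    also have "\<dots> = (\<integral>w. (\<integral>x. f K k (max 0 (w + x)) \<partial>\<mu>) \<partial>\<nu>)"
      using pair.integral_fst'[OF i2] by simp
    also have "\<dots> \<le> (\<integral>w. f K (Suc k) w \<partial>\<nu>)"
    proof (intro integral_mono inner)
      show "integrable \<nu> (\<lambda>w. \<integral>x. f K k (max 0 (w + x)) \<partial>\<mu>)"
        using pair.integrable_fst'[OF i2] by simp
      show "integrable \<nu> (f K (Suc k))"
        using fi[OF wait.prob_space_axioms _ K, of "\<lambda>x. x"] by simp
    qed
    finally show ?thesis .
  qed
  have bnd: "(\<integral>w. min K (exp (c\<^sub>1 * w)) \<partial>\<nu>) \<le> C" if K: "0 \<le> K" for K
  proof -
    have "(\<integral>w. f K 0 w \<partial>\<nu>) \<le> (\<integral>w. f K k w \<partial>\<nu>)" for k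
      by (induction k) (auto intro: order_trans[OF _ step_le[OF K]])
    moreover have "(\<lambda>k. \<integral>w. f K k w \<partial>\<nu>) \<longlonglongrightarrow> (\<integral>w. min K (0 * exp (c\<^sub>1 * w) + C * (1 - 0)) \<partial>\<nu>)"
    proof (rule integral_dominated_convergence[where w = "\<lambda>_. K"])
      show "AE w in \<nu>. (\<lambda>k. f K k w) \<longlonglongrightarrow> min K (0 * exp (c\<^sub>1 * w) + C * (1 - 0))"
        unfolding f_def using q by (intro AE_I2 tendsto_intros LIMSEQ_power_zero) auto
      show "\<And>k. AE w in \<nu>. norm (f K k w) \<le> K" using f0[OF K] fK by auto
    qed auto
    ultimately have "(\<integral>w. f K 0 w \<partial>\<nu>) \<le> (\<integral>w. min K (0 * exp (c\<^sub>1 * w) + C * (1 - 0)) \<partial>\<nu>)"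
      by (intro LIMSEQ_le_const) auto
    also have "\<dots> \<le> C" by (simp add: wait.prob_space)
    finally show ?thesis by (simp add: f_def)
  qed
  \<comment> \<open>The bound \<open>C\<close> is the same for every cap, so the cap is removed by
    monotone convergence.\<close>
  define I where "I = (\<lambda>j. \<integral>w. min (real j) (exp (c\<^sub>1 * w)) \<partial>\<nu>)"
  have ij: "integrable \<nu> (\<lambda>w. min (real j) (exp (c\<^sub>1 * w)))" for j
    using fi[OF wait.prob_space_axioms _ of_nat_0_le_iff, of "\<lambda>x. x" j 0] by (simp add: f_def)
  have "incseq I" unfolding I_def by (intro incseq_SucI integral_mono ij) auto
  moreover have "\<And>j. I j \<le> C" unfolding I_def by (intro bnd) auto
  ultimately obtain l where l: "I \<longlonglongrightarrow> l" using incseq_convergent[of I C] by blast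
  show ?thesis
  proof (rule integrable_monotone_convergence[OF ij])
    show "AE w in \<nu>. mono (\<lambda>j. min (real j) (exp (c\<^sub>1 * w)))"
      by (auto intro!: AE_I2 monoI)
    show "AE w in \<nu>. (\<lambda>j. min (real j) (exp (c\<^sub>1 * w))) \<longlonglongrightarrow> exp (c\<^sub>1 * w)"
    proof (rule AE_I2)
      fix w
      obtain j0 where "exp (c\<^sub>1 * w) \<le> real j0" using real_arch_simple by blast
      hence "\<forall>\<^sub>F j in sequentially. min (real j) (exp (c\<^sub>1 * w)) = exp (c\<^sub>1 * w)"
        by (intro eventually_sequentiallyI[of j0]) (auto simp: min_def intro: order_trans)
      thus "(\<lambda>j. min (real j) (exp (c\<^sub>1 * w))) \<longlonglongrightarrow> exp (c\<^sub>1 * w)"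
        by (rule tendsto_eventually)
    qed
    show "(\<lambda>j. \<integral>w. min (real j) (exp (c\<^sub>1 * w)) \<partial>\<nu>) \<longlonglongrightarrow> l" using l by (simp add: I_def)
  qed auto
qed

section \<open>Spitzer's series and its two halves\<close>

lemmas conv_power_step = prob_space_conv_power[OF step.prob_space_axioms sets_step]

definition step_lt :: "complex \<Rightarrow> complex" where
  "step_lt s = (\<integral>x. exp (- s * of_real x) \<partial>\<mu>)"

definition step_mgf :: "real \<Rightarrow> real" where
  "step_mgf \<theta> = (\<integral>x. exp (\<theta> * x) \<partial>\<mu>)"

text \<open>The term with index \<open>k\<close> belongs to the sum of \<open>Suc k\<close> steps.
  Subtracting 1 discards the paths whose sum is not positive, which leaves geometrically small terms
  and makes the series vanish at 0.\<close>

definition spitzer_pos :: "complex \<Rightarrow> complex" where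
  "spitzer_pos s = (\<Sum>k. ((\<integral>x. exp (- s * of_real (max 0 x)) \<partial>conv_power \<mu> (Suc k)) - 1) / of_nat (Suc k))"

text \<open>Here no 1 is subtracted. The mass of the positive sums, collapsed to the point 0, is
  kept; it is geometrically small by itself, and with it the two series add up exactly to that of
  \<open>- Ln (1 - step_lt s)\<close>.\<close>

definition spitzer_neg :: "complex \<Rightarrow> complex" where
  "spitzer_neg s = (\<Sum>k. (\<integral>x. exp (- s * of_real (min 0 x)) \<partial>conv_power \<mu> (Suc k)) / of_nat (Suc k))"

lemma step_mgf_bounds: "c\<^sub>2 \<le> \<theta> \<Longrightarrow> \<theta> \<le> c\<^sub>1 \<Longrightarrow> 0 \<le> step_mgf \<theta> \<and> step_mgf \<theta> < 1"
  using step_exp_less_1 by (auto simp: step_mgf_def)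

lemma integrable_step_lt:
  assumes "c\<^sub>2 \<le> - Re s" "- Re s \<le> c\<^sub>1"
  shows "integrable \<mu> (\<lambda>x. exp (- s * of_real x))"
  by (rule Bochner_Integration.integrable_bound[OF step_exp[OF assms]]) (auto simp: mult_ac)

lemma norm_step_lt_le:
  assumes "c\<^sub>2 \<le> - Re s" "- Re s \<le> c\<^sub>1"
  shows "cmod (step_lt s) \<le> step_mgf (- Re s)"
proof -
  have "cmod (step_lt s) \<le> (\<integral>x. norm (exp (- s * of_real x)) \<partial>\<mu>)"
    unfolding step_lt_def by (rule integral_norm_bound)
  thus ?thesis by (simp add: step_mgf_def)
qed

text \<open>The integrand minus 1 vanishes for x \<le> 0, and for x > 0 both of its terms are at
  most \<open>exp (c\<^sub>1 * x)\<close> in modulus, whose integral over the convolution power is a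
  power.\<close>

lemma
  assumes s: "- c\<^sub>1 \<le> Re s"
  shows spitzer_pos_integrable: "integrable (conv_power \<mu> k) (\<lambda>x. exp (- s * of_real (max 0 x)))"
    and spitzer_pos_term_le: "cmod ((\<integral>x. exp (- s * of_real (max 0 x)) \<partial>conv_power \<mu> k) - 1) \<le> 2 * step_mgf c\<^sub>1 ^ k"
proof -
  interpret P: prob_space "conv_power \<mu> k"
    by (rule conv_power_step)
  have [measurable_cong]: "sets (conv_power \<mu> k) = sets borel"
    by (rule conv_power_step)
  have ic: "integrable (conv_power \<mu> k) (\<lambda>x. exp (c\<^sub>1 * x))"
    and vc: "(\<integral>x. exp (c\<^sub>1 * x) \<partial>conv_power \<mu> k) = step_mgf c\<^sub>1 ^ k"
    using exp_conv_power[of \<mu> c\<^sub>1 k] step.prob_space_axioms sets_step step_exp[of c\<^sub>1] strip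
    by (auto simp: step_mgf_def)
  have b: "cmod (exp (- s * of_real (max 0 x)) - 1) \<le> 2 * exp (c\<^sub>1 * x)" for x :: real
  proof (cases "x \<le> 0")
    case False
    have "cmod (exp (- s * of_real (max 0 x)) - 1) \<le> exp (- Re s * x) + 1"
      using False norm_triangle_ineq4[of "exp (- s * of_real (max 0 x))" 1] by simp
    also have "exp (- Re s * x) \<le> exp (c\<^sub>1 * x)"
      using False s mult_right_mono[of "- Re s" c\<^sub>1 x] by simp
    also have "1 \<le> exp (c\<^sub>1 * x)" using False strip by simp
    finally show ?thesis by simp
  qed (simp add: max_def)
  have i1: "integrable (conv_power \<mu> k) (\<lambda>x. exp (- s * of_real (max 0 x)) - 1)"
    by (rule Bochner_Integration.integrable_bound[where f = "\<lambda>x. 2 * exp (c\<^sub>1 * x)"])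
       (use ic b in auto)
  have "integrable (conv_power \<mu> k) (\<lambda>x. (exp (- s * of_real (max 0 x)) - 1) + 1)"
    by (rule Bochner_Integration.integrable_add[OF i1]) simp
  thus i2: "integrable (conv_power \<mu> k) (\<lambda>x. exp (- s * of_real (max 0 x)))" by simp
  have "(\<integral>x. exp (- s * of_real (max 0 x)) \<partial>conv_power \<mu> k) - 1 = (\<integral>x. exp (- s * of_real (max 0 x)) - 1 \<partial>conv_power \<mu> k)"
    using i2 by (simp add: P.prob_space)
  also have "cmod \<dots> \<le> (\<integral>x. 2 * exp (c\<^sub>1 * x) \<partial>conv_power \<mu> k)"
    using i1 ic b by (intro order_trans[OF integral_norm_bound] integral_mono) auto
  finally show "cmod ((\<integral>x. exp (- s * of_real (max 0 x)) \<partial>conv_power \<mu> k) - 1) \<le> 2 * step_mgf c\<^sub>1 ^ k"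
    using ic vc by simp
qed

text \<open>For x \<le> 0 the condition on \<open>s\<close> gives the bound
  \<open>exp (c\<^sub>2 * x)\<close>; for x > 0 the integrand is 1, which lies below the same
  bound.\<close>

lemma
  assumes s: "Re s \<le> - c\<^sub>2"
  shows spitzer_neg_integrable: "integrable (conv_power \<mu> k) (\<lambda>x. exp (- s * of_real (min 0 x)))"
    and spitzer_neg_term_le: "cmod (\<integral>x. exp (- s * of_real (min 0 x)) \<partial>conv_power \<mu> k) \<le> step_mgf c\<^sub>2 ^ k"
proof -
  have [measurable_cong]: "sets (conv_power \<mu> k) = sets borel"
    by (rule conv_power_step)
  have ic: "integrable (conv_power \<mu> k) (\<lambda>x. exp (c\<^sub>2 * x))"
    and vc: "(\<integral>x. exp (c\<^sub>2 * x) \<partial>conv_power \<mu> k) = step_mgf c\<^sub>2 ^ k"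
    using exp_conv_power[of \<mu> c\<^sub>2 k] step.prob_space_axioms sets_step step_exp[of c\<^sub>2] strip
    by (auto simp: step_mgf_def)
  have b: "cmod (exp (- s * of_real (min 0 x))) \<le> exp (c\<^sub>2 * x)" for x :: real
  proof -
    have "- Re s * min 0 x \<le> c\<^sub>2 * x"
    proof (cases "x \<le> 0")
      case True thus ?thesis using s mult_right_mono_neg[of "c\<^sub>2" "- Re s" x] by (simp add: min_def)
    qed (use strip in \<open>simp add: min_def\<close>)
    thus ?thesis by simp
  qed
  show i2: "integrable (conv_power \<mu> k) (\<lambda>x. exp (- s * of_real (min 0 x)))"
    by (rule Bochner_Integration.integrable_bound[OF ic]) (use b in auto)
  have "cmod (\<integral>x. exp (- s * of_real (min 0 x)) \<partial>conv_power \<mu> k) \<le> (\<integral>x. exp (c\<^sub>2 * x) \<partial>conv_power \<mu> k)"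
    by (intro order_trans[OF integral_norm_bound] integral_mono integrable_norm[OF i2] ic b)
  thus "cmod (\<integral>x. exp (- s * of_real (min 0 x)) \<partial>conv_power \<mu> k) \<le> step_mgf c\<^sub>2 ^ k"
    using vc by simp
qed

lemma summable_step_mgf_power: "c\<^sub>2 \<le> \<theta> \<Longrightarrow> \<theta> \<le> c\<^sub>1 \<Longrightarrow> summable (\<lambda>k. C * step_mgf \<theta> ^ Suc k)"
  using step_mgf_bounds[of \<theta>] by (intro summable_mult) (simp add: summable_geometric)

lemma norm_div_Suc_le:
  fixes z :: complex assumes "cmod z \<le> b" shows "cmod (z / of_nat (Suc k)) \<le> b"
proof -
  have "cmod z / real (Suc k) \<le> cmod z / 1" by (intro divide_left_mono) auto
  thus ?thesis using assms by (simp add: norm_divide del: of_nat_Suc)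
qed

lemma
  shows spitzer_pos_summable: "- c\<^sub>1 \<le> Re s \<Longrightarrow>
     summable (\<lambda>k. ((\<integral>x. exp (- s * of_real (max 0 x)) \<partial>conv_power \<mu> (Suc k)) - 1) / of_nat (Suc k))"
    and norm_spitzer_pos_le: "- c\<^sub>1 \<le> Re s \<Longrightarrow> cmod (spitzer_pos s) \<le> (\<Sum>k. 2 * step_mgf c\<^sub>1 ^ Suc k)"
    and spitzer_neg_summable: "Re s \<le> - c\<^sub>2 \<Longrightarrow>
     summable (\<lambda>k. (\<integral>x. exp (- s * of_real (min 0 x)) \<partial>conv_power \<mu> (Suc k)) / of_nat (Suc k))"
    and norm_spitzer_neg_le: "Re s \<le> - c\<^sub>2 \<Longrightarrow> cmod (spitzer_neg s) \<le> (\<Sum>k. 1 * step_mgf c\<^sub>2 ^ Suc k)"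
proof -
  have *: "summable f \<and> cmod (suminf f) \<le> suminf g" if "\<And>k. cmod (f k) \<le> g k" "summable g" 
    for f :: "nat \<Rightarrow> complex" and g
  proof
    have sn: "summable (\<lambda>k. cmod (f k))" by (rule summable_comparison_test'[OF that(2), of 0]) (use that in auto)
    thus "summable f" by (rule summable_norm_cancel)
    show "cmod (suminf f) \<le> suminf g"
      by (rule order_trans[OF summable_norm[OF sn] suminf_le[OF _ sn that(2)]]) (use that in auto)
  qed
  have 1: "cmod (((\<integral>x. exp (- s * of_real (max 0 x)) \<partial>conv_power \<mu> (Suc k)) - 1) / of_nat (Suc k))
     \<le> 2 * step_mgf c\<^sub>1 ^ Suc k" if "- c\<^sub>1 \<le> Re s" for k
    by (intro norm_div_Suc_le spitzer_pos_term_le that)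
  have 2: "cmod ((\<integral>x. exp (- s * of_real (min 0 x)) \<partial>conv_power \<mu> (Suc k)) / of_nat (Suc k))
     \<le> 1 * step_mgf c\<^sub>2 ^ Suc k" if "Re s \<le> - c\<^sub>2" for k
    unfolding mult_1 by (intro norm_div_Suc_le spitzer_neg_term_le that)
  note s = summable_step_mgf_power[of c\<^sub>1 2] summable_step_mgf_power[of c\<^sub>2 1]
  show "- c\<^sub>1 \<le> Re s \<Longrightarrow>
     summable (\<lambda>k. ((\<integral>x. exp (- s * of_real (max 0 x)) \<partial>conv_power \<mu> (Suc k)) - 1) / of_nat (Suc k))"
    "- c\<^sub>1 \<le> Re s \<Longrightarrow> cmod (spitzer_pos s) \<le> (\<Sum>k. 2 * step_mgf c\<^sub>1 ^ Suc k)"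
    using *[OF 1 s(1)] strip unfolding spitzer_pos_def by auto
  show "Re s \<le> - c\<^sub>2 \<Longrightarrow>
     summable (\<lambda>k. (\<integral>x. exp (- s * of_real (min 0 x)) \<partial>conv_power \<mu> (Suc k)) / of_nat (Suc k))"
    "Re s \<le> - c\<^sub>2 \<Longrightarrow> cmod (spitzer_neg s) \<le> (\<Sum>k. 1 * step_mgf c\<^sub>2 ^ Suc k)"
    using *[OF 2 s(2)] strip unfolding spitzer_neg_def by auto
qed

lemma holomorphic_spitzer_pos: "spitzer_pos holomorphic_on {s. - c\<^sub>1 < Re s}"
  unfolding spitzer_pos_def
proof (rule holomorphic_on_suminf)
  show "open {s. - c\<^sub>1 < Re s}" by (rule open_halfspace_Re_gt)
  fix k
  interpret P: prob_space "conv_power \<mu> (Suc k)"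
    by (rule conv_power_step)
  have [measurable_cong]: "sets (conv_power \<mu> (Suc k)) = sets borel"
    by (rule conv_power_step)
  have i: "integrable (conv_power \<mu> (Suc k)) (\<lambda>x. exp (c\<^sub>1 * max 0 x))"
    using spitzer_pos_integrable[of "of_real (- c\<^sub>1)" "Suc k", THEN integrable_Re]
    by (simp add: Re_exp)
  have "(\<lambda>z. \<integral>x. exp (z * of_real (max 0 x)) \<partial>conv_power \<mu> (Suc k)) holomorphic_on {s. Re s < c\<^sub>1}"
    by (rule P.holomorphic_on_exp_moment_nonneg[OF _ _ i]) auto
  hence "((\<lambda>z. \<integral>x. exp (z * of_real (max 0 x)) \<partial>conv_power \<mu> (Suc k)) \<circ> uminus) holomorphic_on {s. - c\<^sub>1 < Re s}"
    by (rule holomorphic_on_compose_gen[rotated]) (auto intro!: holomorphic_intros)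
  hence "(\<lambda>s. \<integral>x. exp (- s * of_real (max 0 x)) \<partial>conv_power \<mu> (Suc k)) holomorphic_on {s. - c\<^sub>1 < Re s}"
    by (simp add: o_def)
  thus "(\<lambda>s. ((\<integral>x. exp (- s * of_real (max 0 x)) \<partial>conv_power \<mu> (Suc k)) - 1) / of_nat (Suc k)) holomorphic_on {s. - c\<^sub>1 < Re s}"
    by (intro holomorphic_intros) auto
  show "\<And>s. s \<in> {s. - c\<^sub>1 < Re s} \<Longrightarrow> cmod (((\<integral>x. exp (- s * of_real (max 0 x)) \<partial>conv_power \<mu> (Suc k)) - 1) / of_nat (Suc k))
     \<le> 2 * step_mgf c\<^sub>1 ^ Suc k"
    by (intro norm_div_Suc_le spitzer_pos_term_le) auto
  show "summable (\<lambda>k. 2 * step_mgf c\<^sub>1 ^ Suc k)" using strip by (intro summable_step_mgf_power) auto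
qed

lemma holomorphic_spitzer_neg: "spitzer_neg holomorphic_on {s. Re s < - c\<^sub>2}"
  unfolding spitzer_neg_def
proof (rule holomorphic_on_suminf)
  show "open {s. Re s < - c\<^sub>2}" by (rule open_halfspace_Re_lt)
  fix k
  interpret P: prob_space "conv_power \<mu> (Suc k)"
    by (rule conv_power_step)
  have [measurable_cong]: "sets (conv_power \<mu> (Suc k)) = sets borel"
    by (rule conv_power_step)
  have "(\<lambda>s. \<integral>x. exp (s * of_real (- min 0 x)) \<partial>conv_power \<mu> (Suc k)) holomorphic_on {s. Re s < 0}"
    using P.integrable_const[of 1] by (intro P.holomorphic_on_exp_moment_nonneg) auto
  hence "(\<lambda>s. \<integral>x. exp (- s * of_real (min 0 x)) \<partial>conv_power \<mu> (Suc k)) holomorphic_on {s. Re s < - c\<^sub>2}"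
    using strip by (auto elim!: holomorphic_on_subset)
  thus "(\<lambda>s. (\<integral>x. exp (- s * of_real (min 0 x)) \<partial>conv_power \<mu> (Suc k)) / of_nat (Suc k)) holomorphic_on {s. Re s < - c\<^sub>2}"
    by (intro holomorphic_intros) auto
  show "\<And>s. s \<in> {s. Re s < - c\<^sub>2} \<Longrightarrow> cmod ((\<integral>x. exp (- s * of_real (min 0 x)) \<partial>conv_power \<mu> (Suc k)) / of_nat (Suc k))
     \<le> 1 * step_mgf c\<^sub>2 ^ Suc k"
    unfolding mult_1 by (intro norm_div_Suc_le spitzer_neg_term_le) auto
  show "summable (\<lambda>k. 1 * step_mgf c\<^sub>2 ^ Suc k)" using strip by (intro summable_step_mgf_power) auto
qed

lemma spitzer_pos_0: "spitzer_pos 0 = 0"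
proof -
  have "prob_space (conv_power \<mu> k)" for k
    by (rule conv_power_step)
  hence "measure (conv_power \<mu> k) (space (conv_power \<mu> k)) = 1" for k
    by (rule prob_space.prob_space)
  from this[of "Suc k" for k] show ?thesis unfolding spitzer_pos_def by simp
qed

text \<open>One of \<open>max 0 x\<close> and \<open>min 0 x\<close> is always 0, so their
  exponentials add up to \<open>exp (- s * x) + 1\<close>. Taken over all partial sums this gives
  the power series of the logarithm, which converges because \<open>step_lt s\<close> lies in the
  open unit disc on the strip.\<close>

lemma spitzer_pos_plus_neg:
  assumes s: "- c\<^sub>1 \<le> Re s" "Re s \<le> - c\<^sub>2"
  shows "spitzer_pos s + spitzer_neg s = - Ln (1 - step_lt s)"
proof -
  have term_eq: "((\<integral>x. exp (- s * of_real (max 0 x)) \<partial>conv_power \<mu> k) - 1) / of_nat k +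
       (\<integral>x. exp (- s * of_real (min 0 x)) \<partial>conv_power \<mu> k) / of_nat k = step_lt s ^ k / of_nat k" for k
  proof -
    interpret P: prob_space "conv_power \<mu> k"
      by (rule conv_power_step)
    have "step_lt s ^ k = (\<integral>x. exp (- s * of_real x) \<partial>conv_power \<mu> k)"
      unfolding step_lt_def using integrable_step_lt[of s] s
      by (intro exp_conv_power(2)[symmetric] step.prob_space_axioms sets_step) auto
    also have "\<dots> = (\<integral>x. exp (- s * of_real (max 0 x)) + exp (- s * of_real (min 0 x)) - 1 \<partial>conv_power \<mu> k)"
      by (intro Bochner_Integration.integral_cong) (auto simp: max_def min_def)
    also have "\<dots> = (\<integral>x. exp (- s * of_real (max 0 x)) \<partial>conv_power \<mu> k) + (\<integral>x. exp (- s * of_real (min 0 x)) \<partial>conv_power \<mu> k) - 1"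
      using spitzer_pos_integrable[of s k] spitzer_neg_integrable[of s k] s by (simp add: P.prob_space)
    finally have "((\<integral>x. exp (- s * of_real (max 0 x)) \<partial>conv_power \<mu> k) - 1) +
       (\<integral>x. exp (- s * of_real (min 0 x)) \<partial>conv_power \<mu> k) = step_lt s ^ k" by simp
    thus ?thesis unfolding add_divide_distrib[symmetric] by simp
  qed
  have "cmod (step_lt s) < 1" using norm_step_lt_le[of s] step_mgf_bounds[of "- Re s"] s by auto
  hence "(\<lambda>k. - ((- (- step_lt s)) ^ k) / of_nat k) sums Ln (1 + (- step_lt s))"
    by (intro Ln_series') auto
  hence "(\<lambda>k. - (step_lt s ^ k / of_nat k)) sums Ln (1 - step_lt s)" by simp
  hence "(\<lambda>k. - (- (step_lt s ^ k / of_nat k))) sums - Ln (1 - step_lt s)" by (rule sums_minus)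
  \<comment> \<open>Dropping the term with index 0 changes nothing: it is a division by
    \<open>of_nat 0\<close>, hence 0.\<close>
  hence L: "(\<lambda>k. step_lt s ^ Suc k / of_nat (Suc k)) sums - Ln (1 - step_lt s)"
    by (subst sums_Suc_iff) simp
  have "spitzer_pos s + spitzer_neg s = (\<Sum>k. step_lt s ^ Suc k / of_nat (Suc k))"
    unfolding spitzer_pos_def spitzer_neg_def
    by (subst suminf_add[OF spitzer_pos_summable[OF s(1)] spitzer_neg_summable[OF s(2)]])
       (simp only: term_eq)
  also have "\<dots> = - Ln (1 - step_lt s)" using sums_unique[OF L] by simp
  finally show ?thesis .
qed

section \<open>The waiting time and the Wiener-Hopf factorization\<close>

definition wait_lt :: "complex \<Rightarrow> complex" where
  "wait_lt s = (\<integral>w. exp (- s * of_real w) \<partial>\<nu>)"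

lemma integrable_wait_lt:
  assumes "- c\<^sub>1 \<le> Re s" shows "integrable \<nu> (\<lambda>w. exp (- s * of_real w))"
  by (rule wait.integrable_exp_le_nonneg[OF _ wait_nonneg integrable_wait_exp]) (use assms in auto)

lemma holomorphic_wait_lt: "wait_lt holomorphic_on {s. - c\<^sub>1 < Re s}"
proof -
  have "(\<lambda>z. \<integral>x. exp (z * of_real x) \<partial>\<nu>) holomorphic_on {s. Re s < c\<^sub>1}"
    by (rule wait.holomorphic_on_exp_moment_nonneg[OF _ wait_nonneg integrable_wait_exp]) auto
  hence "((\<lambda>z. \<integral>x. exp (z * of_real x) \<partial>\<nu>) \<circ> uminus) holomorphic_on {s. - c\<^sub>1 < Re s}"
    by (rule holomorphic_on_compose_gen[rotated]) (auto intro!: holomorphic_intros)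
  moreover have "wait_lt = (\<lambda>z. \<integral>x. exp (z * of_real x) \<partial>\<nu>) \<circ> uminus"
    by (auto simp: wait_lt_def fun_eq_iff)
  ultimately show ?thesis by simp
qed

lemma norm_wait_lt_le:
  assumes "- c\<^sub>1 \<le> Re s" shows "cmod (wait_lt s) \<le> (\<integral>w. exp (c\<^sub>1 * w) \<partial>\<nu>)"
proof -
  have "cmod (wait_lt s) \<le> (\<integral>w. norm (exp (- s * of_real w)) \<partial>\<nu>)"
    unfolding wait_lt_def by (rule integral_norm_bound)
  also have "\<dots> \<le> (\<integral>w. exp (c\<^sub>1 * w) \<partial>\<nu>)"
  proof (rule integral_mono_AE)
    show "integrable \<nu> (\<lambda>w. cmod (exp (- s * of_real w)))" 
      using integrable_wait_lt[OF assms] by (rule integrable_norm)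
    show "AE w in \<nu>. cmod (exp (- s * of_real w)) \<le> exp (c\<^sub>1 * w)"
      using wait_nonneg
    proof eventually_elim
      case (elim w)
      thus ?case using assms mult_right_mono[of "- Re s" c\<^sub>1 w] by simp
    qed
  qed (rule integrable_wait_exp)
  finally show ?thesis .
qed

text \<open>The part of w + x that reflection at 0 cuts off; for the queue it is, up to sign and
  scale, the idle time. Being at most 0, it has a bounded transform in the left half-plane,
  complementary to that of the waiting time.\<close>

definition overshoot_lt :: "complex \<Rightarrow> complex" where
  "overshoot_lt s = (\<integral>p. exp (- s * of_real (min 0 (fst p + snd p))) \<partial>(\<nu> \<Otimes>\<^sub>M \<mu>))"

lemma integrable_overshoot_lt:
  assumes "Re s \<le> 0" shows "integrable (\<nu> \<Otimes>\<^sub>M \<mu>) (\<lambda>p. exp (- s * of_real (min 0 (fst p + snd p))))"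
proof (rule pair.integrable_const_bound[of _ 1])
  show "AE p in \<nu> \<Otimes>\<^sub>M \<mu>. cmod (exp (- s * of_real (min 0 (fst p + snd p)))) \<le> 1"
    using assms by (auto intro!: AE_I2 mult_nonpos_nonpos)
qed measurable

lemma norm_overshoot_lt_le: assumes "Re s \<le> 0" shows "cmod (overshoot_lt s) \<le> 1"
proof -
  have "cmod (overshoot_lt s) \<le> (\<integral>p. norm (exp (- s * of_real (min 0 (fst p + snd p)))) \<partial>(\<nu> \<Otimes>\<^sub>M \<mu>))"
    unfolding overshoot_lt_def by (rule integral_norm_bound)
  also have "\<dots> \<le> (\<integral>p. 1 \<partial>(\<nu> \<Otimes>\<^sub>M \<mu>))"
    using integrable_overshoot_lt[OF assms] assms
    by (intro integral_mono integrable_norm) (auto intro!: mult_nonpos_nonpos)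
  finally show ?thesis by (simp add: pair.prob_space)
qed

lemma holomorphic_overshoot_lt: "overshoot_lt holomorphic_on {s. Re s < 0}"
proof -
  have "(\<lambda>s. \<integral>p. exp (s * of_real (- min 0 (fst p + snd p))) \<partial>(\<nu> \<Otimes>\<^sub>M \<mu>)) holomorphic_on {s. Re s < 0}"
    by (rule pair.holomorphic_on_exp_moment_nonneg) auto
  moreover have "overshoot_lt = (\<lambda>s. \<integral>p. exp (s * of_real (- min 0 (fst p + snd p))) \<partial>(\<nu> \<Otimes>\<^sub>M \<mu>))"
    by (auto simp: overshoot_lt_def fun_eq_iff)
  ultimately show ?thesis by simp
qed

text \<open>The splitting into \<open>max 0\<close> and \<open>min 0\<close> behind Spitzer's
  series, now applied to w + x: stationarity identifies the law of the first part with that of w,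
  and independence factors the transform of the sum.\<close>

lemma wiener_hopf_equation:
  assumes s: "- c\<^sub>1 \<le> Re s" "Re s \<le> - c\<^sub>2"
  shows "wait_lt s * (1 - step_lt s) = 1 - overshoot_lt s"
proof -
  note i = integrable_wait_lt[OF s(1)] integrable_step_lt[of s]
  have ip: "integrable (\<nu> \<Otimes>\<^sub>M \<mu>) (\<lambda>(w, x). exp (- s * of_real w) * exp (- s * of_real x))"
    using s by (intro pair.integrable_pair_mult i) auto
  have vp: "(\<integral>p. (case p of (w, x) \<Rightarrow> exp (- s * of_real w) * exp (- s * of_real x)) \<partial>(\<nu> \<Otimes>\<^sub>M \<mu>)) = wait_lt s * step_lt s"
    using pair.integral_pair_mult[OF i] s by (simp add: wait_lt_def step_lt_def)
  have "wait_lt s = (\<integral>w. exp (- s * of_real w) \<partial>distr (\<nu> \<Otimes>\<^sub>M \<mu>) borel (\<lambda>(w, x). max 0 (w + x)))"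
    using stationary by (simp add: wait_lt_def)
  also have "\<dots> = (\<integral>p. exp (- s * of_real (case p of (w, x) \<Rightarrow> max 0 (w + x))) \<partial>(\<nu> \<Otimes>\<^sub>M \<mu>))"
    by (rule integral_distr) auto
  also have "\<dots> = (\<integral>p. (case p of (w, x) \<Rightarrow> exp (- s * of_real w) * exp (- s * of_real x)) -
        exp (- s * of_real (min 0 (fst p + snd p))) + 1 \<partial>(\<nu> \<Otimes>\<^sub>M \<mu>))"
    by (intro Bochner_Integration.integral_cong)
       (auto simp: max_def min_def algebra_simps exp_add[symmetric])
  also have "\<dots> = wait_lt s * step_lt s - overshoot_lt s + 1"
    using ip vp integrable_overshoot_lt[of s] s strip
    by (simp add: overshoot_lt_def pair.prob_space)
  finally show ?thesis by (simp add: algebra_simps)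
qed

text \<open>\<open>f\<close> and \<open>g\<close> are holomorphic and bounded on two half-planes
  that cover the plane. They agree on the overlap, since there 1 - \<open>step_lt\<close> is the
  exponential of minus the sum of both series. The glued function is therefore constant, and its
  value at 0 is 1.\<close>

lemma exp_spitzer_pos:
  assumes s: "- c\<^sub>1 < Re s"
  shows "exp (spitzer_pos s) = wait_lt s"
proof -
  define A where "A = {s. - c\<^sub>1 < Re s}"
  define B where "B = {s. Re s < - c\<^sub>2}"
  define f where "f = (\<lambda>s. wait_lt s * exp (- spitzer_pos s))"
  define g where "g = (\<lambda>s. (1 - overshoot_lt s) * exp (spitzer_neg s))"
  have AB: "A \<union> B = UNIV" using strip by (auto simp: A_def B_def)
  have "open A" "open B" unfolding A_def B_def by (auto intro: open_halfspace_Re_gt open_halfspace_Re_lt)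
  have "f holomorphic_on A" unfolding f_def A_def
    by (intro holomorphic_intros holomorphic_wait_lt holomorphic_spitzer_pos)
  moreover have "g holomorphic_on B" unfolding g_def B_def
    using strip by (intro holomorphic_intros holomorphic_spitzer_neg holomorphic_on_subset[OF holomorphic_overshoot_lt]) auto
  moreover have "f z = g z" if "z \<in> A" "z \<in> B" for z
  proof -
    have z: "- c\<^sub>1 \<le> Re z" "Re z \<le> - c\<^sub>2" using that by (auto simp: A_def B_def)
    have "cmod (step_lt z) < 1" using norm_step_lt_le[of z] step_mgf_bounds[of "- Re z"] z by auto
    hence nz: "1 - step_lt z \<noteq> 0" by auto
    have "exp (spitzer_pos z + spitzer_neg z) = 1 / (1 - step_lt z)"
      unfolding spitzer_pos_plus_neg[OF z] using nz by (simp add: exp_minus divide_inverse)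
    moreover have "exp (spitzer_neg z) = exp (- spitzer_pos z) * exp (spitzer_pos z + spitzer_neg z)"
      by (simp add: exp_add[symmetric])
    ultimately have "exp (spitzer_neg z) = exp (- spitzer_pos z) / (1 - step_lt z)" by simp
    thus ?thesis unfolding f_def g_def wiener_hopf_equation[OF z, symmetric]
      using nz by simp
  qed
  ultimately have hol: "(\<lambda>z. if z \<in> A then f z else g z) holomorphic_on UNIV"
    unfolding AB[symmetric] by (intro holomorphic_on_If_Un \<open>open A\<close> \<open>open B\<close>)
  have ebound: "cmod (exp z) \<le> exp (cmod z)" for z :: complex
    using complex_Re_le_cmod[of z] by simp
  have fb: "cmod (f z) \<le> (\<integral>w. exp (c\<^sub>1 * w) \<partial>\<nu>) * exp (\<Sum>k. 2 * step_mgf c\<^sub>1 ^ Suc k)" if "z \<in> A" for z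
    unfolding f_def norm_mult
    using that norm_spitzer_pos_le[of z] 
    by (intro mult_mono norm_wait_lt_le order_trans[OF ebound]) (auto simp: A_def)
  have gb: "cmod (g z) \<le> 2 * exp (\<Sum>k. 1 * step_mgf c\<^sub>2 ^ Suc k)" if "z \<in> B" for z
    unfolding g_def norm_mult
  proof (intro mult_mono)
    have "cmod (1 - overshoot_lt z) \<le> 1 + cmod (overshoot_lt z)"
      using norm_triangle_ineq4[of 1 "overshoot_lt z"] by simp
    thus "cmod (1 - overshoot_lt z) \<le> 2" using norm_overshoot_lt_le[of z] that strip by (auto simp: B_def)
    show "cmod (exp (spitzer_neg z)) \<le> exp (\<Sum>k. 1 * step_mgf c\<^sub>2 ^ Suc k)"
      using that norm_spitzer_neg_le[of z] by (intro order_trans[OF ebound]) (auto simp: B_def)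
  qed auto
  have "bounded (range (\<lambda>z. if z \<in> A then f z else g z))"
    unfolding bounded_iff
  proof (intro exI ballI)
    fix u assume "u \<in> range (\<lambda>z. if z \<in> A then f z else g z)"
    then obtain z where u: "u = (if z \<in> A then f z else g z)" by blast
    show "cmod u \<le> max ((\<integral>w. exp (c\<^sub>1 * w) \<partial>\<nu>) * exp (\<Sum>k. 2 * step_mgf c\<^sub>1 ^ Suc k)) (2 * exp (\<Sum>k. 1 * step_mgf c\<^sub>2 ^ Suc k))"
    proof (cases "z \<in> A")
      case True
      thus ?thesis using fb[OF True] u by simp
    next
      case False
      hence "z \<in> B" using AB by auto
      thus ?thesis using gb[of z] u False by simp
    qed
  qed
  from Liouville_theorem[OF hol this] obtain c where c: "\<And>z. (if z \<in> A then f z else g z) = c"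
    unfolding constant_on_def by blast
  have "f 0 = 1"
    by (simp add: f_def wait_lt_def spitzer_pos_0 wait.prob_space)
  moreover have "0 \<in> A" using strip by (simp add: A_def)
  ultimately have "c = 1" using c[of 0] by simp
  hence "f s = 1" using c[of s] s by (simp add: A_def)
  thus ?thesis by (simp add: f_def exp_minus field_simps)
qed

end

section \<open>Pollaczek's integral\<close>

text \<open>Subtracting the Cauchy kernel of \<open>q\<close> improves the decay along a vertical
  line to order \<open>1 / y\<^sup>2\<close>, so that all line integrals converge absolutely. In the
  applications \<open>q\<close> marks the point where the logarithm of the transform
  vanishes.\<close>

definition cauchy_kernel :: "complex \<Rightarrow> complex \<Rightarrow> complex \<Rightarrow> complex" where
  "cauchy_kernel p q u = 1 / (u - p) - 1 / (u - q)"

lemma norm_cauchy_kernel: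
  assumes "u \<noteq> p" "u \<noteq> q"
  shows "cmod (cauchy_kernel p q u) = cmod (p - q) / (cmod (u - p) * cmod (u - q))"
proof -
  have "cauchy_kernel p q u = (p - q) / ((u - p) * (u - q))"
    using assms by (simp add: cauchy_kernel_def field_simps)
  thus ?thesis by (simp add: norm_divide norm_mult)
qed

lemma one_plus_abs_le_dist:
  assumes "0 < m" "m \<le> \<bar>a - Re p\<bar>" "\<bar>Im p\<bar> \<le> S"
  shows "1 + \<bar>y\<bar> \<le> ((1 + S) / m + 1) * cmod (Complex a y - p)"
proof -
  have 1: "m \<le> cmod (Complex a y - p)"
    using assms abs_Re_le_cmod[of "Complex a y - p"] by auto
  have "0 \<le> S" using assms by linarith
  hence "1 + S \<le> (1 + S) / m * cmod (Complex a y - p)"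
    using mult_left_mono[OF 1, of "(1 + S) / m"] assms by simp
  moreover have "\<bar>y\<bar> \<le> cmod (Complex a y - p) + S"
    using abs_Im_le_cmod[of "Complex a y - p"] assms by auto
  ultimately show ?thesis by (simp add: algebra_simps)
qed

text \<open>Besides the distance of the poles only their clearance \<open>m\<close> from the line
  and their height \<open>S\<close> enter, which makes the bound uniform over bounded sets of
  \<open>s\<close>.\<close>

lemma norm_cauchy_kernel_le:
  assumes m: "0 < m" "m \<le> \<bar>a - Re p\<bar>" "m \<le> \<bar>a - Re q\<bar>" and S: "\<bar>Im p\<bar> \<le> S" "\<bar>Im q\<bar> \<le> S"
  shows "cmod (cauchy_kernel p q (Complex a y)) \<le> cmod (p - q) * ((1 + S) / m + 1)\<^sup>2 * inverse (1 + y\<^sup>2)"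
proof -
  define C where "C = (1 + S) / m + 1"
  have "0 \<le> S" using S by linarith
  hence C: "0 < C" using m by (auto simp: C_def intro!: add_nonneg_pos)
  define d e where "d = cmod (Complex a y - p)" and "e = cmod (Complex a y - q)"
  have 1: "1 + \<bar>y\<bar> \<le> C * d" "1 + \<bar>y\<bar> \<le> C * e"
    unfolding C_def d_def e_def by (rule one_plus_abs_le_dist; use assms in auto)+
  have de: "0 < d" "0 < e" using 1 C by (smt (verit) mult_nonneg_nonpos)+
  hence ne: "Complex a y \<noteq> p" "Complex a y \<noteq> q" by (auto simp: d_def e_def)
  have "1 + y\<^sup>2 \<le> (1 + \<bar>y\<bar>) * (1 + \<bar>y\<bar>)"
    by (simp add: power2_eq_square algebra_simps)
  also have "\<dots> \<le> (C * d) * (C * e)" using 1 by (intro mult_mono) auto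
  finally have "1 + y\<^sup>2 \<le> C\<^sup>2 * (d * e)" by (simp add: power2_eq_square mult_ac)
  moreover have "0 < 1 + y\<^sup>2" by (smt (verit) zero_le_power2)
  ultimately have "1 / (d * e) \<le> C\<^sup>2 * inverse (1 + y\<^sup>2)"
    using de by (simp add: field_simps)
  hence "cmod (p - q) * (1 / (d * e)) \<le> cmod (p - q) * (C\<^sup>2 * inverse (1 + y\<^sup>2))"
    by (intro mult_left_mono) auto
  thus ?thesis unfolding norm_cauchy_kernel[OF ne] d_def e_def C_def by (simp add: mult.assoc)
qed

lemma integrable_inverse_1_plus_square_lborel: "integrable lborel (\<lambda>y :: real. inverse (1 + y\<^sup>2))"
  using integrable_inverse_1_plus_square by (simp add: set_integrable_def)

lemma integrable_times_cauchy_kernel: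
  fixes F :: "real \<Rightarrow> complex"
  assumes "Re p \<noteq> a" "Re q \<noteq> a" and [measurable]: "F \<in> borel_measurable borel"
    and F: "\<And>y. cmod (F y) \<le> C"
  shows "integrable lborel (\<lambda>y. F y * cauchy_kernel p q (Complex a y))"
proof -
  define m where "m = min \<bar>a - Re p\<bar> \<bar>a - Re q\<bar>"
  define S where "S = max \<bar>Im p\<bar> \<bar>Im q\<bar>"
  define D where "D = cmod (p - q) * ((1 + S) / m + 1)\<^sup>2"
  have [measurable]: "(\<lambda>y. cauchy_kernel p q (Complex a y)) \<in> borel_measurable borel"
    unfolding cauchy_kernel_def Complex_eq by measurable
  show ?thesis
  proof (rule Bochner_Integration.integrable_bound)
    show "integrable lborel (\<lambda>y. C * D * inverse (1 + y\<^sup>2))"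
      by (intro integrable_mult_right integrable_inverse_1_plus_square_lborel)
    show "AE y in lborel. norm (F y * cauchy_kernel p q (Complex a y)) \<le> norm (C * D * inverse (1 + y\<^sup>2))"
    proof (rule AE_I2)
      fix y
      have "cmod (cauchy_kernel p q (Complex a y)) \<le> D * inverse (1 + y\<^sup>2)"
        unfolding D_def by (rule norm_cauchy_kernel_le) (use assms in \<open>auto simp: m_def S_def\<close>)
      hence "norm (F y * cauchy_kernel p q (Complex a y)) \<le> C * (D * inverse (1 + y\<^sup>2))"
        unfolding norm_mult using F[of y] order_trans[OF norm_ge_zero F] by (intro mult_mono) auto
      thus "norm (F y * cauchy_kernel p q (Complex a y)) \<le> norm (C * D * inverse (1 + y\<^sup>2))"
        by (simp add: mult.assoc)
    qed
  qed measurable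
qed

text \<open>A pole to the left of the line is not enclosed. In that case the half-plane is narrowed
  to real parts above \<open>max a' (Re p)\<close>, which still contains the rectangle but no longer
  the pole.\<close>

lemma has_contour_integral_Cauchy_rectpath:
  assumes hol: "F holomorphic_on {u. a' < Re u}" and a: "a' < a" "0 < A"
    and p: "Re p \<noteq> a" "Re p < a + A" "\<bar>Im p\<bar> < A"
  shows "((\<lambda>u. F u / (u - p)) has_contour_integral (2 * pi * \<i> * (if a < Re p then F p else 0)))
           (rectpath (Complex a (- A)) (Complex (a + A) A))"
proof -
  let ?R = "rectpath (Complex a (- A)) (Complex (a + A) A)"
  have im: "path_image ?R = {z. Re z \<in> {a, a + A} \<and> Im z \<in> {-A..A}} \<union> {z. Im z \<in> {-A, A} \<and> Re z \<in> {a..a + A}}"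
    using path_image_rectpath[of "Complex a (- A)" "Complex (a + A) A"] a by simp
  show ?thesis
  proof (cases "a < Re p")
    case True
    have "((\<lambda>w. F w / (w - p)) has_contour_integral (2 * pi * \<i> * winding_number ?R p * F p)) ?R"
    proof (rule Cauchy_integral_formula_convex_simple)
      show "convex {u. a' < Re u}" by (rule convex_halfspace_Re_gt)
      show "p \<in> interior {u. a' < Re u}" using True a by (simp add: interior_open open_halfspace_Re_gt)
      show "path_image ?R \<subseteq> {u. a' < Re u} - {p}" unfolding im using a p by auto
    qed (use hol in auto)
    moreover have "winding_number ?R p = 1"
      by (rule winding_number_rectpath) (use True p in \<open>auto simp: in_box_complex_iff\<close>)
    ultimately show ?thesis using True by simp
  next
    case False
    have "((\<lambda>w. F w / (w - p)) has_contour_integral 0) ?R"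
    proof (rule Cauchy_theorem_convex_simple)
      show "(\<lambda>w. F w / (w - p)) holomorphic_on {u. max a' (Re p) < Re u}"
        by (intro holomorphic_intros holomorphic_on_subset[OF hol]) auto
      show "convex {u. max a' (Re p) < Re u}" by (rule convex_halfspace_Re_gt)
      show "path_image ?R \<subseteq> {u. max a' (Re p) < Re u}" unfolding im using False a p by auto
    qed auto
    thus ?thesis using False by simp
  qed
qed

text \<open>The line is closed to the right by three sides of total length 4 A, on which the
  integrand is O(1/A^2). The left side of the rectangle is traversed downwards, hence the minus
  sign; the factor \<open>\<i>\<close> of the residue formula cancels against that of the
  parametrization.\<close>

lemma LBINT_half_plane_Cauchy:
  fixes F :: "complex \<Rightarrow> complex"
  assumes hol: "F holomorphic_on {u. a' < Re u}" and bnd: "\<And>u. a' < Re u \<Longrightarrow> cmod (F u) \<le> C"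
    and a: "a' < a" and p: "Re p \<noteq> a" and q: "Re q \<noteq> a"
  shows "integrable lborel (\<lambda>y. F (Complex a y) * cauchy_kernel p q (Complex a y))" (is "integrable _ ?g")
    and "(LBINT y. F (Complex a y) * cauchy_kernel p q (Complex a y)) =
           - 2 * pi * ((if a < Re p then F p else 0) - (if a < Re q then F q else 0))" (is "_ = ?I")
proof -
  define g where "g = (\<lambda>u. F u * cauchy_kernel p q u)"
  have contF: "continuous_on UNIV (\<lambda>y. F (Complex a y))"
    unfolding Complex_eq
    by (rule continuous_on_compose2[OF holomorphic_on_imp_continuous_on[OF hol]])
       (use a in \<open>auto intro!: continuous_intros\<close>)
  show int: "integrable lborel ?g"
    using p q bnd a by (intro integrable_times_cauchy_kernel[where C = C] borel_measurable_continuous_onI contF) auto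
  define V where "V = (if a < Re p then F p else 0) - (if a < Re q then F q else 0)"
  \<comment> \<open>The factor 2 makes \<open>\<bar>a\<bar> + cmod p\<close> and
    \<open>\<bar>a\<bar> + cmod q\<close> less than A / 2, so the three far sides keep a distance of
    at least A / 2 from both poles.\<close>
  define A0 where "A0 = 2 * (\<bar>a\<bar> + cmod p + cmod q + 1)"
  have key: "cmod (integral {-A..A} (\<lambda>y. g (Complex a y)) + 2 * pi * V) \<le> 16 * C * cmod (p - q) / A" if A: "A0 \<le> A" for A
  proof -
    have "0 < A0" unfolding A0_def by (intro mult_pos_pos add_nonneg_pos add_nonneg_nonneg) auto
    hence A_pos: "0 < A" using A by (rule less_le_trans)
    have A_big: "\<bar>a\<bar> + cmod p < A / 2" "\<bar>a\<bar> + cmod q < A / 2"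
      using A by (auto simp: A0_def) (smt (verit) norm_ge_zero)+
    have "0 \<le> C" using bnd[of "Complex a 0"] a order_trans[OF norm_ge_zero] by auto
    define z1 z2 z3 z4 where "z1 = Complex a (- A)" and "z2 = Complex (a + A) (- A)"
      and "z3 = Complex (a + A) A" and "z4 = Complex a A"
    have far: "cmod (g u) \<le> 4 * C * cmod (p - q) / A\<^sup>2" if u: "a \<le> Re u" "Re u = a + A \<or> \<bar>Im u\<bar> = A" for u
    proof -
      have d: "A / 2 \<le> cmod (u - r)" if "\<bar>a\<bar> + cmod r < A / 2" for r
        using u that abs_Re_le_cmod[of r] abs_Im_le_cmod[of r] abs_Re_le_cmod[of "u - r"] abs_Im_le_cmod[of "u - r"]
        by (auto simp: abs_if split: if_splits)
      note dp = d[OF A_big(1)] and dq = d[OF A_big(2)]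
      have ne: "u \<noteq> p" "u \<noteq> q" using dp dq A_pos by auto
      have "cmod (g u) = cmod (F u) * (cmod (p - q) / (cmod (u - p) * cmod (u - q)))"
        by (simp add: g_def norm_mult norm_cauchy_kernel[OF ne])
      also have "\<dots> \<le> C * (cmod (p - q) / (A / 2 * (A / 2)))"
        using dp dq A_pos bnd[of u] u a \<open>0 \<le> C\<close>
        by (intro mult_mono divide_left_mono mult_pos_pos) auto
      finally show ?thesis by (simp add: power2_eq_square mult_ac)
    qed
    have seg: "closed_segment z1 z2 \<subseteq> {u. a \<le> Re u \<and> (Re u = a + A \<or> \<bar>Im u\<bar> = A)}"
      "closed_segment z2 z3 \<subseteq> {u. a \<le> Re u \<and> (Re u = a + A \<or> \<bar>Im u\<bar> = A)}"
      "closed_segment z3 z4 \<subseteq> {u. a \<le> Re u \<and> (Re u = a + A \<or> \<bar>Im u\<bar> = A)}"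
      using A_pos by (auto simp: z1_def z2_def z3_def z4_def closed_segment_same_Re closed_segment_same_Im closed_segment_eq_real_ivl)
    have seg4: "closed_segment z4 z1 \<subseteq> {u. Re u = a}"
      by (auto simp: z1_def z4_def closed_segment_same_Re)
    have holg: "g holomorphic_on {u. a' < Re u} - {p, q}"
      unfolding g_def cauchy_kernel_def
      by (intro holomorphic_intros holomorphic_on_subset[OF hol]) auto
    have np: "u \<noteq> p \<and> u \<noteq> q" if u: "a \<le> Re u" "Re u = a + A \<or> \<bar>Im u\<bar> = A" for u
    proof -
      have "cmod u \<ge> A / 2 \<or> cmod u \<ge> A - \<bar>a\<bar>" 
        using u abs_Re_le_cmod[of u] abs_Im_le_cmod[of u] A_pos by auto
      thus ?thesis using A_big A_pos by (smt (verit) norm_ge_zero field_sum_of_halves)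
    qed
    have cont: "continuous_on {u. a \<le> Re u \<and> (Re u = a + A \<or> \<bar>Im u\<bar> = A)} g" "continuous_on {u. Re u = a} g"
      by (rule holomorphic_on_imp_continuous_on[OF holomorphic_on_subset[OF holg]]; use np a p q in auto)+
    have ci: "g contour_integrable_on linepath z1 z2" "g contour_integrable_on linepath z2 z3"
       "g contour_integrable_on linepath z3 z4" "g contour_integrable_on linepath z4 z1"
      by (intro contour_integrable_continuous_linepath continuous_on_subset[OF cont(1)] continuous_on_subset[OF cont(2)] seg seg4)+
    have "((\<lambda>u. F u / (u - p) - F u / (u - q)) has_contour_integral
        (2 * pi * \<i> * (if a < Re p then F p else 0) - 2 * pi * \<i> * (if a < Re q then F q else 0)))
           (rectpath (Complex a (- A)) (Complex (a + A) A))"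
      using A_big A_pos p q a abs_Re_le_cmod[of p] abs_Re_le_cmod[of q] abs_Im_le_cmod[of p] abs_Im_le_cmod[of q]
      by (intro has_contour_integral_diff has_contour_integral_Cauchy_rectpath[OF hol]) auto
    moreover have "(\<lambda>u. F u / (u - p) - F u / (u - q)) = g"
      by (auto simp: g_def cauchy_kernel_def algebra_simps)
    ultimately have "(g has_contour_integral (2 * pi * \<i> * V)) (rectpath (Complex a (- A)) (Complex (a + A) A))"
      by (simp add: V_def algebra_simps)
    hence "2 * pi * \<i> * V = contour_integral (rectpath (Complex a (- A)) (Complex (a + A) A)) g"
      by (rule contour_integral_unique[symmetric])
    also have "rectpath (Complex a (- A)) (Complex (a + A) A) = linepath z1 z2 +++ linepath z2 z3 +++ linepath z3 z4 +++ linepath z4 z1"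
      by (simp add: rectpath_def Let_def z1_def z2_def z3_def z4_def)
    also have "contour_integral \<dots> g = contour_integral (linepath z1 z2) g + (contour_integral (linepath z2 z3) g +
         (contour_integral (linepath z3 z4) g + contour_integral (linepath z4 z1) g))"
      using ci by (simp add: contour_integral_join contour_integrable_joinI)
    also have "contour_integral (linepath z4 z1) g = - contour_integral (linepath z1 z4) g"
      using contour_integral_reverse_linepath[of z4 z1 g] cont(2) seg4 continuous_on_subset by blast
    also have "contour_integral (linepath z1 z4) g = \<i> * integral {-A..A} (\<lambda>y. g (Complex a y))"
      by (rule contour_integral_linepath_same_Re) (use A_pos in \<open>auto simp: z1_def z4_def\<close>)
    finally have "\<i> * (integral {-A..A} (\<lambda>y. g (Complex a y)) + 2 * pi * V) = 
       contour_integral (linepath z1 z2) g + contour_integral (linepath z2 z3) g + contour_integral (linepath z3 z4) g"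
      by (simp add: algebra_simps)
    hence "cmod (integral {-A..A} (\<lambda>y. g (Complex a y)) + 2 * pi * V) = 
       cmod (contour_integral (linepath z1 z2) g + contour_integral (linepath z2 z3) g + contour_integral (linepath z3 z4) g)"
      by (metis norm_mult norm_ii mult_1)
    also have "\<dots> \<le> cmod (contour_integral (linepath z1 z2) g) + cmod (contour_integral (linepath z2 z3) g) + cmod (contour_integral (linepath z3 z4) g)"
      by (intro order_trans[OF norm_triangle_ineq] add_mono) auto
    also have "\<dots> \<le> 4 * C * cmod (p - q) / A\<^sup>2 * cmod (z2 - z1) + 4 * C * cmod (p - q) / A\<^sup>2 * cmod (z3 - z2) + 4 * C * cmod (p - q) / A\<^sup>2 * cmod (z4 - z3)"
      using seg \<open>0 \<le> C\<close> by (intro add_mono contour_integral_bound_linepath ci far) auto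
    also have "\<dots> = 4 * C * cmod (p - q) / A\<^sup>2 * (A + 2 * A + A)"
    proof -
      have "cmod (z2 - z1) = A" "cmod (z3 - z2) = 2 * A" "cmod (z4 - z3) = A"
        using A_pos by (auto simp: z1_def z2_def z3_def z4_def cmod_def real_sqrt_mult)
      thus ?thesis by (simp only:) (simp add: algebra_simps)
    qed
    also have "\<dots> = 16 * C * cmod (p - q) / A" using A_pos by (simp add: power2_eq_square)
    finally show ?thesis .
  qed
  have "(\<lambda>n. integral {- real n..real n} (\<lambda>y. g (Complex a y)) + 2 * pi * V) \<longlonglongrightarrow> 0"
  proof (rule Lim_null_comparison)
    show "\<forall>\<^sub>F n in sequentially. cmod (integral {- real n..real n} (\<lambda>y. g (Complex a y)) + 2 * pi * V) \<le> 16 * C * cmod (p - q) / real n"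
    proof -
      obtain N where "A0 \<le> real N" using real_arch_simple by blast
      thus ?thesis by (intro eventually_sequentiallyI[of N] key) (auto intro: order_trans)
    qed
    show "(\<lambda>n. 16 * C * cmod (p - q) / real n) \<longlonglongrightarrow> 0" by (rule lim_const_over_n)
  qed
  hence "(\<lambda>n. integral {- real n..real n} (\<lambda>y. g (Complex a y)) + 2 * pi * V - 2 * pi * V) \<longlonglongrightarrow> 0 - 2 * pi * V"
    by (intro tendsto_intros)
  hence lim1: "(\<lambda>n. integral {- real n..real n} (\<lambda>y. g (Complex a y))) \<longlonglongrightarrow> - 2 * pi * V" by simp
  have lim2: "(\<lambda>n. LBINT y. indicator {- real n..real n} y *\<^sub>R ?g y) \<longlonglongrightarrow> (LBINT y. ?g y)"
  proof (rule integral_dominated_convergence[where w = "\<lambda>y. norm (?g y)"])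
    show "AE y in lborel. (\<lambda>n. indicator {- real n..real n} y *\<^sub>R ?g y) \<longlonglongrightarrow> ?g y"
    proof (rule AE_I2)
      fix y :: real
      obtain N where N: "\<bar>y\<bar> \<le> real N" using real_arch_simple by blast
      have "\<forall>\<^sub>F n in sequentially. indicator {- real n..real n} y *\<^sub>R ?g y = ?g y"
        using N by (intro eventually_sequentiallyI[of N]) (auto simp: indicator_def)
      thus "(\<lambda>n. indicator {- real n..real n} y *\<^sub>R ?g y) \<longlonglongrightarrow> ?g y" by (rule tendsto_eventually)
    qed
    show "integrable lborel (\<lambda>y. norm (?g y))" using int by (rule integrable_norm)
  qed (use int in \<open>auto simp: indicator_def intro!: AE_I2\<close>)
  have "(LBINT y. indicator {- real n..real n} y *\<^sub>R ?g y) = integral {- real n..real n} (\<lambda>y. g (Complex a y))" for n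
  proof -
    have "set_integrable lborel {- real n..real n} ?g"
      unfolding set_integrable_def by (rule integrable_mult_indicator[OF _ int]) auto
    from set_borel_integral_eq_integral(2)[OF this]
    show ?thesis by (simp add: set_lebesgue_integral_def g_def)
  qed
  with lim2 have "(\<lambda>n. integral {- real n..real n} (\<lambda>y. g (Complex a y))) \<longlonglongrightarrow> (LBINT y. ?g y)" by simp
  from LIMSEQ_unique[OF this lim1] show "(LBINT y. ?g y) = ?I" by (simp add: V_def)
qed

context lindley_stationary
begin

text \<open>On the line the logarithm is minus the sum of the two halves of Spitzer's series. The
  positive half closes to the right around both \<open>s\<close> and 0, and it vanishes at 0. The
  negative half closes to the left, where neither pole lies, and contributes nothing.\<close>

lemma pollaczek:
  assumes c: "c\<^sub>2 < c" "c < c\<^sub>1" and s: "- c < Re s"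
  shows "integrable lborel (\<lambda>y. Ln (1 - step_lt (Complex (- c) y)) * cauchy_kernel s 0 (Complex (- c) y))"
    and "(LBINT y. Ln (1 - step_lt (Complex (- c) y)) * cauchy_kernel s 0 (Complex (- c) y)) = 2 * pi * spitzer_pos s"
proof -
  have "0 < c" using c strip by auto
  note P = LBINT_half_plane_Cauchy[OF holomorphic_spitzer_pos norm_spitzer_pos_le, of "- c" s 0]
  have P1: "integrable lborel (\<lambda>y. spitzer_pos (Complex (- c) y) * cauchy_kernel s 0 (Complex (- c) y))"
    using P(1) c s \<open>0 < c\<close> by simp
  have P2: "(LBINT y. spitzer_pos (Complex (- c) y) * cauchy_kernel s 0 (Complex (- c) y)) = - 2 * pi * spitzer_pos s"
    using P(2) c s \<open>0 < c\<close> by (simp add: spitzer_pos_0)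
  \<comment> \<open>Reflection in the origin turns closing to the left into closing to the right,
    with the poles \<open>- s\<close> and 0 left of the line at \<open>c\<close>.\<close>
  define G where "G = (\<lambda>u. spitzer_neg (- u))"
  have "spitzer_neg \<circ> uminus holomorphic_on {u. c\<^sub>2 < Re u}"
    by (rule holomorphic_on_compose_gen[OF _ holomorphic_spitzer_neg]) (auto intro!: holomorphic_intros)
  hence G: "G holomorphic_on {u. c\<^sub>2 < Re u}" by (simp add: G_def o_def)
  have Gb: "cmod (G u) \<le> (\<Sum>k. 1 * step_mgf c\<^sub>2 ^ Suc k)" if "c\<^sub>2 < Re u" for u
    unfolding G_def using that by (intro norm_spitzer_neg_le) auto
  note N = LBINT_half_plane_Cauchy[OF G Gb, of c "- s" 0]
  have eq: "G (Complex c y) * cauchy_kernel (- s) 0 (Complex c y) =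
      - (spitzer_neg (Complex (- c) (- y)) * cauchy_kernel s 0 (Complex (- c) (- y)))" for y
  proof -
    have "- Complex c y = Complex (- c) (- y)" by (simp add: complex_eq_iff)
    moreover have "cauchy_kernel (- s) 0 (Complex c y) = - cauchy_kernel s 0 (- Complex c y)"
    proof -
      have "- Complex c y - s = - (Complex c y - - s)" by simp
      thus ?thesis unfolding cauchy_kernel_def by (simp only: divide_minus_right) simp
    qed
    ultimately show ?thesis by (simp add: G_def)
  qed
  have N1: "integrable lborel (\<lambda>y. spitzer_neg (Complex (- c) (- y)) * cauchy_kernel s 0 (Complex (- c) (- y)))"
    using N(1) c s \<open>0 < c\<close> unfolding eq by simp
  have N2: "(LBINT y. spitzer_neg (Complex (- c) (- y)) * cauchy_kernel s 0 (Complex (- c) (- y))) = 0"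
    using N(2) c s \<open>0 < c\<close> unfolding eq by simp
  have N1': "integrable lborel (\<lambda>y. spitzer_neg (Complex (- c) y) * cauchy_kernel s 0 (Complex (- c) y))"
    using lborel_integrable_real_affine[OF N1, of "-1" 0] by simp
  have N2': "(LBINT y. spitzer_neg (Complex (- c) y) * cauchy_kernel s 0 (Complex (- c) y)) = 0"
    using N2 lborel_integral_real_affine[of "-1" "\<lambda>y. spitzer_neg (Complex (- c) y) * cauchy_kernel s 0 (Complex (- c) y)" 0] by simp
  have L: "Ln (1 - step_lt (Complex (- c) y)) * cauchy_kernel s 0 (Complex (- c) y) =
       - (spitzer_pos (Complex (- c) y) * cauchy_kernel s 0 (Complex (- c) y)) -
       (spitzer_neg (Complex (- c) y) * cauchy_kernel s 0 (Complex (- c) y))" for y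
  proof -
    have "Ln (1 - step_lt (Complex (- c) y)) = - (spitzer_pos (Complex (- c) y) + spitzer_neg (Complex (- c) y))"
      using spitzer_pos_plus_neg[of "Complex (- c) y"] c by simp
    thus ?thesis by (simp only:) (simp add: algebra_simps)
  qed
  show "integrable lborel (\<lambda>y. Ln (1 - step_lt (Complex (- c) y)) * cauchy_kernel s 0 (Complex (- c) y))"
    unfolding L using P1 N1' by auto
  show "(LBINT y. Ln (1 - step_lt (Complex (- c) y)) * cauchy_kernel s 0 (Complex (- c) y)) = 2 * pi * spitzer_pos s"
    unfolding L using P1 N1' P2 N2' by simp
qed

end

section \<open>The Gaussian random walk\<close>

abbreviation normal_law :: "real \<Rightarrow> real measure" where
  "normal_law m \<equiv> density lborel (\<lambda>x. ennreal (normal_density m 1 x))"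

text \<open>Tilting by the real part of \<open>z\<close> moves the mean of the normal density by
  \<open>\<theta>\<close> and costs the factor \<open>k\<close>; what remains is a characteristic
  function at the imaginary part.\<close>

lemma normal_law_exp:
  fixes z :: complex
  shows "integrable (normal_law m) (\<lambda>x. exp (z * of_real x))"
    and "(\<integral>x. exp (z * of_real x) \<partial>normal_law m) = exp (z\<^sup>2 / 2 + of_real m * z)"
proof -
  define \<theta> y where "\<theta> = Re z" and "y = Im z"
  have z: "z = of_real \<theta> + \<i> * of_real y" by (simp add: \<theta>_def y_def complex_eq_iff)
  define k where "k = exp (\<theta>\<^sup>2 / 2 + m * \<theta>)"
  have tilt: "normal_density m 1 x *\<^sub>R exp (z * of_real x) = k *\<^sub>R (normal_density (m + \<theta>) 1 x *\<^sub>R iexp (y * x))" for x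
  proof -
    have "normal_density m 1 x * exp (\<theta> * x) = k * normal_density (m + \<theta>) 1 x"
    proof -
      have "- (x - m)\<^sup>2 / 2 + \<theta> * x = (\<theta>\<^sup>2 / 2 + m * \<theta>) + - (x - (m + \<theta>))\<^sup>2 / 2"
        by (simp add: power2_eq_square field_simps)
      thus ?thesis by (simp add: normal_density_def k_def exp_add[symmetric])
    qed
    moreover have "exp (z * of_real x) = exp (\<theta> * x) *\<^sub>R iexp (y * x)"
      by (simp add: z algebra_simps exp_add scaleR_conv_of_real flip: exp_of_real)
    ultimately show ?thesis by simp
  qed
  have int: "integrable lborel (\<lambda>x. normal_density (m + \<theta>) 1 x *\<^sub>R iexp (y * x))"
    by (rule Bochner_Integration.integrable_bound[where f = "normal_density (m + \<theta>) 1"]) auto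
  show "integrable (normal_law m) (\<lambda>x. exp (z * of_real x))"
    using integrable_scaleR_right[of k, OF int] by (subst integrable_density) (auto simp: tilt)
  have "(\<integral>x. exp (z * of_real x) \<partial>normal_law m) = k *\<^sub>R (LBINT x. normal_density (m + \<theta>) 1 x *\<^sub>R iexp (y * x))"
  proof -
    have "(\<integral>x. exp (z * of_real x) \<partial>normal_law m) = (LBINT x. normal_density m 1 x *\<^sub>R exp (z * of_real x))"
      by (subst integral_density) auto
    thus ?thesis unfolding tilt by (simp del: scaleR_scaleR)
  qed
  also have "(LBINT x. normal_density (m + \<theta>) 1 x *\<^sub>R iexp (y * x)) =
      (LBINT x. normal_density (m + \<theta>) 1 ((m + \<theta>) + 1 * x) *\<^sub>R iexp (y * ((m + \<theta>) + 1 * x)))"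
    by (subst lborel_integral_real_affine[of 1 _ "m + \<theta>"]) auto
  also have "\<dots> = (LBINT x. iexp (y * (m + \<theta>)) * (std_normal_density x *\<^sub>R iexp (y * x)))"
    by (intro Bochner_Integration.integral_cong) (auto simp: normal_density_def algebra_simps exp_add)
  also have "\<dots> = iexp (y * (m + \<theta>)) * (LBINT x. std_normal_density x *\<^sub>R iexp (y * x))"
    by (rule integral_mult_right_zero)
  also have "(LBINT x. std_normal_density x *\<^sub>R iexp (y * x)) = char std_normal_distribution y"
    unfolding char_def by (subst integral_density) auto
  also have "\<dots> = exp (- of_real (y\<^sup>2) / 2)"
    by (simp add: char_std_normal_distribution exp_of_real[symmetric])
  finally have "(\<integral>x. exp (z * of_real x) \<partial>normal_law m) = of_real k * (iexp (y * (m + \<theta>)) * exp (- of_real (y\<^sup>2) / 2))"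
    by (simp add: scaleR_conv_of_real)
  also have "\<dots> = exp (of_real (\<theta>\<^sup>2 / 2 + m * \<theta>) + (\<i> * of_real (y * (m + \<theta>)) + - of_real (y\<^sup>2) / 2))"
    unfolding k_def exp_of_real[symmetric] by (simp only: exp_add)
  also have "of_real (\<theta>\<^sup>2 / 2 + m * \<theta>) + (\<i> * of_real (y * (m + \<theta>)) + - of_real (y\<^sup>2) / 2) = z\<^sup>2 / 2 + of_real m * z"
    unfolding z by (simp add: complex_eq_iff power2_eq_square field_simps)
  finally show "(\<integral>x. exp (z * of_real x) \<partial>normal_law m) = exp (z\<^sup>2 / 2 + of_real m * z)" .
qed

lemma normal_law_exp_real:
  shows "integrable (normal_law m) (\<lambda>x. exp (\<theta> * x))"
    and "(\<integral>x. exp (\<theta> * x) \<partial>normal_law m) = exp (\<theta>\<^sup>2 / 2 + m * \<theta>)"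
proof -
  have i: "integrable (normal_law m) (\<lambda>x. complex_of_real (exp (\<theta> * x)))"
    using normal_law_exp(1)[of m "of_real \<theta>"] by (simp add: exp_of_real[symmetric])
  from integrable_Re[OF this] show "integrable (normal_law m) (\<lambda>x. exp (\<theta> * x))" by simp
  have "complex_of_real (\<integral>x. exp (\<theta> * x) \<partial>normal_law m) = (\<integral>x. complex_of_real (exp (\<theta> * x)) \<partial>normal_law m)"
    by simp
  also have "\<dots> = complex_of_real (exp (\<theta>\<^sup>2 / 2 + m * \<theta>))"
    using normal_law_exp(2)[of m "of_real \<theta>"] by (simp add: exp_of_real[symmetric])
  finally show "(\<integral>x. exp (\<theta> * x) \<partial>normal_law m) = exp (\<theta>\<^sup>2 / 2 + m * \<theta>)"
    by (simp only: of_real_eq_iff)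
qed

text \<open>The supremum of an unbounded set of reals is one fixed junk value.\<close>

lemma walk_max_unbounded:
  assumes "\<not> bdd_above (range (\<lambda>k. \<Sum>i<k. x i))"
  shows "walk_max x = (LEAST z :: real. False)"
proof -
  have "(\<forall>y\<in>range (\<lambda>k. \<Sum>i<k. x i). y \<le> z) = False" for z
    using assms by (auto simp: bdd_above_def)
  hence "(\<lambda>z. \<forall>y\<in>range (\<lambda>k. \<Sum>i<k. x i). y \<le> z) = (\<lambda>z. False)" by (intro ext) simp
  thus ?thesis unfolding walk_max_def Sup_real_def by simp
qed

text \<open>Measurability of a supremum asks for a bounded family at every point, which fails for
  walks unbounded above. The predicate \<open>P\<close>, measurable thanks to its countable
  quantifiers, separates them: their partial sums are replaced by 0, and \<open>walk_max\<close> is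
  constant there.\<close>

lemma measurable_walk_max:
  fixes M :: "real measure"
  assumes [measurable_cong]: "sets M = sets borel"
  shows "walk_max \<in> borel_measurable (\<Pi>\<^sub>M i\<in>UNIV::nat set. M)"
proof -
  let ?S = "\<Pi>\<^sub>M i\<in>UNIV::nat set. M"
  define P where "P = (\<lambda>x :: nat \<Rightarrow> real. \<exists>n::nat. \<forall>k. (\<Sum>i<k. x i) \<le> real n)"
  have P: "P x \<longleftrightarrow> bdd_above (range (\<lambda>k. \<Sum>i<k. x i))" for x
  proof
    assume "bdd_above (range (\<lambda>k. \<Sum>i<k. x i))"
    then obtain C where C: "\<And>k. (\<Sum>i<k. x i) \<le> C" by (auto simp: bdd_above_def)
    obtain n where "C \<le> real n" using real_arch_simple by blast
    thus "P x" unfolding P_def using C order_trans by blast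
  qed (auto simp: P_def bdd_above_def)
  have comp [measurable]: "(\<lambda>x. x i) \<in> borel_measurable ?S" for i
    using measurable_component_singleton[of i UNIV "\<lambda>_. M"] by (simp add: measurable_cong_sets[OF refl assms])
  have [measurable]: "Measurable.pred ?S P" unfolding P_def by measurable
  have "(\<lambda>x. SUP k. if P x then \<Sum>i<k. x i else 0) \<in> borel_measurable ?S"
  proof (rule borel_measurable_cSUP)
    fix x show "bdd_above ((\<lambda>k. if P x then \<Sum>i<k. x i else 0) ` UNIV)"
      by (cases "P x") (auto simp: P)
  qed auto
  hence "(\<lambda>x. if P x then (SUP k. if P x then \<Sum>i<k. x i else 0) else (LEAST z :: real. False)) \<in> borel_measurable ?S"
    by measurable
  moreover have "walk_max = (\<lambda>x. if P x then (SUP k. if P x then \<Sum>i<k. x i else 0) else (LEAST z :: real. False))"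
  proof (rule ext)
    fix x show "walk_max x = (if P x then (SUP k. if P x then \<Sum>i<k. x i else 0) else (LEAST z :: real. False))"
    proof (cases "P x")
      case True thus ?thesis by (simp add: walk_max_def)
    next
      case False thus ?thesis using walk_max_unbounded[of x] by (simp add: P)
    qed
  qed
  ultimately show ?thesis by simp
qed

text \<open>The Lindley recursion path by path: a prefixed step \<open>a\<close> is added to every
  partial sum, and the new empty sum acts as the reflecting barrier 0.\<close>

lemma walk_max_case_nat:
  assumes "bdd_above (range (\<lambda>k. \<Sum>i<k. x i))"
  shows "walk_max (case_nat a x) = max 0 (walk_max x + a)"
proof -
  have e: "(\<Sum>i<k. case_nat a x i) = (case k of 0 \<Rightarrow> 0 | Suc j \<Rightarrow> a + (\<Sum>i<j. x i))" for k
    by (cases k) (auto simp: sum.lessThan_Suc_shift simp del: sum.lessThan_Suc)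
  define R where "R = range (\<lambda>k. \<Sum>i<k. x i)"
  have R: "R \<noteq> {}" "bdd_above R" using assms by (auto simp: R_def)
  have r: "range (\<lambda>k. \<Sum>i<k. case_nat a x i) = insert 0 ((+) a ` R)"
  proof (intro equalityI subsetI)
    fix y assume "y \<in> range (\<lambda>k. \<Sum>i<k. case_nat a x i)"
    then obtain k where "y = (case k of 0 \<Rightarrow> 0 | Suc j \<Rightarrow> a + (\<Sum>i<j. x i))" unfolding e by blast
    thus "y \<in> insert 0 ((+) a ` R)" by (cases k) (simp_all add: R_def)
  next
    fix y assume "y \<in> insert 0 ((+) a ` R)"
    then consider "y = 0" | j where "y = a + (\<Sum>i<j. x i)" unfolding R_def by blast
    thus "y \<in> range (\<lambda>k. \<Sum>i<k. case_nat a x i)"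
    proof cases
      case 1 thus ?thesis by (intro range_eqI[of _ _ 0]) simp
    next
      case (2 j) thus ?thesis by (intro range_eqI[of _ _ "Suc j"]) (simp only: e nat.case)
    qed
  qed
  have "Sup ((+) a ` R) = a + Sup R"
  proof (rule continuous_at_Sup_mono[symmetric])
    show "continuous (at_left (Sup R)) ((+) a)" by (intro continuous_intros)
    show "mono ((+) a)" by (intro monoI) simp
  qed (rule R)+
  moreover have "bdd_above ((+) a ` R)"
    using R(2) by (intro bdd_above_image_mono) (auto intro: monoI)
  ultimately have "Sup (insert 0 ((+) a ` R)) = sup 0 (a + Sup R)"
    using R(1) by (subst cSup_insert) auto
  thus ?thesis unfolding walk_max_def r sup_max by (simp only: R_def add.commute)
qed

lemma walk_max_nonneg:
  assumes "bdd_above (range (\<lambda>k. \<Sum>i<k. x i))" shows "0 \<le> walk_max x"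
  unfolding walk_max_def using cSUP_upper[OF _ assms, of 0] by simp

text \<open>Induction on \<open>k\<close>, splitting off the first coordinate of the sequence space.
  With nonnegative integrals the product formula applies even before finiteness is known.\<close>

lemma nn_integral_exp_partial_sum:
  fixes M :: "real measure"
  assumes "prob_space M" and [measurable_cong]: "sets M = sets borel"
  shows "(\<integral>\<^sup>+x. ennreal (exp (\<theta> * (\<Sum>i<k. x i))) \<partial>(\<Pi>\<^sub>M i\<in>UNIV::nat set. M)) = (\<integral>\<^sup>+x. ennreal (exp (\<theta> * x)) \<partial>M) ^ k"
proof -
  interpret prob_space M by fact
  interpret sequence_space M ..
  interpret T: pair_sigma_finite M S ..
  have comp [measurable]: "(\<lambda>x. x i) \<in> borel_measurable S" for i
    using measurable_component_singleton[of i UNIV "\<lambda>_. M"] by (simp add: measurable_cong_sets[OF refl assms(2)])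
  have "(\<lambda>s :: real. ennreal (exp (\<theta> * s))) \<in> borel_measurable borel" by measurable
  hence mM: "(\<lambda>s. ennreal (exp (\<theta> * s))) \<in> borel_measurable M"
    by (simp add: measurable_cong_sets[OF assms(2) refl])
  have m [measurable]: "(\<lambda>\<omega>. ennreal (exp (\<theta> * (\<Sum>i<k. \<omega> i)))) \<in> borel_measurable S" for k
    by (intro measurable_compose[OF _ measurable_ennreal] measurable_compose[OF _ borel_measurable_exp]
        borel_measurable_times borel_measurable_const borel_measurable_sum comp)
  have [measurable]: "(\<lambda>p. snd p i) \<in> borel_measurable (M \<Otimes>\<^sub>M S)" for i
    by (rule measurable_compose[OF measurable_snd comp])
  show ?thesis
  proof (induction k)
    case 0
    thus ?case using P.emeasure_space_1 by simp
  next
    case (Suc k)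
    have c: "(\<lambda>(s, \<omega>). case_nat s \<omega>) \<in> M \<Otimes>\<^sub>M S \<rightarrow>\<^sub>M S" by measurable
    have "(\<integral>\<^sup>+x. ennreal (exp (\<theta> * (\<Sum>i<Suc k. x i))) \<partial>S) =
      (\<integral>\<^sup>+x. ennreal (exp (\<theta> * (\<Sum>i<Suc k. x i))) \<partial>distr (M \<Otimes>\<^sub>M S) S (\<lambda>(s, \<omega>). case_nat s \<omega>))"
      by (simp only: PiM_iter)
    also have "\<dots> = (\<integral>\<^sup>+p. ennreal (exp (\<theta> * (\<Sum>i<Suc k. (case p of (s, \<omega>) \<Rightarrow> case_nat s \<omega>) i))) \<partial>(M \<Otimes>\<^sub>M S))"
      by (rule nn_integral_distr[OF c]) measurable
    also have "\<dots> = (\<integral>\<^sup>+p. ennreal (exp (\<theta> * fst p)) * ennreal (exp (\<theta> * (\<Sum>i<k. snd p i))) \<partial>(M \<Otimes>\<^sub>M S))"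
      by (intro nn_integral_cong)
         (auto simp: sum.lessThan_Suc_shift ennreal_mult[symmetric] exp_add[symmetric] algebra_simps simp del: sum.lessThan_Suc)
    also have "\<dots> = (\<integral>\<^sup>+s. \<integral>\<^sup>+\<omega>. ennreal (exp (\<theta> * s)) * ennreal (exp (\<theta> * (\<Sum>i<k. \<omega> i))) \<partial>S \<partial>M)"
      by (subst P.nn_integral_fst[symmetric]) auto
    also have "\<dots> = (\<integral>\<^sup>+s. ennreal (exp (\<theta> * s)) * (\<integral>\<^sup>+\<omega>. ennreal (exp (\<theta> * (\<Sum>i<k. \<omega> i))) \<partial>S) \<partial>M)"
      by (intro nn_integral_cong nn_integral_cmult m)
    also have "\<dots> = (\<integral>\<^sup>+s. ennreal (exp (\<theta> * s)) \<partial>M) * (\<integral>\<^sup>+\<omega>. ennreal (exp (\<theta> * (\<Sum>i<k. \<omega> i))) \<partial>S)"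
      by (rule nn_integral_multc[OF mM])
    finally show ?case using Suc by simp
  qed
qed

text \<open>The exponentials of all partial sums have a finite total mean, a geometric series. Their
  sum is therefore finite almost surely, and it bounds every partial sum through exp x \<ge> 1 +
  x.\<close>

lemma AE_bdd_above_partial_sums:
  fixes M :: "real measure"
  assumes M: "prob_space M" and sM [measurable_cong]: "sets M = sets borel"
    and \<theta>: "0 < \<theta>" "integrable M (\<lambda>x. exp (\<theta> * x))" "(\<integral>x. exp (\<theta> * x) \<partial>M) < 1"
  shows "AE x in (\<Pi>\<^sub>M i\<in>UNIV::nat set. M). bdd_above (range (\<lambda>k. \<Sum>i<k. x i))"
proof -
  let ?S = "\<Pi>\<^sub>M i\<in>UNIV::nat set. M"
  have comp [measurable]: "(\<lambda>x. x i) \<in> borel_measurable ?S" for i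
    using measurable_component_singleton[of i UNIV "\<lambda>_. M"] by (simp add: measurable_cong_sets[OF refl sM])
  define q where "q = (\<integral>x. exp (\<theta> * x) \<partial>M)"
  have q: "0 \<le> q" "q < 1" "(\<integral>\<^sup>+x. ennreal (exp (\<theta> * x)) \<partial>M) = ennreal q"
    using \<theta> by (auto simp: q_def nn_integral_eq_integral)
  have "(\<integral>\<^sup>+x. (\<Sum>k. ennreal (exp (\<theta> * (\<Sum>i<k. x i)))) \<partial>?S) = (\<Sum>k. ennreal q ^ k)"
    unfolding q(3)[symmetric] nn_integral_exp_partial_sum[OF M sM, symmetric]
    by (rule nn_integral_suminf) measurable
  also have "\<dots> = (\<Sum>k. ennreal (q ^ k))" using q(1) by (simp only: ennreal_power)
  also have "\<dots> = ennreal (\<Sum>k. q ^ k)" using q by (intro suminf_ennreal2 summable_geometric) auto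
  finally have "(\<integral>\<^sup>+x. (\<Sum>k. ennreal (exp (\<theta> * (\<Sum>i<k. x i)))) \<partial>?S) \<noteq> \<infinity>" by simp
  hence "AE x in ?S. (\<Sum>k. ennreal (exp (\<theta> * (\<Sum>i<k. x i)))) \<noteq> \<infinity>"
    by (intro nn_integral_PInf_AE borel_measurable_suminf_order) auto
  thus ?thesis
  proof eventually_elim
    case (elim x)
    hence fin: "(\<Sum>k. ennreal (exp (\<theta> * (\<Sum>i<k. x i)))) < top"
      unfolding infinity_ennreal_def less_top .
    define C where "C = enn2real (\<Sum>k. ennreal (exp (\<theta> * (\<Sum>i<k. x i))))"
    have C: "(\<Sum>k. ennreal (exp (\<theta> * (\<Sum>i<k. x i)))) = ennreal C" "0 \<le> C"
        by (simp_all only: C_def ennreal_enn2real[OF fin] enn2real_nonneg)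
    have "(\<Sum>i<k. x i) \<le> C / \<theta>" for k
    proof -
      have "ennreal (exp (\<theta> * (\<Sum>i<k. x i))) \<le> ennreal C"
      proof -
        have "(\<Sum>k\<in>{k}. ennreal (exp (\<theta> * (\<Sum>i<k. x i)))) \<le> (\<Sum>k. ennreal (exp (\<theta> * (\<Sum>i<k. x i))))"
          by (rule sum_le_suminf) auto
        thus ?thesis unfolding C(1) by (simp only: sum.insert sum.empty finite.emptyI empty_iff add_0_right not_False_eq_True)
      qed
      hence "exp (\<theta> * (\<Sum>i<k. x i)) \<le> C" using C(2) by (simp add: ennreal_le_iff)
      hence "\<theta> * (\<Sum>i<k. x i) \<le> C" using exp_ge_add_one_self[of "\<theta> * (\<Sum>i<k. x i)"] by linarith
      thus ?thesis using \<theta>(1) by (simp add: field_simps)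
    qed
    thus ?case by (intro bdd_aboveI[of _ "C / \<theta>"]) auto
  qed
qed

text \<open>The sequence space is the product of the first step and an independent copy of itself,
  which turns the pathwise recursion into an identity of laws. The factors are swapped because the
  locale lists the waiting time before the step.\<close>

lemma lindley_stationary_walk_max:
  fixes M :: "real measure"
  assumes M: "prob_space M" and sM [measurable_cong]: "sets M = sets borel" and c: "0 < c\<^sub>2" "c\<^sub>2 < c\<^sub>1"
    and i: "\<And>\<theta>. c\<^sub>2 \<le> \<theta> \<Longrightarrow> \<theta> \<le> c\<^sub>1 \<Longrightarrow> integrable M (\<lambda>x. exp (\<theta> * x))"
    and l: "\<And>\<theta>. c\<^sub>2 \<le> \<theta> \<Longrightarrow> \<theta> \<le> c\<^sub>1 \<Longrightarrow> (\<integral>x. exp (\<theta> * x) \<partial>M) < 1"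
  shows "lindley_stationary M (distr (\<Pi>\<^sub>M i\<in>UNIV::nat set. M) borel walk_max) c\<^sub>1 c\<^sub>2"
proof -
  interpret prob_space M by fact
  interpret sequence_space M ..
  interpret T: pair_sigma_finite M S ..
  note [measurable] = measurable_walk_max[OF sM]
  have bdd: "AE x in S. bdd_above (range (\<lambda>k. \<Sum>i<k. x i))"
    by (rule AE_bdd_above_partial_sums[OF M sM, of c\<^sub>1]) (use c i l in auto)
  interpret W: prob_space "distr S borel walk_max" by (rule P.prob_space_distr) simp
  have cm: "(\<lambda>(s, \<omega>). case_nat s \<omega>) \<in> M \<Otimes>\<^sub>M S \<rightarrow>\<^sub>M S" by measurable
  have "distr S borel walk_max = distr (distr (M \<Otimes>\<^sub>M S) S (\<lambda>(s, \<omega>). case_nat s \<omega>)) borel walk_max"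
    by (simp only: PiM_iter)
  also have "\<dots> = distr (M \<Otimes>\<^sub>M S) borel (walk_max \<circ> (\<lambda>(s, \<omega>). case_nat s \<omega>))"
    by (rule distr_distr[OF _ cm]) simp
  also have "\<dots> = distr (distr (S \<Otimes>\<^sub>M M) (M \<Otimes>\<^sub>M S) (\<lambda>(x, y). (y, x))) borel (walk_max \<circ> (\<lambda>(s, \<omega>). case_nat s \<omega>))"
    by (simp only: T.distr_pair_swap[symmetric])
  also have "\<dots> = distr (S \<Otimes>\<^sub>M M) borel (\<lambda>(\<omega>, s). walk_max (case_nat s \<omega>))"
    using cm by (subst distr_distr) (auto simp: o_def case_prod_unfold)
  also have "\<dots> = distr (S \<Otimes>\<^sub>M M) borel (\<lambda>(\<omega>, s). max 0 (walk_max \<omega> + s))"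
  proof (rule distr_cong_AE)
    have "AE \<omega> in distr (S \<Otimes>\<^sub>M M) S fst. bdd_above (range (\<lambda>k. \<Sum>i<k. \<omega> i))"
      using bdd by (simp only: prob_space.distr_pair_fst[OF M])
    hence "AE p in S \<Otimes>\<^sub>M M. bdd_above (range (\<lambda>k. \<Sum>i<k. fst p i))"
      by (rule AE_distrD[rotated]) simp
    thus "AE p in S \<Otimes>\<^sub>M M. (case p of (\<omega>, s) \<Rightarrow> walk_max (case_nat s \<omega>)) = (case p of (\<omega>, s) \<Rightarrow> max 0 (walk_max \<omega> + s))"
      by eventually_elim (auto simp: walk_max_case_nat split: prod.split)
  qed auto
  also have "\<dots> = distr (distr (S \<Otimes>\<^sub>M M) (borel \<Otimes>\<^sub>M M) (\<lambda>(x, y). (walk_max x, y))) borel (\<lambda>(w, s). max 0 (w + s))"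
    by (subst distr_distr) (auto simp: o_def case_prod_unfold)
  also have "distr (S \<Otimes>\<^sub>M M) (borel \<Otimes>\<^sub>M M) (\<lambda>(x, y). (walk_max x, y)) = distr S borel walk_max \<Otimes>\<^sub>M distr M M (\<lambda>x. x)"
    by (subst pair_measure_distr) (auto simp: distr_id2 prob_space_imp_sigma_finite[OF M])
  also have "distr M M (\<lambda>x. x) = M" by (simp add: distr_id2)
  finally have st: "distr S borel walk_max = distr (distr S borel walk_max \<Otimes>\<^sub>M M) borel (\<lambda>(w, s). max 0 (w + s))" .
  show ?thesis
  proof unfold_locales
    show "AE w in distr S borel walk_max. 0 \<le> w"
      using bdd by (subst AE_distr_iff) (auto elim: eventually_mono intro: walk_max_nonneg)
  qed (use sM c i l st in \<open>simp_all\<close>)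
qed

text \<open>The exponent \<theta>^2 / 2 - B \<theta> is negative exactly for 0 < \<theta> < 2 B. The
  strip from \<open>B / 4\<close> to \<open>7 / 4 * B\<close> is symmetric about the saddle
  \<open>B\<close> and admits every line at distance less than \<open>3 / 4 * B\<close> from it. The
  freedom in \<open>a\<close> is what later allows the line to be fitted to the ends of a Moebius
  image.\<close>

lemma gaussian_walk_log_transform:
  assumes B: "0 < B"
  obtains L :: "complex \<Rightarrow> complex" where "is_log_transform (gaussian_steps B) walk_max B L"
    "\<And>a r. \<bar>a\<bar> < 3 / 4 * B \<Longrightarrow> a < Re r + B \<Longrightarrow>
      (LBINT y. Ln (1 - exp (((Complex a y)\<^sup>2 - of_real (B\<^sup>2)) / 2)) * cauchy_kernel (r + of_real B) (of_real B) (Complex a y)) = 2 * pi * L r"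
proof -
  let ?N = "normal_law (- B)"
  have mgf: "(\<integral>x. exp (\<theta> * x) \<partial>?N) < 1" if "B / 4 \<le> \<theta>" "\<theta> \<le> 7 / 4 * B" for \<theta>
  proof -
    have "\<theta>\<^sup>2 / 2 + - B * \<theta> = \<theta> * (\<theta> / 2 - B)" by (simp add: power2_eq_square algebra_simps)
    also have "\<dots> < 0" using that B by (intro mult_pos_neg) auto
    finally show ?thesis unfolding normal_law_exp_real by simp
  qed
  interpret lindley_stationary ?N "distr (\<Pi>\<^sub>M i\<in>UNIV::nat set. ?N) borel walk_max" "7 / 4 * B" "B / 4"
    by (rule lindley_stationary_walk_max)
       (use B mgf normal_law_exp_real(1) in \<open>auto intro: prob_space_normal_density\<close>)
  have gs: "gaussian_steps B = (\<Pi>\<^sub>M i\<in>UNIV::nat set. ?N)" by (simp add: gaussian_steps_def)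
  have wm: "walk_max \<in> borel_measurable (gaussian_steps B)" unfolding gs by (rule measurable_walk_max) simp
  \<comment> \<open>Completing the square centres the coordinate at the saddle point, so that lines
    are described by \<open>a\<close> instead of \<open>- (B - a)\<close>.\<close>
  have lt: "step_lt u = exp (((u + of_real B)\<^sup>2 - of_real (B\<^sup>2)) / 2)" for u
    unfolding step_lt_def normal_law_exp
    by (rule arg_cong[of _ _ exp]) (simp add: power2_eq_square algebra_simps add_divide_distrib)
  show ?thesis
  proof (rule that[of spitzer_pos])
    show "is_log_transform (gaussian_steps B) walk_max B spitzer_pos"
      unfolding is_log_transform_def
    proof (intro conjI allI impI)
      show "spitzer_pos holomorphic_on {s. - B < Re s}"
        by (rule holomorphic_on_subset[OF holomorphic_spitzer_pos]) (use B in auto)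
      show "spitzer_pos 0 = 0" by (rule spitzer_pos_0)
      fix s assume s: "- B < Re s"
      have s': "- (7 / 4 * B) < Re s" using s B by simp
      show "integrable (gaussian_steps B) (\<lambda>\<omega>. exp (- s * complex_of_real (walk_max \<omega>)))"
        using integrable_wait_lt[of s] s' unfolding gs[symmetric] by (intro integrable_distr[OF wm]) auto
      show "exp (spitzer_pos s) = (\<integral>\<omega>. exp (- s * complex_of_real (walk_max \<omega>)) \<partial>gaussian_steps B)"
        unfolding exp_spitzer_pos[OF s'] wait_lt_def unfolding gs[symmetric]
        by (subst integral_distr) (use wm in auto)
    qed
    fix a r assume a: "\<bar>a\<bar> < 3 / 4 * B" "a < Re r + B"
    have "(LBINT y. Ln (1 - step_lt (Complex (- (B - a)) y)) * cauchy_kernel r 0 (Complex (- (B - a)) y)) = 2 * pi * spitzer_pos r"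
      by (rule pollaczek(2)) (use a in auto)
    moreover have "Complex (- (B - a)) y + of_real B = Complex a y" for y by (simp add: complex_eq_iff)
    moreover have "cauchy_kernel r 0 (Complex (- (B - a)) y) = cauchy_kernel (r + of_real B) (of_real B) (Complex a y)" for y
      by (simp add: cauchy_kernel_def complex_eq_iff) (simp add: Complex_eq algebra_simps)
    ultimately show "(LBINT y. Ln (1 - exp (((Complex a y)\<^sup>2 - of_real (B\<^sup>2)) / 2)) * cauchy_kernel (r + of_real B) (of_real B) (Complex a y)) = 2 * pi * spitzer_pos r"
      unfolding lt by simp
  qed
qed

section \<open>Comparison of the contour integrals\<close>

lemma norm_Ln_one_minus_diff_le:
  assumes "cmod x \<le> q" "cmod y \<le> q" "q < 1"
  shows "cmod (Ln (1 - x) - Ln (1 - y)) \<le> 1 / (1 - q) * cmod (x - y)"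
proof (rule field_differentiable_bound[where S = "cball 0 q" and f' = "\<lambda>z. - 1 / (1 - z)"])
  fix z :: complex assume z: "z \<in> cball 0 q"
  have "Re z < 1" using z assms abs_Re_le_cmod[of z] by auto
  hence nn: "1 - z \<notin> \<real>\<^sub>\<le>\<^sub>0" by (auto simp: complex_nonpos_Reals_iff)
  show "((\<lambda>z. Ln (1 - z)) has_field_derivative - 1 / (1 - z)) (at z within cball 0 q)"
    using nn by (auto intro!: derivative_eq_intros simp: divide_inverse)
  have "1 - q \<le> cmod (1 - z)" using z norm_triangle_ineq2[of 1 z] by auto
  thus "cmod (- 1 / (1 - z)) \<le> 1 / (1 - q)"
    using assms by (auto simp: norm_divide intro!: divide_left_mono mult_pos_pos)
qed (use assms in auto)

lemma norm_Ln_one_minus_le: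
  assumes "cmod x \<le> q" "q < 1"
  shows "cmod (Ln (1 - x)) \<le> 1 / (1 - q) * cmod x"
  using norm_Ln_one_minus_diff_le[of x q 0] assms order_trans[OF norm_ge_zero assms(1)] by simp

lemma continuous_on_Ln_one_minus:
  fixes f :: "'a :: topological_space \<Rightarrow> complex"
  assumes "continuous_on A f" "\<And>x. x \<in> A \<Longrightarrow> cmod (f x) \<le> q" "q < 1"
  shows "continuous_on A (\<lambda>x. Ln (1 - f x))"
proof (rule continuous_on_compose2[where g = Ln and t = "- \<real>\<^sub>\<le>\<^sub>0"])
  show "continuous_on (- \<real>\<^sub>\<le>\<^sub>0) Ln"
    by (intro holomorphic_on_imp_continuous_on holomorphic_on_Ln) auto
  show "(\<lambda>x. 1 - f x) ` A \<subseteq> - \<real>\<^sub>\<le>\<^sub>0"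
  proof
    fix z assume "z \<in> (\<lambda>x. 1 - f x) ` A"
    then obtain x where "x \<in> A" "z = 1 - f x" by blast
    moreover from this have "Re (f x) < 1"
      using assms(2)[of x] assms(3) complex_Re_le_cmod[of "f x"] by linarith
    ultimately show "z \<in> - \<real>\<^sub>\<le>\<^sub>0" by (auto simp: complex_nonpos_Reals_iff)
  qed
qed (intro continuous_intros assms)

section \<open>Moebius maps and the Cauchy kernel\<close>

definition moebius :: "real \<Rightarrow> complex \<Rightarrow> complex" where
  "moebius \<phi> t = t / (1 + of_real \<phi> * t)"

lemma moebius_diff:
  assumes "1 + of_real \<phi> * t \<noteq> 0" "1 + of_real \<phi> * p \<noteq> 0"
  shows "moebius \<phi> t - moebius \<phi> p = (t - p) / ((1 + of_real \<phi> * t) * (1 + of_real \<phi> * p))"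
  using assms by (simp add: moebius_def diff_frac_eq) (simp add: algebra_simps)

text \<open>The kernel is the logarithmic derivative of a cross-ratio, hence invariant.\<close>

lemma cauchy_kernel_moebius:
  assumes "1 + of_real \<phi> * t \<noteq> 0" "1 + of_real \<phi> * p \<noteq> 0" "1 + of_real \<phi> * q \<noteq> 0" "t \<noteq> p" "t \<noteq> q"
  shows "cauchy_kernel (moebius \<phi> p) (moebius \<phi> q) (moebius \<phi> t) / (1 + of_real \<phi> * t)\<^sup>2 = cauchy_kernel p q t"
proof -
  define T P Q where "T = 1 + of_real \<phi> * t" and "P = 1 + of_real \<phi> * p" and "Q = 1 + of_real \<phi> * q"
  have nz: "T \<noteq> 0" "P \<noteq> 0" "Q \<noteq> 0" "t - p \<noteq> 0" "t - q \<noteq> 0" using assms by (auto simp: T_def P_def Q_def)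
  have "cauchy_kernel (moebius \<phi> p) (moebius \<phi> q) (moebius \<phi> t) / T\<^sup>2 = (T * P / (t - p) - T * Q / (t - q)) / T\<^sup>2"
    unfolding cauchy_kernel_def moebius_diff[OF assms(1,2)] moebius_diff[OF assms(1,3)] T_def P_def Q_def by simp
  also have "\<dots> = (P * (t - q) - Q * (t - p)) / (T * ((t - p) * (t - q)))"
  proof -
    have "T * P / (t - p) - T * Q / (t - q) = T * (P * (t - q) - Q * (t - p)) / ((t - p) * (t - q))"
      using nz by (simp add: diff_frac_eq algebra_simps)
    thus ?thesis using nz by (simp add: power2_eq_square)
  qed
  also have "P * (t - q) - Q * (t - p) = T * (p - q)"
    by (simp add: T_def P_def Q_def algebra_simps)
  also have "T * (p - q) / (T * ((t - p) * (t - q))) = (p - q) / ((t - p) * (t - q))" using nz by simp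
  also have "\<dots> = cauchy_kernel p q t" using nz by (simp add: cauchy_kernel_def field_simps)
  finally show ?thesis by (simp add: T_def)
qed

lemma norm_moebius_denominator:
  assumes "cmod (of_real \<phi> * p) \<le> 1 / 2"
  shows "1 / 2 \<le> cmod (1 + of_real \<phi> * p)" "1 + of_real \<phi> * p \<noteq> 0"
proof -
  show 1: "1 / 2 \<le> cmod (1 + of_real \<phi> * p)"
    using norm_triangle_ineq4[of "1 + of_real \<phi> * p" "of_real \<phi> * p"] assms by simp
  thus "1 + of_real \<phi> * p \<noteq> 0" by auto
qed

lemma norm_moebius_minus_id_le:
  assumes "cmod (of_real \<phi> * p) \<le> 1 / 2"
  shows "cmod (moebius \<phi> p - p) \<le> 2 * \<bar>\<phi>\<bar> * (cmod p)\<^sup>2"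
proof -
  note d = norm_moebius_denominator[OF assms]
  have "moebius \<phi> p - p = - (of_real \<phi> * p\<^sup>2) / (1 + of_real \<phi> * p)"
    using d by (simp add: moebius_def field_simps power2_eq_square)
  hence "cmod (moebius \<phi> p - p) = \<bar>\<phi>\<bar> * (cmod p)\<^sup>2 / cmod (1 + of_real \<phi> * p)"
    by (simp add: norm_divide norm_mult norm_power)
  also have "\<dots> \<le> \<bar>\<phi>\<bar> * (cmod p)\<^sup>2 / (1 / 2)"
    using d by (intro divide_left_mono mult_pos_pos) auto
  finally show ?thesis by simp
qed

text \<open>For nonzero \<phi> the image of the imaginary axis lies on the circle with diameter from
  0 to 1 / \<phi>. It is symmetric under conjugation, so the two ends of a symmetric segment land on
  one vertical line.\<close>

lemma moebius_imaginary:
  "moebius \<phi> (Complex 0 y) = Complex (\<phi> * y\<^sup>2 / (1 + (\<phi> * y)\<^sup>2)) (y / (1 + (\<phi> * y)\<^sup>2))"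
proof -
  have "(1 + (\<phi> * y)\<^sup>2) \<noteq> 0" by (smt (verit) zero_le_power2)
  moreover have "1 + of_real \<phi> * Complex 0 y = Complex 1 (\<phi> * y)" by (simp add: complex_eq_iff)
  ultimately show ?thesis
    by (simp add: moebius_def complex_eq_iff Re_divide Im_divide power2_eq_square) 
qed

lemma abs_Re_moebius_imaginary_le: "\<bar>Re (moebius \<phi> (Complex 0 y))\<bar> \<le> \<bar>\<phi>\<bar> * y\<^sup>2"
proof -
  have "\<bar>\<phi>\<bar> * y\<^sup>2 / (1 + (\<phi> * y)\<^sup>2) \<le> \<bar>\<phi>\<bar> * y\<^sup>2 / 1"
    by (intro divide_left_mono) (auto intro: add_pos_nonneg)
  moreover have "\<bar>1 + (\<phi> * y)\<^sup>2\<bar> = 1 + (\<phi> * y)\<^sup>2" by (simp add: add_nonneg_nonneg)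
  ultimately show ?thesis by (simp add: moebius_imaginary abs_mult)
qed

text \<open>The constants \<open>b\<^sub>1\<close>, \<open>b\<^sub>2\<close> and \<open>S\<close>
  are uniform in \<open>n\<close> and \<open>s\<close>. The bound \<open>\<phi>_half\<close> keeps
  the Moebius denominators at the two poles at least \<open>1 / 2\<close> in modulus;
  \<open>\<phi>_small\<close> lets the poles move by at most \<open>b\<^sub>1 / 8\<close>; the
  bounds on \<open>Y\<close> keep the image of the segment within \<open>b\<^sub>1 / 8\<close> of
  the imaginary axis and its height at least \<open>Y / 2\<close>.\<close>

locale gaussian_comparison =
  fixes b\<^sub>1 b\<^sub>2 S \<beta> \<phi> Y :: real and s :: complex
  assumes b: "0 < b\<^sub>1" "b\<^sub>1 \<le> \<beta>" "\<beta> \<le> b\<^sub>2"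
    and s: "cmod s \<le> S" "- \<beta> / 2 \<le> Re s"
    and \<phi>_half: "\<bar>\<phi>\<bar> * (S + b\<^sub>2) \<le> 1 / 2"
    and \<phi>_small: "2 * \<bar>\<phi>\<bar> * (S + b\<^sub>2)\<^sup>2 \<le> b\<^sub>1 / 8"
    and Y: "0 < Y" "\<bar>\<phi>\<bar> * Y\<^sup>2 \<le> b\<^sub>1 / 8" "\<bar>\<phi>\<bar> * Y \<le> 1"
begin

abbreviation "B \<equiv> \<beta> / (1 + \<beta> * \<phi>)"
abbreviation "p \<equiv> s + complex_of_real \<beta>"
abbreviation "R \<equiv> s / ((1 + complex_of_real (\<beta> * \<phi>)) * (1 + p * complex_of_real \<phi>))"

lemma norm_p: "cmod p \<le> S + b\<^sub>2" "cmod (complex_of_real \<beta>) \<le> S + b\<^sub>2"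
  using norm_triangle_ineq[of s "complex_of_real \<beta>"] b s order_trans[OF norm_ge_zero s(1)] by auto

lemma small: "cmod (of_real \<phi> * p) \<le> 1 / 2" "cmod (of_real \<phi> * complex_of_real \<beta>) \<le> 1 / 2"
proof -
  have "cmod (of_real \<phi> * z) \<le> 1 / 2" if "cmod z \<le> S + b\<^sub>2" for z
    using mult_left_mono[OF that, of "\<bar>\<phi>\<bar>"] \<phi>_half by (simp add: norm_mult)
  thus "cmod (of_real \<phi> * p) \<le> 1 / 2" "cmod (of_real \<phi> * complex_of_real \<beta>) \<le> 1 / 2" using norm_p by blast+
qed

lemma denominators: "1 + of_real \<phi> * p \<noteq> 0" "1 + of_real \<phi> * complex_of_real \<beta> \<noteq> 0" "1 + p * of_real \<phi> \<noteq> 0"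
  using norm_moebius_denominator(2)[OF small(1)] norm_moebius_denominator(2)[OF small(2)] by (simp_all add: mult.commute)

lemma moebius_\<beta>: "moebius \<phi> (of_real \<beta>) = of_real B"
  by (simp add: moebius_def mult.commute)

lemma moebius_p: "moebius \<phi> p = R + of_real B"
proof -
  have "moebius \<phi> p - moebius \<phi> (of_real \<beta>) = R"
    using moebius_diff[OF denominators(1,2)] by (simp add: mult_ac)
  thus ?thesis by (simp add: moebius_\<beta> algebra_simps)
qed

lemma close: "cmod (moebius \<phi> p - p) \<le> b\<^sub>1 / 8" "\<bar>B - \<beta>\<bar> \<le> b\<^sub>1 / 8"
proof -
  have *: "cmod (moebius \<phi> z - z) \<le> b\<^sub>1 / 8" if "cmod z \<le> S + b\<^sub>2" "cmod (of_real \<phi> * z) \<le> 1 / 2" for z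
  proof -
    have "cmod (moebius \<phi> z - z) \<le> 2 * \<bar>\<phi>\<bar> * (cmod z)\<^sup>2" by (rule norm_moebius_minus_id_le) fact
    also have "\<dots> \<le> 2 * \<bar>\<phi>\<bar> * (S + b\<^sub>2)\<^sup>2" using that by (intro mult_left_mono power_mono) auto
    finally show ?thesis using \<phi>_small by simp
  qed
  show "cmod (moebius \<phi> p - p) \<le> b\<^sub>1 / 8" by (rule *[OF norm_p(1) small(1)])
  have "cmod (of_real B - of_real \<beta>) \<le> b\<^sub>1 / 8" using *[OF norm_p(2) small(2)] by (simp only: moebius_\<beta>)
  thus "\<bar>B - \<beta>\<bar> \<le> b\<^sub>1 / 8" by (simp only: of_real_diff[symmetric] norm_of_real)
qed

lemma B_bounds: "7 / 8 * b\<^sub>1 \<le> B" "0 < B"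
  using close(2) b unfolding abs_le_iff by linarith+

text \<open>\<open>Re p\<close> is at least \<open>b\<^sub>1 / 2\<close> because \<open>Re s\<close>
  is at least \<open>- \<beta> / 2\<close>, and the map moves \<open>p\<close> by at most
  \<open>b\<^sub>1 / 8\<close>. This leaves a clearance of \<open>b\<^sub>1 / 4\<close> from
  contours with real part at most \<open>b\<^sub>1 / 8\<close>.\<close>

lemma moebius_p_bounds: "3 / 8 * b\<^sub>1 \<le> Re (moebius \<phi> p)" "\<bar>Im (moebius \<phi> p)\<bar> \<le> S + b\<^sub>1"
proof -
  have "\<bar>Re (moebius \<phi> p) - Re p\<bar> \<le> b\<^sub>1 / 8" "\<bar>Im (moebius \<phi> p) - Im p\<bar> \<le> b\<^sub>1 / 8"
    using close(1) abs_Re_le_cmod[of "moebius \<phi> p - p"] abs_Im_le_cmod[of "moebius \<phi> p - p"] by auto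
  moreover have "b\<^sub>1 / 2 \<le> Re p" using s b by auto
  moreover have "\<bar>Im p\<bar> \<le> S" using s abs_Im_le_cmod[of s] by auto
  ultimately show "3 / 8 * b\<^sub>1 \<le> Re (moebius \<phi> p)" "\<bar>Im (moebius \<phi> p)\<bar> \<le> S + b\<^sub>1"
    using b unfolding abs_le_iff by linarith+
qed

lemma Re_R: "- B < Re R"
  using moebius_p_bounds(1) b unfolding moebius_p by simp

text \<open>The step transform of the Gaussian walk with drift \<open>- B\<close>, in the coordinate
  centred at its saddle point.\<close>

definition gauss :: "complex \<Rightarrow> complex" where
  "gauss v = exp ((v\<^sup>2 - of_real (B\<^sup>2)) / 2)"

lemma norm_gauss: "cmod (gauss v) = exp (((Re v)\<^sup>2 - (Im v)\<^sup>2 - B\<^sup>2) / 2)"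
proof -
  have "Re ((v\<^sup>2 - of_real (B\<^sup>2)) / 2) = ((Re v)\<^sup>2 - (Im v)\<^sup>2 - B\<^sup>2) / 2"
    by (simp del: of_real_power of_real_divide add: power2_eq_square)
  thus ?thesis unfolding gauss_def by (simp only: norm_exp_eq_Re)
qed

text \<open>The first bound keeps the logarithm away from its singularity, the second supplies
  decay. For the first, half of \<open>1 / 16 - 49 / 64\<close> is \<open>- 45 / 128\<close>, which
  is below \<open>- 1 / 4\<close>.\<close>

lemma norm_gauss_le:
  assumes "\<bar>Re v\<bar> \<le> b\<^sub>1 / 4" 
  shows "cmod (gauss v) \<le> exp (- b\<^sub>1\<^sup>2 / 4)" "cmod (gauss v) \<le> exp (- (Im v)\<^sup>2 / 2)"
proof -
  have "(Re v)\<^sup>2 \<le> (b\<^sub>1 / 4)\<^sup>2" using assms b by (intro abs_le_square_iff[THEN iffD1]) auto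
  hence 1: "(Re v)\<^sup>2 \<le> b\<^sub>1\<^sup>2 / 16" by (simp add: power2_eq_square)
  have "(7 / 8 * b\<^sub>1)\<^sup>2 \<le> B\<^sup>2" using B_bounds b by (intro power_mono) auto
  hence 2: "49 / 64 * b\<^sub>1\<^sup>2 \<le> B\<^sup>2" by (simp add: power2_eq_square)
  have "0 \<le> b\<^sub>1\<^sup>2" by simp
  note 3 = 1 2 this zero_le_power2[of "Im v"]
  show "cmod (gauss v) \<le> exp (- b\<^sub>1\<^sup>2 / 4)" unfolding norm_gauss exp_le_cancel_iff using 3 by argo
  show "cmod (gauss v) \<le> exp (- (Im v)\<^sup>2 / 2)" unfolding norm_gauss exp_le_cancel_iff using 3 by argo
qed

lemma exp_neg_b1: "exp (- b\<^sub>1\<^sup>2 / 4) < 1" using b by simp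

lemma holomorphic_gauss_integrand:
  "(\<lambda>v. Ln (1 - gauss v) * cauchy_kernel (moebius \<phi> p) (of_real B) v) holomorphic_on {v. \<bar>Re v\<bar> < b\<^sub>1 / 4}"
proof -
  have "1 - gauss v \<notin> \<real>\<^sub>\<le>\<^sub>0" if "\<bar>Re v\<bar> < b\<^sub>1 / 4" for v
  proof -
    have "cmod (gauss v) < 1" using that by (intro le_less_trans[OF norm_gauss_le(1) exp_neg_b1]) auto
    thus ?thesis using complex_Re_le_cmod[of "gauss v"] by (auto simp: complex_nonpos_Reals_iff)
  qed
  moreover have "v \<noteq> moebius \<phi> p \<and> v \<noteq> of_real B" if "\<bar>Re v\<bar> < b\<^sub>1 / 4" for v
  proof -
    have "Re v < Re (moebius \<phi> p)" "Re v < Re (complex_of_real B)"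
      using that moebius_p_bounds(1) B_bounds b abs_ge_self[of "Re v"] unfolding Re_complex_of_real by linarith+
    thus ?thesis by (metis less_irrefl)
  qed
  ultimately show ?thesis
    unfolding cauchy_kernel_def gauss_def[abs_def]
    by (intro holomorphic_intros) (auto simp: gauss_def)
qed

text \<open>
  The Moebius image of the segment \<open>[- i Y, i Y]\<close> ends at \<open>a - i h\<close> and \<open>a + i h\<close>. Moving the Gaussian
  line of integration to real part \<open>a\<close> puts both contours into one convex strip free of
  singularities, where they can be exchanged by means of a primitive.
\<close>

definition "a = \<phi> * Y\<^sup>2 / (1 + (\<phi> * Y)\<^sup>2)"
definition "h = Y / (1 + (\<phi> * Y)\<^sup>2)"

lemma a_le: "\<bar>a\<bar> \<le> b\<^sub>1 / 8"
proof -
  have "a = Re (moebius \<phi> (Complex 0 Y))" by (simp add: moebius_imaginary a_def)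
  thus ?thesis using abs_Re_moebius_imaginary_le[of \<phi> Y] Y by linarith
qed

lemma separated: "b\<^sub>1 / 4 \<le> \<bar>a - Re (moebius \<phi> p)\<bar>" "b\<^sub>1 / 4 \<le> \<bar>a - B\<bar>" "a < B" "a < Re (moebius \<phi> p)"
  using a_le moebius_p_bounds(1) B_bounds b abs_ge_minus_self[of "a - Re (moebius \<phi> p)"] abs_ge_minus_self[of "a - B"]
  unfolding abs_le_iff[of a] by linarith+

lemma h_ge: "Y / 2 \<le> h"
proof -
  have "(\<phi> * Y)\<^sup>2 \<le> 1\<^sup>2" using Y by (intro abs_le_square_iff[THEN iffD1]) (auto simp: abs_mult)
  hence "Y / 2 \<le> Y / (1 + (\<phi> * Y)\<^sup>2)"
    using Y by (intro divide_left_mono mult_pos_pos) (auto intro: add_pos_nonneg)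
  thus ?thesis by (simp add: h_def)
qed

lemma h_pos: "0 < h" using h_ge Y by linarith

lemma Re_curve: assumes "\<bar>y\<bar> \<le> Y" shows "\<bar>Re (moebius \<phi> (Complex 0 y))\<bar> \<le> b\<^sub>1 / 8"
proof -
  have "y\<^sup>2 \<le> Y\<^sup>2" using assms by (intro abs_le_square_iff[THEN iffD1]) auto
  hence "\<bar>\<phi>\<bar> * y\<^sup>2 \<le> \<bar>\<phi>\<bar> * Y\<^sup>2" by (intro mult_left_mono) auto
  thus ?thesis using abs_Re_moebius_imaginary_le[of \<phi> y] Y by linarith
qed

text \<open>Both integrals equal \<open>- \<i>\<close> times the increment of one primitive between
  the same end points. Stated as an equivalence, it transports the existence of the integral
  together with its value.\<close>

lemma contour_change:
  "((\<lambda>y. Ln (1 - gauss (moebius \<phi> (Complex 0 y))) * cauchy_kernel p (of_real \<beta>) (Complex 0 y)) has_integral I) {-Y..Y} \<longleftrightarrow>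
   ((\<lambda>y. Ln (1 - gauss (Complex a y)) * cauchy_kernel (moebius \<phi> p) (of_real B) (Complex a y)) has_integral I) {-h..h}"
proof -
  let ?g = "\<lambda>v. Ln (1 - gauss v) * cauchy_kernel (moebius \<phi> p) (of_real B) v"
  let ?D = "{v. \<bar>Re v\<bar> < b\<^sub>1 / 4}"
  have D: "?D = {v. Re v < b\<^sub>1 / 4} \<inter> {v. - (b\<^sub>1 / 4) < Re v}" by auto
  have "convex ?D" unfolding D by (intro convex_Int convex_halfspace_Re_lt convex_halfspace_Re_gt)
  have "open ?D" unfolding D by (intro open_Int open_halfspace_Re_lt open_halfspace_Re_gt)
  obtain P where P: "\<And>v. v \<in> ?D \<Longrightarrow> (P has_field_derivative ?g v) (at v)"
    using holomorphic_convex_primitive'[OF \<open>convex ?D\<close> \<open>open ?D\<close> holomorphic_gauss_integrand] 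
      at_within_open[OF _ \<open>open ?D\<close>] by metis
  have 1: "((\<lambda>y. \<i> * ?g (Complex a y)) has_integral (P (Complex a h) - P (Complex a (- h)))) {-h..h}"
  proof (rule fundamental_theorem_of_calculus)
    fix y assume "y \<in> {-h..h}"
    have line: "((\<lambda>y. of_real a + \<i> * of_real y) has_vector_derivative \<i>) (at y within {-h..h})"
      by (auto intro!: derivative_eq_intros)
    have "(P has_field_derivative ?g (of_real a + \<i> * of_real y)) (at (of_real a + \<i> * of_real y))"
      by (rule P) (use a_le b in auto)
    hence "((\<lambda>y. P (of_real a + \<i> * of_real y)) has_vector_derivative \<i> * ?g (of_real a + \<i> * of_real y)) (at y within {-h..h})"
      using field_vector_diff_chain_within[OF line, of P] has_field_derivative_at_within by (fastforce simp: o_def)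
    thus "((\<lambda>y. P (Complex a y)) has_vector_derivative \<i> * ?g (Complex a y)) (at y within {-h..h})"
      by (simp only: Complex_eq o_def)
  qed (use h_pos in auto)
  have 2: "((\<lambda>y. \<i> * (Ln (1 - gauss (moebius \<phi> (Complex 0 y))) * cauchy_kernel p (of_real \<beta>) (Complex 0 y))) has_integral
     (P (moebius \<phi> (Complex 0 Y)) - P (moebius \<phi> (Complex 0 (- Y))))) {-Y..Y}"
  proof (rule fundamental_theorem_of_calculus)
    fix y assume y: "y \<in> {-Y..Y}"
    define t where "t = Complex 0 y"
    have t: "t = \<i> * of_real y" by (simp add: t_def complex_eq_iff)
    have "Re (1 + of_real \<phi> * t) = 1" by (simp add: t)
    hence nz: "1 + of_real \<phi> * t \<noteq> 0" by (metis zero_complex.simps(1) zero_neq_one)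
    have "t \<noteq> p" "t \<noteq> of_real \<beta>" using s b by (auto simp: t complex_eq_iff)
    \<comment> \<open>The divisor \<open>(1 + of_real \<phi> * t)\<^sup>2\<close> is the reciprocal
      of the derivative of the Moebius map, so the substitution leaves the kernel with poles
      \<open>p\<close> and \<open>\<beta>\<close>.\<close>
    note kernel = cauchy_kernel_moebius[OF nz denominators(1,2) this, unfolded moebius_\<beta>]
    have vd: "((\<lambda>y. moebius \<phi> (\<i> * of_real y)) has_vector_derivative \<i> / (1 + of_real \<phi> * t)\<^sup>2) (at y within {-Y..Y})"
    proof -
      have "(moebius \<phi> has_field_derivative 1 / (1 + of_real \<phi> * t)\<^sup>2) (at t)"
        unfolding moebius_def[abs_def]
        by (rule derivative_eq_intros refl nz)+ (use nz in \<open>simp add: field_simps power2_eq_square\<close>)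
      hence m1: "(moebius \<phi> has_field_derivative 1 / (1 + of_real \<phi> * t)\<^sup>2) (at (\<i> * of_real y) within (\<lambda>y. \<i> * of_real y) ` {-Y..Y})"
        unfolding t by (rule has_field_derivative_at_within)
      have v1: "((\<lambda>y. \<i> * of_real y) has_vector_derivative \<i>) (at y within {-Y..Y})"
        by (auto intro!: derivative_eq_intros)
      show ?thesis using field_vector_diff_chain_within[OF v1 m1] by (simp add: o_def)
    qed
    have Pd: "(P has_field_derivative ?g (moebius \<phi> t)) (at (moebius \<phi> t))"
    proof (rule P)
      have "\<bar>Re (moebius \<phi> (Complex 0 y))\<bar> \<le> b\<^sub>1 / 8" using y by (intro Re_curve) (simp add: abs_le_iff)
      hence "\<bar>Re (moebius \<phi> t)\<bar> < b\<^sub>1 / 4" using b unfolding t_def by linarith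
      thus "moebius \<phi> t \<in> ?D" by (rule CollectI)
    qed
    have "((\<lambda>y. P (moebius \<phi> (\<i> * of_real y))) has_vector_derivative \<i> / (1 + of_real \<phi> * t)\<^sup>2 * ?g (moebius \<phi> t)) (at y within {-Y..Y})"
      using field_vector_diff_chain_within[OF vd, of P "?g (moebius \<phi> t)"]
        has_field_derivative_at_within[OF Pd]
      by (simp add: o_def t)
    also have "\<i> / (1 + of_real \<phi> * t)\<^sup>2 * ?g (moebius \<phi> t) = \<i> * (Ln (1 - gauss (moebius \<phi> t)) * cauchy_kernel p (of_real \<beta>) t)"
      unfolding kernel[symmetric] by simp
    finally show "((\<lambda>y. P (moebius \<phi> (Complex 0 y))) has_vector_derivative
        \<i> * (Ln (1 - gauss (moebius \<phi> (Complex 0 y))) * cauchy_kernel p (of_real \<beta>) (Complex 0 y))) (at y within {-Y..Y})"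
      by (simp add: t Complex_eq)
  qed (use Y in auto)
  have e: "moebius \<phi> (Complex 0 Y) = Complex a h" "moebius \<phi> (Complex 0 (- Y)) = Complex a (- h)"
    by (simp_all add: moebius_imaginary a_def h_def)
  define W where "W = P (Complex a h) - P (Complex a (- h))"
  have "((\<lambda>y. - \<i> * (\<i> * ?g (Complex a y))) has_integral - \<i> * W) {-h..h}"
    using has_integral_mult_right[OF 1, of "- \<i>"] unfolding W_def .
  hence J1: "((\<lambda>y. ?g (Complex a y)) has_integral - \<i> * W) {-h..h}" by (simp add: mult.assoc[symmetric])
  have "((\<lambda>y. - \<i> * (\<i> * (Ln (1 - gauss (moebius \<phi> (Complex 0 y))) * cauchy_kernel p (of_real \<beta>) (Complex 0 y)))) has_integral - \<i> * W) {-Y..Y}"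
    using has_integral_mult_right[OF 2[unfolded e], of "- \<i>"] unfolding W_def .
  hence J2: "((\<lambda>y. Ln (1 - gauss (moebius \<phi> (Complex 0 y))) * cauchy_kernel p (of_real \<beta>) (Complex 0 y)) has_integral - \<i> * W) {-Y..Y}"
    by (simp add: mult.assoc[symmetric])
  show ?thesis using J1 J2 has_integral_unique by blast
qed

text \<open>One constant for both kernels: every pole has clearance at least
  \<open>b\<^sub>1 / 4\<close> and height at most \<open>S + b\<^sub>1\<close>. The images of the
  poles are at most \<open>4 * S\<close> apart, as their distance is \<open>cmod s\<close> divided
  by two denominators of modulus at least \<open>1 / 2\<close>.\<close>

lemma kernel_bounds:
  "cmod (cauchy_kernel p (of_real \<beta>) (Complex 0 y)) \<le> 4 * S * ((1 + (S + b\<^sub>1)) / (b\<^sub>1 / 4) + 1)\<^sup>2 * inverse (1 + y\<^sup>2)" (is "?l1 \<le> _ * ?C * _")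
  "cmod (cauchy_kernel (moebius \<phi> p) (of_real B) (Complex a y)) \<le> 4 * S * ((1 + (S + b\<^sub>1)) / (b\<^sub>1 / 4) + 1)\<^sup>2 * inverse (1 + y\<^sup>2)" (is "?l2 \<le> _")
proof -
  have S: "0 \<le> S" using s order_trans[OF norm_ge_zero] by auto
  have "?l1 \<le> cmod (p - of_real \<beta>) * ?C * inverse (1 + y\<^sup>2)"
    using b s S abs_Im_le_cmod[of s] by (intro norm_cauchy_kernel_le) auto
  also have "\<dots> \<le> 4 * S * ?C * inverse (1 + y\<^sup>2)"
    using s S by (intro mult_right_mono) auto
  finally show "?l1 \<le> 4 * S * ?C * inverse (1 + y\<^sup>2)" .
  have "?l2 \<le> cmod (moebius \<phi> p - of_real B) * ?C * inverse (1 + y\<^sup>2)"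
    using b S separated moebius_p_bounds(2) by (intro norm_cauchy_kernel_le) auto
  also have "cmod (moebius \<phi> p - of_real B) \<le> 4 * S"
  proof -
    have "1 / 2 * (1 / 2) \<le> cmod (1 + of_real \<phi> * p) * cmod (1 + of_real \<phi> * complex_of_real \<beta>)"
      using norm_moebius_denominator(1)[OF small(1)] norm_moebius_denominator(1)[OF small(2)]
      by (intro mult_mono) auto
    hence "cmod s / (cmod (1 + of_real \<phi> * p) * cmod (1 + of_real \<phi> * complex_of_real \<beta>)) \<le> S / (1 / 2 * (1 / 2))"
      using s S by (intro frac_le) auto
    thus ?thesis
      unfolding moebius_\<beta>[symmetric] moebius_diff[OF denominators(1,2)] by (simp add: norm_divide norm_mult)
  qed
  finally show "?l2 \<le> 4 * S * ?C * inverse (1 + y\<^sup>2)" by (simp add: mult_right_mono)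
qed

text \<open>The middle part of the Gaussian integral is carried to the segment and kernel of the
  queue, so that only the logarithms differ there. What is left are the two tails. All these errors
  are bounded by the same multiple of \<open>inverse (1 + y\<^sup>2)\<close>.\<close>

lemma pollaczek_integrals_close:
  fixes LW LM :: complex
  assumes q: "q < 1" "exp (- b\<^sub>1\<^sup>2 / 4) \<le> q"
    and \<Psi>: "continuous_on UNIV \<Psi>" "\<And>y. cmod (\<Psi> y) \<le> q"
    and near: "\<And>y. \<bar>y\<bar> \<le> Y \<Longrightarrow> cmod (\<Psi> y - gauss (moebius \<phi> (Complex 0 y))) \<le> E"
    and far: "\<And>y. Y < \<bar>y\<bar> \<Longrightarrow> cmod (\<Psi> y) \<le> E"
    and E: "exp (- Y\<^sup>2 / 8) \<le> E"
    and LW: "(LBINT y. Ln (1 - \<Psi> y) * cauchy_kernel p (of_real \<beta>) (Complex 0 y)) = 2 * pi * LW"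
    and LM: "(LBINT y. Ln (1 - gauss (Complex a y)) * cauchy_kernel (R + of_real B) (of_real B) (Complex a y)) = 2 * pi * LM"
  shows "cmod (LW - LM) \<le> 1 / (1 - q) * E * (4 * S * ((1 + (S + b\<^sub>1)) / (b\<^sub>1 / 4) + 1)\<^sup>2) * (LBINT y. inverse (1 + y\<^sup>2))"
proof -
  define D where "D = 4 * S * ((1 + (S + b\<^sub>1)) / (b\<^sub>1 / 4) + 1)\<^sup>2"
  define J where "J = (LBINT y :: real. inverse (1 + y\<^sup>2))"
  have "0 \<le> E" using E by (smt (verit) exp_ge_zero)
  define f1 where "f1 = (\<lambda>y. Ln (1 - \<Psi> y) * cauchy_kernel p (of_real \<beta>) (Complex 0 y))"
  define f2 where "f2 = (\<lambda>y. Ln (1 - gauss (Complex a y)) * cauchy_kernel (moebius \<phi> p) (of_real B) (Complex a y))"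
  define f3 where "f3 = (\<lambda>y. Ln (1 - gauss (moebius \<phi> (Complex 0 y))) * cauchy_kernel p (of_real \<beta>) (Complex 0 y))"
  have k: "cmod (cauchy_kernel p (of_real \<beta>) (Complex 0 y)) \<le> D * inverse (1 + y\<^sup>2)"
    "cmod (cauchy_kernel (moebius \<phi> p) (of_real B) (Complex a y)) \<le> D * inverse (1 + y\<^sup>2)" for y
    using kernel_bounds unfolding D_def by auto
  have Lb: "cmod (Ln (1 - x)) \<le> 1 / (1 - q)" if "cmod x \<le> q" for x
  proof -
    have "1 / (1 - q) * cmod x \<le> 1 / (1 - q) * 1" using that q by (intro mult_left_mono) auto
    thus ?thesis using norm_Ln_one_minus_le[OF that q(1)] by simp
  qed
  have ga: "cmod (gauss (Complex a y)) \<le> q" for y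
    using norm_gauss_le(1)[of "Complex a y"] a_le b q by auto
  have gm: "cmod (gauss (moebius \<phi> (Complex 0 y))) \<le> q" if "\<bar>y\<bar> \<le> Y" for y
    using norm_gauss_le(1)[of "moebius \<phi> (Complex 0 y)"] Re_curve[OF that] b q by auto
  have i1: "integrable lborel f1" unfolding f1_def
    using s b \<Psi> Lb by (intro integrable_times_cauchy_kernel[where C = "1 / (1 - q)"] borel_measurable_continuous_onI
        continuous_on_Ln_one_minus[OF _ _ q(1)]) auto
  have i2: "integrable lborel f2" unfolding f2_def
  proof (intro integrable_times_cauchy_kernel[where C = "1 / (1 - q)"] borel_measurable_continuous_onI
        continuous_on_Ln_one_minus[OF _ _ q(1)])
    show "continuous_on UNIV (\<lambda>y. gauss (Complex a y))"
      unfolding gauss_def Complex_eq by (intro continuous_intros) auto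
  qed (use ga Lb separated in auto)
  have s2: "set_integrable lborel {-h..h} f2"
    unfolding set_integrable_def by (rule integrable_mult_indicator[OF _ i2]) auto
  have s3: "set_integrable lborel {-Y..Y} f3"
  proof (rule borel_integrable_atLeastAtMost')
    have nz: "1 + of_real \<phi> * Complex 0 y \<noteq> 0" for y by (simp add: complex_eq_iff)
    have ne: "Complex 0 y \<noteq> p" "Complex 0 y \<noteq> of_real \<beta>" for y using s b by (auto simp: complex_eq_iff)
    have c0: "continuous_on {-Y..Y} (Complex 0)" unfolding Complex_eq[abs_def] by (intro continuous_intros)
    have "continuous_on {-Y..Y} (\<lambda>y. gauss (moebius \<phi> (Complex 0 y)))"
      unfolding gauss_def moebius_def by (intro continuous_intros c0) (use nz in auto)
    hence cL: "continuous_on {-Y..Y} (\<lambda>y. Ln (1 - gauss (moebius \<phi> (Complex 0 y))))"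
      using gm by (intro continuous_on_Ln_one_minus[OF _ _ q(1)]) auto
    thus "continuous_on {-Y..Y} f3"
      unfolding f3_def cauchy_kernel_def by (intro continuous_on_mult[OF cL] continuous_on_diff continuous_on_divide continuous_on_const c0) (use ne in auto)
  qed
  have "(f3 has_integral (LBINT y:{-Y..Y}. f3 y)) {-Y..Y}"
    using set_borel_integral_eq_integral[OF s3] by (simp add: has_integral_integrable_integral)
  hence "(f2 has_integral (LBINT y:{-Y..Y}. f3 y)) {-h..h}"
    unfolding f2_def f3_def contour_change .
  moreover have "(f2 has_integral (LBINT y:{-h..h}. f2 y)) {-h..h}"
    using set_borel_integral_eq_integral[OF s2] by (simp add: has_integral_integrable_integral)
  ultimately have mid: "(LBINT y:{-Y..Y}. f3 y) = (LBINT y:{-h..h}. f2 y)" by (rule has_integral_unique)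
  have e1: "cmod (f1 y - indicator {-Y..Y} y *\<^sub>R f3 y) \<le> 1 / (1 - q) * E * (D * inverse (1 + y\<^sup>2))" for y
  proof (cases "\<bar>y\<bar> \<le> Y")
    case True
    have "cmod (Ln (1 - \<Psi> y) - Ln (1 - gauss (moebius \<phi> (Complex 0 y)))) \<le> 1 / (1 - q) * E"
      using norm_Ln_one_minus_diff_le[OF \<Psi>(2) gm[OF True] q(1), of y] near[OF True] q
      by (elim order_trans) (intro mult_left_mono, auto)
    hence "cmod ((Ln (1 - \<Psi> y) - Ln (1 - gauss (moebius \<phi> (Complex 0 y)))) * cauchy_kernel p (of_real \<beta>) (Complex 0 y))
       \<le> 1 / (1 - q) * E * (D * inverse (1 + y\<^sup>2))"
      unfolding norm_mult using k(1) q \<open>0 \<le> E\<close> by (intro mult_mono) auto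
    moreover have "indicator {-Y..Y} y = (1 :: real)" using True by (simp add: indicator_def abs_le_iff)
    ultimately show ?thesis by (simp add: f1_def f3_def algebra_simps)
  next
    case False
    have "cmod (Ln (1 - \<Psi> y)) \<le> 1 / (1 - q) * E"
      using norm_Ln_one_minus_le[OF \<Psi>(2) q(1), of y] far[of y] False q
      by (elim order_trans) (intro mult_left_mono, auto)
    hence "cmod (Ln (1 - \<Psi> y) * cauchy_kernel p (of_real \<beta>) (Complex 0 y)) \<le> 1 / (1 - q) * E * (D * inverse (1 + y\<^sup>2))"
      unfolding norm_mult using k(1) q \<open>0 \<le> E\<close> by (intro mult_mono) auto
    moreover have "indicator {-Y..Y} y = (0 :: real)" using False by (auto simp: indicator_def abs_le_iff)
    ultimately show ?thesis by (simp add: f1_def)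
  qed
  have e2: "cmod (f2 y - indicator {-h..h} y *\<^sub>R f2 y) \<le> 1 / (1 - q) * E * (D * inverse (1 + y\<^sup>2))" for y
  proof (cases "\<bar>y\<bar> \<le> h")
    case True
    have "0 \<le> D * inverse (1 + y\<^sup>2)" using k(1)[of y] order_trans[OF norm_ge_zero] by blast
    moreover have "indicator {-h..h} y = (1 :: real)" using True by (simp add: indicator_def abs_le_iff)
    ultimately show ?thesis using q \<open>0 \<le> E\<close> by simp
  next
    case False
    \<comment> \<open>The image segment ends at height \<open>h\<close>, which is only known to be
      at least \<open>Y / 2\<close>; hence the 8 in the hypothesis on \<open>E\<close>.\<close>
    have "(Y / 2)\<^sup>2 \<le> y\<^sup>2" using False h_ge Y by (intro abs_le_square_iff[THEN iffD1]) auto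
    hence "exp (- y\<^sup>2 / 2) \<le> exp (- Y\<^sup>2 / 8)" by (simp add: power2_eq_square)
    moreover have "cmod (gauss (Complex a y)) \<le> exp (- y\<^sup>2 / 2)"
      using norm_gauss_le(2)[of "Complex a y"] a_le b by simp
    ultimately have "cmod (gauss (Complex a y)) \<le> exp (- Y\<^sup>2 / 8)" by (rule order_trans[rotated])
    hence "cmod (gauss (Complex a y)) \<le> E" using E by linarith
    hence "cmod (Ln (1 - gauss (Complex a y))) \<le> 1 / (1 - q) * E"
      using norm_Ln_one_minus_le[OF ga q(1), of y] q
      by (elim order_trans) (intro mult_left_mono, auto)
    hence "cmod (Ln (1 - gauss (Complex a y)) * cauchy_kernel (moebius \<phi> p) (of_real B) (Complex a y)) \<le> 1 / (1 - q) * E * (D * inverse (1 + y\<^sup>2))"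
      unfolding norm_mult using k(2) q \<open>0 \<le> E\<close> by (intro mult_mono) auto
    moreover have "indicator {-h..h} y = (0 :: real)" using False by (auto simp: indicator_def abs_le_iff)
    ultimately show ?thesis by (simp add: f2_def)
  qed
  have bound: "cmod (LBINT y. f y) \<le> 1 / (1 - q) * E * D * J"
    if "integrable lborel f" "\<And>y. cmod (f y) \<le> 1 / (1 - q) * E * (D * inverse (1 + y\<^sup>2))" for f
  proof -
    have "cmod (LBINT y. f y) \<le> (LBINT y. 1 / (1 - q) * E * D * inverse (1 + y\<^sup>2))"
    proof (intro order_trans[OF integral_norm_bound] integral_mono)
      show "integrable lborel (\<lambda>y. cmod (f y))" using that(1) by (rule integrable_norm)
      show "integrable lborel (\<lambda>y. 1 / (1 - q) * E * D * inverse (1 + y\<^sup>2))"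
        by (intro integrable_mult_right integrable_inverse_1_plus_square_lborel)
    qed (use that(2) in \<open>simp add: mult.assoc\<close>)
    also have "\<dots> = 1 / (1 - q) * E * D * J" unfolding J_def by (rule integral_mult_right_zero)
    finally show ?thesis .
  qed
  have j2: "integrable lborel (\<lambda>y. indicator {-h..h} y *\<^sub>R f2 y)" and j3: "integrable lborel (\<lambda>y. indicator {-Y..Y} y *\<^sub>R f3 y)"
    using s2 s3 by (simp_all add: set_integrable_def)
  have "2 * pi * LW - 2 * pi * LM = (LBINT y. f1 y) - (LBINT y. f2 y)"
    using LW LM unfolding f1_def f2_def moebius_p by simp
  also have "\<dots> = (LBINT y. f1 y - indicator {-Y..Y} y *\<^sub>R f3 y) - (LBINT y. f2 y - indicator {-h..h} y *\<^sub>R f2 y)"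
    using i1 i2 j2 j3 mid by (simp add: set_lebesgue_integral_def)
  finally have "cmod (2 * pi * LW - 2 * pi * LM) \<le> 1 / (1 - q) * E * D * J + 1 / (1 - q) * E * D * J"
    using i1 i2 j2 j3 by (simp only:) (intro order_trans[OF norm_triangle_ineq4] add_mono bound e1 e2 Bochner_Integration.integrable_diff)
  moreover have "cmod (2 * pi * LW - 2 * pi * LM) = 2 * pi * cmod (LW - LM)"
    unfolding right_diff_distrib[symmetric] norm_mult by simp
  \<comment> \<open>Two error integrals stand against the factor \<open>2 * pi\<close>; the
    remaining \<open>pi\<close> is dropped, being larger than 1.\<close>
  moreover have "2 * pi * x \<le> y + y \<Longrightarrow> pi * x \<le> y" for x y :: real by argo
  ultimately have "pi * cmod (LW - LM) \<le> 1 / (1 - q) * E * D * J" by metis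
  moreover have "1 * cmod (LW - LM) \<le> pi * cmod (LW - LM)" using pi_gt3 by (intro mult_right_mono) auto
  ultimately show ?thesis unfolding D_def J_def by simp
qed

end

section \<open>The queue\<close>

lemma prob_space_iid_mean_law:
  assumes "prob_space \<mu>" and [measurable_cong]: "sets \<mu> = sets borel"
  shows "prob_space (iid_mean_law n \<mu>)" "sets (iid_mean_law n \<mu>) = sets borel"
proof -
  interpret prob_space "\<Pi>\<^sub>M k\<in>{1..n}. \<mu>" by (intro prob_space_PiM assms)
  show "prob_space (iid_mean_law n \<mu>)" unfolding iid_mean_law_def by (rule prob_space_distr) measurable
qed (simp add: iid_mean_law_def)

lemma exp_iid_mean_law:
  fixes z :: complex
  assumes "prob_space \<mu>" and [measurable_cong]: "sets \<mu> = sets borel" and n: "1 \<le> n"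
    and int: "integrable \<mu> (\<lambda>x. exp (z / of_nat n * of_real x))"
  shows "integrable (iid_mean_law n \<mu>) (\<lambda>x. exp (z * of_real x))"
    and "(\<integral>x. exp (z * of_real x) \<partial>iid_mean_law n \<mu>) = (\<integral>x. exp (z / of_nat n * of_real x) \<partial>\<mu>) ^ n"
proof -
  interpret prob_space \<mu> by fact
  interpret product_sigma_finite "\<lambda>_::nat. \<mu>" ..
  have [measurable]: "(\<lambda>x. (\<Sum>k=1..n. x k) / real n) \<in> borel_measurable (\<Pi>\<^sub>M k\<in>{1..n}. \<mu>)" by measurable
  have e: "exp (z * complex_of_real ((\<Sum>k=1..n. x k) / real n)) = (\<Prod>k=1..n. exp (z / of_nat n * of_real (x k)))" for x
    by (simp add: exp_sum[symmetric] sum_distrib_left[symmetric] sum_divide_distrib[symmetric])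
  show "integrable (iid_mean_law n \<mu>) (\<lambda>x. exp (z * of_real x))"
    unfolding iid_mean_law_def
    by (subst integrable_distr_eq) (auto simp only: e intro!: product_integrable_prod int, measurable)
  have "(\<integral>x. exp (z * of_real x) \<partial>iid_mean_law n \<mu>) = (\<integral>x. (\<Prod>k=1..n. exp (z / of_nat n * of_real (x k))) \<partial>(\<Pi>\<^sub>M k\<in>{1..n}. \<mu>))"
    unfolding iid_mean_law_def by (subst integral_distr) (simp_all only: e, measurable)
  also have "\<dots> = (\<Prod>k=1..n. \<integral>x. exp (z / of_nat n * of_real x) \<partial>\<mu>)"
    by (rule product_integral_prod) (simp, rule int)
  finally show "(\<integral>x. exp (z * of_real x) \<partial>iid_mean_law n \<mu>) = (\<integral>x. exp (z / of_nat n * of_real x) \<partial>\<mu>) ^ n"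
    by simp
qed

locale queue_data = prob_space M for M :: "'a measure" +
  fixes V U :: "'a \<Rightarrow> real" and r :: real
  assumes indep: "indep_var borel V borel U"
    and V_exp: "\<And>z. \<bar>Re z\<bar> \<le> r \<Longrightarrow> integrable M (\<lambda>\<omega>. exp (z * complex_of_real (V \<omega>)))"
    and U_exp: "\<And>z. \<bar>Re z\<bar> \<le> r \<Longrightarrow> integrable M (\<lambda>\<omega>. exp (z * complex_of_real (U \<omega>)))"
begin

lemma measurable_VU [measurable]: "V \<in> borel_measurable M" "U \<in> borel_measurable M"
  using indep_var_rv1[OF indep] indep_var_rv2[OF indep] by auto

definition mgf_V :: "complex \<Rightarrow> complex" where "mgf_V z = (\<integral>\<omega>. exp (z * complex_of_real (V \<omega>)) \<partial>M)"
definition mgf_U :: "complex \<Rightarrow> complex" where "mgf_U z = (\<integral>\<omega>. exp (z * complex_of_real (U \<omega>)) \<partial>M)"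

text \<open>\<open>V\<close> is paired with the exponent \<open>s\<close> and \<open>U\<close> with
  \<open>- s / \<rho>\<close>, hence the two bounds on \<open>Re s\<close>.\<close>

lemma
  assumes \<rho>: "0 < \<rho>" and s: "\<bar>Re s\<bar> \<le> r" "\<bar>Re s\<bar> \<le> \<rho> * r"
  shows psi_eq: "psi M V U \<rho> s = mgf_V s * mgf_U (- s / of_real \<rho>)"
    and integrable_psi: "integrable M (\<lambda>\<omega>. exp (s * complex_of_real (V \<omega> - U \<omega> / \<rho>)))"
proof -
  have s': "\<bar>Re (- s / of_real \<rho>)\<bar> \<le> r" using s \<rho> by (simp add: abs_divide field_simps)
  have "indep_var borel ((\<lambda>v. exp (s * complex_of_real v)) \<circ> V) borel ((\<lambda>u. exp (- s / of_real \<rho> * complex_of_real u)) \<circ> U)"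
    by (rule indep_var_compose[OF indep]) auto
  hence iv: "indep_var borel (\<lambda>\<omega>. exp (s * complex_of_real (V \<omega>))) borel (\<lambda>\<omega>. exp (- s / of_real \<rho> * complex_of_real (U \<omega>)))"
    by (simp add: o_def)
  have e: "exp (s * complex_of_real (V \<omega> - U \<omega> / \<rho>)) = exp (s * complex_of_real (V \<omega>)) * exp (- s / of_real \<rho> * complex_of_real (U \<omega>))" for \<omega>
    by (simp add: exp_add[symmetric] algebra_simps)
  show "psi M V U \<rho> s = mgf_V s * mgf_U (- s / of_real \<rho>)"
    unfolding psi_def e mgf_V_def mgf_U_def by (rule indep_var_lebesgue_integral[OF iv V_exp[OF s(1)] U_exp[OF s']])
  show "integrable M (\<lambda>\<omega>. exp (s * complex_of_real (V \<omega> - U \<omega> / \<rho>)))"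
    unfolding e by (rule indep_var_integrable[OF iv V_exp[OF s(1)] U_exp[OF s']])
qed

lemma psi_real:
  assumes \<rho>: "0 < \<rho>" and s: "\<bar>x\<bar> \<le> r" "\<bar>x\<bar> \<le> \<rho> * r"
  shows "integrable M (\<lambda>\<omega>. exp (x * (V \<omega> - U \<omega> / \<rho>)))"
    and "psi M V U \<rho> (of_real x) = of_real (\<integral>\<omega>. exp (x * (V \<omega> - U \<omega> / \<rho>)) \<partial>M)"
    and "0 < (\<integral>\<omega>. exp (x * (V \<omega> - U \<omega> / \<rho>)) \<partial>M)"
    and "Re (psi M V U \<rho> (of_real x)) = (\<integral>\<omega>. exp (x * (V \<omega> - U \<omega> / \<rho>)) \<partial>M)"
proof -
  have e: "exp (of_real x * complex_of_real (V \<omega> - U \<omega> / \<rho>)) = of_real (exp (x * (V \<omega> - U \<omega> / \<rho>)))" for \<omega>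
    by (simp only: of_real_mult[symmetric] exp_of_real)
  have "integrable M (\<lambda>\<omega>. complex_of_real (exp (x * (V \<omega> - U \<omega> / \<rho>))))"
    using integrable_psi[of \<rho> "of_real x"] \<rho> s unfolding e by simp
  from integrable_Re[OF this] show i: "integrable M (\<lambda>\<omega>. exp (x * (V \<omega> - U \<omega> / \<rho>)))" by simp
  show "psi M V U \<rho> (of_real x) = of_real (\<integral>\<omega>. exp (x * (V \<omega> - U \<omega> / \<rho>)) \<partial>M)"
    unfolding psi_def e by (rule integral_complex_of_real)
  thus "Re (psi M V U \<rho> (of_real x)) = (\<integral>\<omega>. exp (x * (V \<omega> - U \<omega> / \<rho>)) \<partial>M)" by simp
  have "(\<integral>\<omega>. 0 \<partial>M) < (\<integral>\<omega>. exp (x * (V \<omega> - U \<omega> / \<rho>)) \<partial>M)"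
    by (rule integral_less_AE_space[OF _ i]) (auto simp: emeasure_space_1)
  thus "0 < (\<integral>\<omega>. exp (x * (V \<omega> - U \<omega> / \<rho>)) \<partial>M)" by simp
qed

text \<open>A positive factor commutes with the positive part, so \<open>\<kappa> * W\<close> is
  stationary for the scaled step, whose transform is the \<open>n\<close>-th power of
  \<open>psi\<close> at \<open>\<kappa> / n\<close> times the argument. Shifting Pollaczek's
  integral by \<open>c\<close> puts the line on the imaginary axis and the point 0 at
  \<open>c\<close>.\<close>

lemma queue_log_transform:
  assumes W: "steady_state_waiting_time M V U n \<rho> W"
    and n: "1 \<le> n" and \<rho>: "0 < \<rho>" and \<kappa>: "0 < \<kappa>" and c: "0 < c\<^sub>2" "c\<^sub>2 < c" "c < c\<^sub>1"
    and dom: "\<kappa> / real n * c\<^sub>1 \<le> r" "\<kappa> / real n * c\<^sub>1 \<le> \<rho> * r"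
    and less_1: "\<And>\<theta>. c\<^sub>2 \<le> \<theta> \<Longrightarrow> \<theta> \<le> c\<^sub>1 \<Longrightarrow> Re (psi M V U \<rho> (of_real (\<kappa> / real n * \<theta>))) < 1"
  obtains L :: "complex \<Rightarrow> complex" where "is_log_transform M (\<lambda>\<omega>. \<kappa> * W \<omega>) c L"
    "\<And>s. - c < Re s \<Longrightarrow> (LBINT y. Ln (1 - psi M V U \<rho> (of_real (\<kappa> / real n) * Complex c (- y)) ^ n) *
        cauchy_kernel (s + of_real c) (of_real c) (Complex 0 y)) = 2 * pi * L s"
proof -
  define \<nu> where "\<nu> = distr M borel W"
  define \<nu>V where "\<nu>V = iid_mean_law n (distr M borel V)"
  define \<nu>U where "\<nu>U = iid_mean_law n (distr M borel U)"
  have Wm [measurable]: "W \<in> borel_measurable M" and Wnn: "AE \<omega> in M. 0 \<le> W \<omega>"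
    and st: "\<nu> = distr (\<nu> \<Otimes>\<^sub>M (\<nu>V \<Otimes>\<^sub>M \<nu>U)) borel (\<lambda>(w, v, u). max 0 (w + v - u / \<rho>))"
    using W unfolding steady_state_waiting_time_def Let_def \<nu>_def \<nu>V_def \<nu>U_def by blast+
  have pV: "prob_space (distr M borel V)" and pU: "prob_space (distr M borel U)"
    by (rule prob_space_distr, simp)+
  interpret A: prob_space \<nu>V unfolding \<nu>V_def by (rule prob_space_iid_mean_law[OF pV]) simp
  interpret B: prob_space \<nu>U unfolding \<nu>U_def by (rule prob_space_iid_mean_law[OF pU]) simp
  interpret N: prob_space \<nu> unfolding \<nu>_def by (rule prob_space_distr) simp
  have [measurable_cong]: "sets \<nu> = sets borel" "sets \<nu>V = sets borel" "sets \<nu>U = sets borel"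
    unfolding \<nu>_def \<nu>V_def \<nu>U_def by (simp_all add: iid_mean_law_def)
  interpret AB: pair_prob_space \<nu>V \<nu>U ..
  define \<mu> where "\<mu> = distr (\<nu>V \<Otimes>\<^sub>M \<nu>U) borel (\<lambda>(v, u). \<kappa> * (v - u / \<rho>))"
  define \<nu>' where "\<nu>' = distr M borel (\<lambda>\<omega>. \<kappa> * W \<omega>)"
  interpret S: prob_space \<mu> unfolding \<mu>_def by (rule AB.prob_space_distr) measurable
  interpret T: prob_space \<nu>' unfolding \<nu>'_def by (rule prob_space_distr) measurable
  have lt: "integrable \<mu> (\<lambda>x. exp (z * of_real x)) \<and>
      (\<integral>x. exp (z * of_real x) \<partial>\<mu>) = psi M V U \<rho> (of_real (\<kappa> / real n) * z) ^ n"
    if z: "0 \<le> Re z" "Re z \<le> c\<^sub>1" for z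
  proof -
    define s where "s = of_real (\<kappa> / real n) * z"
    have Re_s: "0 \<le> Re s" "Re s \<le> \<kappa> / real n * c\<^sub>1"
      using z \<kappa> n mult_left_mono[OF z(2), of "\<kappa> / real n"] by (auto simp: s_def)
    hence s: "\<bar>Re s\<bar> \<le> r" "\<bar>Re s\<bar> \<le> \<rho> * r" using dom by auto
    have s': "\<bar>Re (- s / of_real \<rho>)\<bar> \<le> r" using s \<rho> by (simp add: abs_divide field_simps)
    have eV: "of_real \<kappa> * z / of_nat n = s" and eU: "- (of_real \<kappa> * z / of_real \<rho>) / of_nat n = - s / of_real \<rho>"
      by (simp_all add: s_def)
    have iV: "integrable (distr M borel V) (\<lambda>x. exp (of_real \<kappa> * z / of_nat n * of_real x))"
      unfolding eV by (subst integrable_distr_eq) (use V_exp[OF s(1)] in auto)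
    have iU: "integrable (distr M borel U) (\<lambda>x. exp (- (of_real \<kappa> * z / of_real \<rho>) / of_nat n * of_real x))"
      unfolding eU by (subst integrable_distr_eq) (use U_exp[OF s'] in auto)
    have vV: "(\<integral>x. exp (of_real \<kappa> * z / of_nat n * of_real x) \<partial>distr M borel V) = mgf_V s"
      unfolding eV mgf_V_def by (rule integral_distr) auto
    have vU: "(\<integral>x. exp (- (of_real \<kappa> * z / of_real \<rho>) / of_nat n * of_real x) \<partial>distr M borel U) = mgf_U (- s / of_real \<rho>)"
      unfolding eU mgf_U_def by (rule integral_distr) auto
    note xV = exp_iid_mean_law[OF pV _ n iV, folded \<nu>V_def, unfolded vV, simplified]
    note xU = exp_iid_mean_law[OF pU _ n iU, folded \<nu>U_def, unfolded vU, simplified]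
    have e: "exp (z * of_real (case q of (v, u) \<Rightarrow> \<kappa> * (v - u / \<rho>))) =
       (case q of (v, u) \<Rightarrow> exp (of_real \<kappa> * z * of_real v) * exp (- (of_real \<kappa> * z / of_real \<rho>) * of_real u))" for q
      by (cases q) (simp add: exp_add[symmetric] algebra_simps)
    have "integrable \<mu> (\<lambda>x. exp (z * of_real x))"
      unfolding \<mu>_def by (subst integrable_distr_eq) (use AB.integrable_pair_mult[of "\<lambda>v. exp (of_real \<kappa> * z * of_real v)" "\<lambda>u. exp (- (of_real \<kappa> * z / of_real \<rho>) * of_real u)"] xV xU in \<open>simp_all add: e\<close>)
    moreover have "(\<integral>x. exp (z * of_real x) \<partial>\<mu>) = mgf_V s ^ n * mgf_U (- s / of_real \<rho>) ^ n"
      unfolding \<mu>_def by (subst integral_distr) (use AB.integral_pair_mult[of "\<lambda>v. exp (of_real \<kappa> * z * of_real v)" "\<lambda>u. exp (- (of_real \<kappa> * z / of_real \<rho>) * of_real u)"] xV xU in \<open>simp_all add: e\<close>)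
    ultimately show ?thesis unfolding s_def[symmetric] using psi_eq[OF \<rho> s] by (simp add: power_mult_distrib)
  qed
  interpret lindley_stationary \<mu> \<nu>' c\<^sub>1 c\<^sub>2
  proof unfold_locales
    show sm: "sets \<mu> = sets borel" "sets \<nu>' = sets borel" by (simp_all add: \<mu>_def \<nu>'_def)
    show "AE w in \<nu>'. 0 \<le> w" unfolding \<nu>'_def
      by (subst AE_distr_iff) (use Wnn \<kappa> in \<open>auto elim: eventually_mono\<close>)
    have nu': "\<nu>' = distr \<nu> borel (\<lambda>w. \<kappa> * w)" unfolding \<nu>'_def \<nu>_def by (subst distr_distr) (auto simp: o_def)
    have "distr \<nu> borel (\<lambda>w. \<kappa> * w) = distr (distr (\<nu> \<Otimes>\<^sub>M (\<nu>V \<Otimes>\<^sub>M \<nu>U)) borel (\<lambda>(w, v, u). max 0 (w + v - u / \<rho>))) borel (\<lambda>w. \<kappa> * w)"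
      using st by simp
    also have "\<dots> = distr (\<nu> \<Otimes>\<^sub>M (\<nu>V \<Otimes>\<^sub>M \<nu>U)) borel ((\<lambda>w. \<kappa> * w) \<circ> (\<lambda>(w, v, u). max 0 (w + v - u / \<rho>)))"
      by (rule distr_distr) measurable
    also have "(\<lambda>w. \<kappa> * w) \<circ> (\<lambda>(w, v, u). max 0 (w + v - u / \<rho>)) = 
       (\<lambda>(w, x). max 0 (w + x)) \<circ> (\<lambda>(w, p). (\<kappa> * w, case p of (v, u) \<Rightarrow> \<kappa> * (v - u / \<rho>)))"
      using \<kappa> by (auto simp: fun_eq_iff max_mult_distrib_left right_diff_distrib distrib_left add_diff_eq)
    also have "distr (\<nu> \<Otimes>\<^sub>M (\<nu>V \<Otimes>\<^sub>M \<nu>U)) borel \<dots> = 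
       distr (distr (\<nu> \<Otimes>\<^sub>M (\<nu>V \<Otimes>\<^sub>M \<nu>U)) (borel \<Otimes>\<^sub>M borel) (\<lambda>(w, p). (\<kappa> * w, case p of (v, u) \<Rightarrow> \<kappa> * (v - u / \<rho>)))) borel (\<lambda>(w, x). max 0 (w + x))"
      by (rule distr_distr[symmetric]) measurable
    also have "distr (\<nu> \<Otimes>\<^sub>M (\<nu>V \<Otimes>\<^sub>M \<nu>U)) (borel \<Otimes>\<^sub>M borel) (\<lambda>(w, p). (\<kappa> * w, case p of (v, u) \<Rightarrow> \<kappa> * (v - u / \<rho>))) = \<nu>' \<Otimes>\<^sub>M \<mu>"
      unfolding nu' \<mu>_def
      by (rule pair_measure_distr[symmetric]) (use S.sigma_finite_measure_axioms in \<open>auto simp: \<mu>_def\<close>)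
    finally show "\<nu>' = distr (\<nu>' \<Otimes>\<^sub>M \<mu>) borel (\<lambda>(w, x). max 0 (w + x))" using nu' by simp
    fix \<theta> assume \<theta>: "c\<^sub>2 \<le> \<theta>" "\<theta> \<le> c\<^sub>1"
    have e: "exp (of_real \<theta> * complex_of_real x) = of_real (exp (\<theta> * x))" for x
      by (simp only: of_real_mult[symmetric] exp_of_real)
    note l = lt[of "of_real \<theta>", unfolded e]
    have i: "integrable \<mu> (\<lambda>x. complex_of_real (exp (\<theta> * x)))" using l \<theta> c by simp
    from integrable_Re[OF this] show "integrable \<mu> (\<lambda>x. exp (\<theta> * x))" by simp
    define s where "s = \<kappa> / real n * \<theta>"
    have "0 \<le> s" "s \<le> \<kappa> / real n * c\<^sub>1" using \<theta> c \<kappa> n unfolding s_def by (auto intro!: mult_left_mono divide_right_mono)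
    hence s: "\<bar>s\<bar> \<le> r" "\<bar>s\<bar> \<le> \<rho> * r" using dom by auto
    define R where "R = Re (psi M V U \<rho> (of_real s))"
    have R: "0 \<le> R" "R < 1" "psi M V U \<rho> (of_real s) = of_real R"
      using psi_real[OF \<rho> s] less_1[OF \<theta>] by (auto simp: R_def s_def)
    have "complex_of_real (\<integral>x. exp (\<theta> * x) \<partial>\<mu>) = (\<integral>x. complex_of_real (exp (\<theta> * x)) \<partial>\<mu>)" by simp
    also have "\<dots> = complex_of_real (R ^ n)" using l \<theta> c R(3) by (simp add: s_def)
    finally have "(\<integral>x. exp (\<theta> * x) \<partial>\<mu>) = R ^ n" by (simp only: of_real_eq_iff)
    also have "\<dots> < 1" using R n by (metis One_nat_def Suc_le_eq power_less_one_iff not_gr_zero zero_less_iff_neq_zero less_le)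
    finally show "(\<integral>x. exp (\<theta> * x) \<partial>\<mu>) < 1" .
  qed (use c in auto)
  show ?thesis
  proof (rule that[of spitzer_pos])
    show "is_log_transform M (\<lambda>\<omega>. \<kappa> * W \<omega>) c spitzer_pos"
      unfolding is_log_transform_def
    proof (intro conjI allI impI)
      show "spitzer_pos holomorphic_on {s. - c < Re s}"
        by (rule holomorphic_on_subset[OF holomorphic_spitzer_pos]) (use c in auto)
      show "spitzer_pos 0 = 0" by (rule spitzer_pos_0)
      fix s assume s: "- c < Re s"
      have s': "- c\<^sub>1 < Re s" using s c by simp
      show "integrable M (\<lambda>\<omega>. exp (- s * complex_of_real (\<kappa> * W \<omega>)))"
        using integrable_wait_lt[of s] s' unfolding \<nu>'_def by (intro integrable_distr[of "\<lambda>\<omega>. \<kappa> * W \<omega>" M borel]) auto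
      show "exp (spitzer_pos s) = (\<integral>\<omega>. exp (- s * complex_of_real (\<kappa> * W \<omega>)) \<partial>M)"
        unfolding exp_spitzer_pos[OF s'] wait_lt_def unfolding \<nu>'_def by (subst integral_distr) auto
    qed
    fix s assume s: "- c < Re s"
    \<comment> \<open>\<open>step_lt\<close> has a minus sign in the exponent and \<open>psi\<close>
      has none, which explains the argument \<open>Complex c (- y)\<close>.\<close>
    have "step_lt (Complex (- c) y) = psi M V U \<rho> (of_real (\<kappa> / real n) * Complex c (- y)) ^ n" for y
    proof -
      have "- Complex (- c) y = Complex c (- y)" by (simp add: complex_eq_iff)
      thus ?thesis using lt[of "Complex c (- y)"] c by (simp add: step_lt_def)
    qed
    moreover have "cauchy_kernel s 0 (Complex (- c) y) = cauchy_kernel (s + of_real c) (of_real c) (Complex 0 y)" for y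
      by (simp add: cauchy_kernel_def Complex_eq algebra_simps)
    ultimately show "(LBINT y. Ln (1 - psi M V U \<rho> (of_real (\<kappa> / real n) * Complex c (- y)) ^ n) *
        cauchy_kernel (s + of_real c) (of_real c) (Complex 0 y)) = 2 * pi * spitzer_pos s"
      using pollaczek(2)[OF c(2,3) s] by simp
  qed
qed

end

section \<open>Cumulants and decay along vertical lines\<close>

text \<open>Near 0 the moment generating function stays within distance 1 of its value 1, so its
  real part is positive and the principal logarithm is holomorphic. The first two derivatives at 0
  are the mean and the variance.\<close>

lemma (in prob_space) cumulant_generating_function:
  fixes X :: "'a \<Rightarrow> real"
  assumes [measurable]: "X \<in> borel_measurable M" and r: "0 < r"
    and int: "\<And>z. \<bar>Re z\<bar> \<le> r \<Longrightarrow> integrable M (\<lambda>\<omega>. exp (z * complex_of_real (X \<omega>)))"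
    and X2: "integrable M X" "integrable M (\<lambda>\<omega>. (X \<omega>)\<^sup>2)"
  defines "K \<equiv> \<lambda>z. Ln (\<integral>\<omega>. exp (z * complex_of_real (X \<omega>)) \<partial>M)"
  obtains R where "0 < R" "R \<le> r" "K holomorphic_on ball 0 R"
    "\<forall>z\<in>ball 0 R. exp (K z) = (\<integral>\<omega>. exp (z * complex_of_real (X \<omega>)) \<partial>M)"
    "\<forall>x. \<bar>x\<bar> < R \<longrightarrow> K (of_real x) \<in> \<real>"
    "deriv K 0 = of_real (expectation X)" "(deriv ^^ 2) K 0 = of_real (variance X)"
proof -
  define m where "m = (\<lambda>k z. \<integral>\<omega>. complex_of_real (X \<omega>) ^ k * exp (z * complex_of_real (X \<omega>)) \<partial>M)"
  have e: "exp (complex_of_real x * complex_of_real (X \<omega>)) = of_real (exp (x * X \<omega>))" for x \<omega>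
    by (simp only: of_real_mult[symmetric] exp_of_real)
  have ir: "integrable M (\<lambda>\<omega>. exp (x * X \<omega>))" if "\<bar>x\<bar> \<le> r" for x
    using integrable_Re[OF int[of "of_real x", unfolded e]] that by simp
  have d: "(m k has_field_derivative m (Suc k) z) (at z)" if "\<bar>Re z\<bar> < r" for k z
    unfolding m_def by (rule has_field_derivative_exp_moment[of X M "- r" r]) (use ir[of "-r"] ir[of r] that r in auto)
  have m0: "m 0 0 = 1" "m 0 = (\<lambda>z. \<integral>\<omega>. exp (z * complex_of_real (X \<omega>)) \<partial>M)"
    by (simp_all add: m_def prob_space)
  have m12: "m 1 0 = of_real (expectation X)" "m 2 0 = of_real (expectation (\<lambda>\<omega>. (X \<omega>)\<^sup>2))"
    by (simp_all add: m_def flip: of_real_power)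
  have "isCont (m 0) 0" using DERIV_isCont[OF d[of 0 0]] r by simp
  then obtain R0 where R0: "0 < R0" "\<And>z. dist z 0 < R0 \<Longrightarrow> dist (m 0 z) (m 0 0) < 1"
    unfolding continuous_at_eps_delta by (metis zero_less_one)
  define R where "R = min R0 r"
  have R: "0 < R" "R \<le> r" "R \<le> R0" using R0 r by (auto simp: R_def)
  have re: "0 < Re (m 0 z)" if "z \<in> ball 0 R" for z
  proof -
    have "cmod (m 0 z - 1) < 1" using R0(2)[of z] that R unfolding m0(1) by (simp add: dist_norm)
    thus ?thesis using abs_Re_le_cmod[of "m 0 z - 1"] by auto
  qed
  have K: "K = (\<lambda>z. Ln (m 0 z))" by (simp add: K_def m0)
  have ball_r: "\<bar>Re z\<bar> < r" if "z \<in> ball 0 R" for z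
    using that R abs_Re_le_cmod[of z] by auto
  have nn: "m 0 z \<notin> \<real>\<^sub>\<le>\<^sub>0" "m 0 z \<noteq> 0" if "z \<in> ball 0 R" for z
    using re[OF that] by (auto simp: complex_nonpos_Reals_iff)
  have dK: "(K has_field_derivative m 1 z / m 0 z) (at z)" if "z \<in> ball 0 R" for z
    unfolding K using d[OF ball_r[OF that], of 0] nn[OF that] by (auto intro!: derivative_eq_intros simp: divide_inverse)
  have derivK: "deriv K z = m 1 z / m 0 z" if "z \<in> ball 0 R" for z
    using dK[OF that] by (rule DERIV_imp_deriv)
  have z0: "(0 :: complex) \<in> ball 0 R" using R by simp
  have "((\<lambda>z. m 1 z / m 0 z) has_field_derivative (m 2 0 * m 0 0 - m 1 0 * m 1 0) / (m 0 0 * m 0 0)) (at 0)"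
    using DERIV_divide[OF d[of 0 1] d[of 0 0]] r m0(1) by (simp add: numeral_2_eq_2)
  hence "(deriv K has_field_derivative (m 2 0 * m 0 0 - m 1 0 * m 1 0) / (m 0 0 * m 0 0)) (at 0)"
    by (rule has_field_derivative_transform_within_open[where S = "ball 0 R"]) (use z0 derivK in auto)
  hence "deriv (deriv K) 0 = of_real (expectation (\<lambda>\<omega>. (X \<omega>)\<^sup>2)) - (of_real (expectation X))\<^sup>2"
    by (subst DERIV_imp_deriv) (auto simp: m0(1) m12[unfolded One_nat_def] power2_eq_square)
  hence d2: "(deriv ^^ 2) K 0 = of_real (variance X)"
    using variance_eq[OF X2] by (simp add: numeral_2_eq_2)
  have real: "K (of_real x) \<in> \<real>" if "\<bar>x\<bar> < R" for x
  proof -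
    have mr: "m 0 (of_real x) = of_real (\<integral>\<omega>. exp (x * X \<omega>) \<partial>M)"
      unfolding m0(2) e by (rule integral_complex_of_real)
    have "0 < Re (m 0 (of_real x))" using re[of "of_real x"] that by simp
    hence "0 < (\<integral>\<omega>. exp (x * X \<omega>) \<partial>M)" by (simp add: mr)
    thus ?thesis unfolding K mr by (simp add: Ln_of_real)
  qed
  show ?thesis
  proof (rule that[OF R(1,2)])
    show "K holomorphic_on ball 0 R" 
    proof (rule holomorphic_onI)
      fix z :: complex assume "z \<in> ball 0 R"
      from has_field_derivative_at_within[OF dK[OF this]]
      show "K field_differentiable at z within ball 0 R" unfolding field_differentiable_def by blast
    qed
    show "\<forall>z\<in>ball 0 R. exp (K z) = (\<integral>\<omega>. exp (z * complex_of_real (X \<omega>)) \<partial>M)"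
    proof
      fix z :: complex assume "z \<in> ball 0 R"
      thus "exp (K z) = (\<integral>\<omega>. exp (z * complex_of_real (X \<omega>)) \<partial>M)"
        using nn[of z] by (simp add: K) (simp add: m_def)
    qed
    show "deriv K 0 = of_real (expectation X)" using derivK[OF z0] m0(1) m12 by simp
  qed (use d2 real in auto)
qed

text \<open>The quantities of the theorem are iterated derivatives of a real function, the estimates
  concern its holomorphic extension. A complex derivative can be computed along the real axis; where
  the function is real its imaginary part differentiates to 0, and the induction goes on.\<close>

lemma higher_deriv_real_restriction:
  fixes f :: "complex \<Rightarrow> complex" and h :: "real \<Rightarrow> real"
  assumes hol: "f holomorphic_on ball 0 R" and fh: "\<And>x. \<bar>x\<bar> < R \<Longrightarrow> f (of_real x) = of_real (h x)"
    and x: "\<bar>x\<bar> < R"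
  shows "(deriv ^^ k) f (of_real x) = of_real ((deriv ^^ k) h x)"
    and "((deriv ^^ k) h has_real_derivative (deriv ^^ Suc k) h x) (at x)"
proof -
  have step: "(g has_real_derivative Re D) (at x) \<and> D = of_real (Re D)"
    if FD: "(F has_field_derivative D) (at (of_real x))" and Fg: "\<And>x. \<bar>x\<bar> < R \<Longrightarrow> F (of_real x) = of_real (g x)"
      and x: "\<bar>x\<bar> < R" for F :: "complex \<Rightarrow> complex" and g D x
  proof -
    have v: "((\<lambda>t. F (of_real t)) has_vector_derivative D) (at x)"
      using has_vector_derivative_real_field[OF FD] .
    have nh: "\<forall>\<^sub>F t in nhds x. \<bar>t\<bar> < R"
      using x by (intro eventually_nhds_in_open[of "{t. \<bar>t\<bar> < R}" x, simplified]) (auto intro!: open_Collect_less continuous_intros)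
    have re: "((\<lambda>t. Re (F (of_real t))) has_real_derivative Re D) (at x)"
      using bounded_linear.has_vector_derivative[OF bounded_linear_Re v] by (simp add: has_real_derivative_iff_has_vector_derivative)
    have im: "((\<lambda>t. Im (F (of_real t))) has_real_derivative Im D) (at x)"
      using bounded_linear.has_vector_derivative[OF bounded_linear_Im v] by (simp add: has_real_derivative_iff_has_vector_derivative)
    have "(g has_real_derivative Re D) (at x)"
      using re by (subst DERIV_cong_ev[OF refl _ refl, of _ "\<lambda>t. Re (F (of_real t))"]) (use nh Fg in \<open>auto elim!: eventually_mono\<close>)
    moreover have "((\<lambda>t. 0 :: real) has_real_derivative Im D) (at x)"
      using im by (subst DERIV_cong_ev[OF refl _ refl, of _ "\<lambda>t. Im (F (of_real t))"]) (use nh Fg in \<open>auto elim!: eventually_mono\<close>)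
    hence "Im D = 0" using DERIV_unique[OF _ DERIV_const] by blast
    ultimately show ?thesis by (simp add: complex_eq_iff)
  qed
  have D: "((deriv ^^ k) f has_field_derivative (deriv ^^ Suc k) f (of_real x)) (at (of_real x))" if "\<bar>x\<bar> < R" for k x
    using holomorphic_derivI[OF holomorphic_higher_deriv[OF hol open_ball, of k] open_ball, of "of_real x"] that
    by simp
  have main: "\<forall>x. \<bar>x\<bar> < R \<longrightarrow> (deriv ^^ k) f (of_real x) = of_real ((deriv ^^ k) h x)" for k
  proof (induction k)
    case (Suc k)
    show ?case
    proof (intro allI impI)
      fix x :: real assume x: "\<bar>x\<bar> < R"
      from step[OF D[OF x, of k] _ x, of "(deriv ^^ k) h"] Suc
      have "((deriv ^^ k) h has_real_derivative Re ((deriv ^^ Suc k) f (of_real x))) (at x)"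
        and r: "(deriv ^^ Suc k) f (of_real x) = of_real (Re ((deriv ^^ Suc k) f (of_real x)))" by blast+
      hence "deriv ((deriv ^^ k) h) x = Re ((deriv ^^ Suc k) f (of_real x))" by (intro DERIV_imp_deriv)
      thus "(deriv ^^ Suc k) f (of_real x) = of_real ((deriv ^^ Suc k) h x)" using r by simp
    qed
  qed (use fh in simp)
  show "(deriv ^^ k) f (of_real x) = of_real ((deriv ^^ k) h x)" using main x by blast
  from step[OF D[OF x, of k] _ x, of "(deriv ^^ k) h"] main
  have "((deriv ^^ k) h has_real_derivative Re ((deriv ^^ Suc k) f (of_real x))) (at x)" by blast
  thus "((deriv ^^ k) h has_real_derivative (deriv ^^ Suc k) h x) (at x)" using main[of "Suc k"] x by simp
qed

section \<open>Spectral gap by doubling the frequency\<close>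

lemma one_minus_cos_double_le: "1 - cos (2 * x) \<le> 4 * (1 - cos (x :: real))"
proof -
  have "0 \<le> 2 * (1 - cos x)\<^sup>2" by simp
  thus ?thesis unfolding cos_double_cos by (simp add: power2_eq_square algebra_simps)
qed

text \<open>With \<open>\<alpha>\<close> the phase of the transform at \<open>y\<close>, the deficit
  at \<open>y\<close> is the weighted mean of \<open>1 - cos (y * Z - \<alpha>)\<close>. At
  \<open>2 * y\<close> the phase \<open>2 * \<alpha>\<close> need not be optimal, but it bounds the
  modulus from below, and doubling the angle enlarges \<open>1 - cos\<close> at most
  fourfold.\<close>

lemma weighted_transform_doubling:
  fixes Z :: "'a \<Rightarrow> real"
  assumes [measurable]: "Z \<in> borel_measurable M" and i: "integrable M (\<lambda>\<omega>. exp (x * Z \<omega>))"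
  defines "\<Phi> \<equiv> \<lambda>y. \<integral>\<omega>. exp (Complex x y * complex_of_real (Z \<omega>)) \<partial>M"
  shows "(\<integral>\<omega>. exp (x * Z \<omega>) \<partial>M) - cmod (\<Phi> (2 * y)) \<le> 4 * ((\<integral>\<omega>. exp (x * Z \<omega>) \<partial>M) - cmod (\<Phi> y))"
proof -
  define \<alpha> where "\<alpha> = Arg (\<Phi> y)"
  have ic: "integrable M (\<lambda>\<omega>. exp (Complex x y * complex_of_real (Z \<omega>)))" for y
    by (rule Bochner_Integration.integrable_bound[OF i]) auto
  have rot: "Re (exp (- \<i> * of_real t) * \<Phi> y) = (\<integral>\<omega>. exp (x * Z \<omega>) * cos (y * Z \<omega> - t) \<partial>M)" for t y
  proof -
    have "Re (exp (- \<i> * of_real t) * \<Phi> y) = Re (\<integral>\<omega>. exp (- \<i> * of_real t) * exp (Complex x y * complex_of_real (Z \<omega>)) \<partial>M)"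
      unfolding \<Phi>_def by simp
    also have "\<dots> = (\<integral>\<omega>. Re (exp (- \<i> * of_real t) * exp (Complex x y * complex_of_real (Z \<omega>))) \<partial>M)"
      by (rule integral_Re[symmetric]) (rule integrable_mult_right, rule ic)
    also have "\<dots> = (\<integral>\<omega>. exp (x * Z \<omega>) * cos (y * Z \<omega> - t) \<partial>M)"
      unfolding exp_add[symmetric] by (simp add: Re_exp)
    finally show ?thesis .
  qed
  have icos: "integrable M (\<lambda>\<omega>. exp (x * Z \<omega>) * cos (y * Z \<omega> - t))" for y t
    by (rule Bochner_Integration.integrable_bound[OF i]) (auto simp: abs_mult)
  have "exp (- \<i> * of_real \<alpha>) * \<Phi> y = of_real (cmod (\<Phi> y))"
    using Arg_eq[of "\<Phi> y"] unfolding \<alpha>_def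
    by (cases "\<Phi> y = 0") (auto simp: exp_minus field_simps)
  hence 1: "cmod (\<Phi> y) = (\<integral>\<omega>. exp (x * Z \<omega>) * cos (y * Z \<omega> - \<alpha>) \<partial>M)"
    using rot[of \<alpha> y] by simp
  have "(\<integral>\<omega>. exp (x * Z \<omega>) * cos (2 * y * Z \<omega> - 2 * \<alpha>) \<partial>M) \<le> cmod (exp (- \<i> * of_real (2 * \<alpha>)) * \<Phi> (2 * y))"
    unfolding rot[symmetric] by (rule complex_Re_le_cmod)
  hence 2: "(\<integral>\<omega>. exp (x * Z \<omega>) * cos (2 * y * Z \<omega> - 2 * \<alpha>) \<partial>M) \<le> cmod (\<Phi> (2 * y))"
    by (simp add: norm_mult)
  have "(\<integral>\<omega>. exp (x * Z \<omega>) \<partial>M) - cmod (\<Phi> (2 * y)) \<le> (\<integral>\<omega>. exp (x * Z \<omega>) - exp (x * Z \<omega>) * cos (2 * y * Z \<omega> - 2 * \<alpha>) \<partial>M)"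
    using 2 i icos by simp
  also have "\<dots> \<le> (\<integral>\<omega>. 4 * (exp (x * Z \<omega>) - exp (x * Z \<omega>) * cos (y * Z \<omega> - \<alpha>)) \<partial>M)"
  proof (intro integral_mono)
    fix \<omega>
    have "exp (x * Z \<omega>) * (1 - cos (2 * (y * Z \<omega> - \<alpha>))) \<le> exp (x * Z \<omega>) * (4 * (1 - cos (y * Z \<omega> - \<alpha>)))"
      by (intro mult_left_mono one_minus_cos_double_le) auto
    thus "exp (x * Z \<omega>) - exp (x * Z \<omega>) * cos (2 * y * Z \<omega> - 2 * \<alpha>) \<le> 4 * (exp (x * Z \<omega>) - exp (x * Z \<omega>) * cos (y * Z \<omega> - \<alpha>))"
      by (simp add: algebra_simps)
  qed (use i icos in \<open>auto intro!: Bochner_Integration.integrable_diff\<close>)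
  also have "\<dots> = 4 * ((\<integral>\<omega>. exp (x * Z \<omega>) \<partial>M) - cmod (\<Phi> y))"
    unfolding 1 using i icos by simp
  finally show ?thesis .
qed

text \<open>Doubling transports the spectral gap from \<open>\<bar>y\<bar> > \<delta>\<close> down to the origin, at a quadratic rate.\<close>

lemma gap_near_zero:
  fixes g :: "real \<Rightarrow> real"
  assumes doubling: "\<And>y. g (2 * y) \<le> 4 * g y" and gap: "\<And>y. \<delta> < \<bar>y\<bar> \<Longrightarrow> \<epsilon> \<le> g y"
    and g0: "0 \<le> g 0" and "0 < \<delta>" "0 \<le> \<epsilon>"
  shows "\<epsilon> * min 1 (y\<^sup>2 / (4 * \<delta>\<^sup>2)) \<le> g y"
proof (cases "\<delta> < \<bar>y\<bar>")
  case True
  have "\<epsilon> * min 1 (y\<^sup>2 / (4 * \<delta>\<^sup>2)) \<le> \<epsilon> * 1" using \<open>0 \<le> \<epsilon>\<close> by (intro mult_left_mono) auto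
  thus ?thesis using gap[OF True] by simp
next
  case False
  show ?thesis
  proof (cases "y = 0")
    case True thus ?thesis using g0 by simp
  next
    case ynz: False
    have iter: "\<epsilon> \<le> 4 ^ k * g z" if "\<delta> < 2 ^ k * \<bar>z\<bar>" for k z
      using that
    proof (induction k arbitrary: z)
      case (Suc k)
      have "\<epsilon> \<le> 4 ^ k * g (2 * z)" by (rule Suc.IH) (use Suc.prems in \<open>simp add: abs_mult mult_ac\<close>)
      also have "\<dots> \<le> 4 ^ k * (4 * g z)" by (intro mult_left_mono doubling) auto
      finally show ?case by simp
    qed (use gap in simp)
    define P where "P = (\<lambda>k. \<delta> < 2 ^ k * \<bar>y\<bar>)"
    have "\<exists>k. \<delta> / \<bar>y\<bar> < 2 ^ k" by (rule real_arch_pow) simp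
    hence ex: "\<exists>k. P k" using ynz by (auto simp: P_def field_simps)
    \<comment> \<open>The least number of doublings that leads beyond \<open>\<delta>\<close>. The
      last of them starts at a value of at most \<open>\<delta>\<close>, so
      \<open>2 ^ k * \<bar>y\<bar>\<close> is at most \<open>2 * \<delta>\<close>.\<close>
    define k where "k = (LEAST k. P k)"
    have k: "P k" unfolding k_def using ex by (rule LeastI_ex)
    have "k \<noteq> 0" using k False by (auto simp: P_def intro: ccontr)
    then obtain j where j: "k = Suc j" using not0_implies_Suc by blast
    have "\<not> P j" using not_less_Least[of j P] j by (simp add: k_def[symmetric])
    hence "2 ^ k * \<bar>y\<bar> \<le> 2 * \<delta>" by (simp add: P_def j)
    hence "(2 ^ k * \<bar>y\<bar>)\<^sup>2 \<le> (2 * \<delta>)\<^sup>2" by (intro power_mono) auto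
    moreover have "((2::real) ^ k)\<^sup>2 = 4 ^ k" by (simp add: power_mult[symmetric] power_mult mult.commute[of k])
    ultimately have b: "4 ^ k * y\<^sup>2 \<le> 4 * \<delta>\<^sup>2" by (simp add: power_mult_distrib)
    have "\<epsilon> * min 1 (y\<^sup>2 / (4 * \<delta>\<^sup>2)) \<le> \<epsilon> * (y\<^sup>2 / (4 * \<delta>\<^sup>2))"
      using \<open>0 \<le> \<epsilon>\<close> by (intro mult_left_mono) auto
    also have "\<dots> \<le> \<epsilon> * (1 / 4 ^ k)"
      using b \<open>0 \<le> \<epsilon>\<close> \<open>0 < \<delta>\<close> by (intro mult_left_mono) (auto simp: field_simps)
    also have "\<dots> \<le> g y" using iter[of k y] k by (simp add: P_def field_simps)
    finally show ?thesis .
  qed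
qed

context queue_data
begin

text \<open>The difference of \<open>psi\<close> at \<open>x\<close> and its modulus at
  \<open>Complex x y\<close> satisfies the doubling inequality, and assumption (A) bounds it below
  for large \<open>\<bar>y\<bar>\<close>. As \<open>psi\<close> is at most 1 at \<open>x\<close>,
  the gap becomes a bound for the modulus itself.\<close>

lemma norm_psi_le_exp:
  assumes sep: "separation M V U \<delta> \<epsilon>" and "0 < \<delta>" "0 < \<epsilon>" and \<rho>: "1 / 2 \<le> \<rho>" "\<rho> < 1"
    and x: "0 < x" "x \<le> \<delta>" "x \<le> r" "x \<le> \<rho> * r" and le1: "Re (psi M V U \<rho> (of_real x)) \<le> 1"
  shows "cmod (psi M V U \<rho> (Complex x y)) \<le> exp (- \<epsilon> * min 1 (y\<^sup>2 / (4 * \<delta>\<^sup>2)))"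
proof -
  define m where "m = (\<integral>\<omega>. exp (x * (V \<omega> - U \<omega> / \<rho>)) \<partial>M)"
  have \<rho>0: "0 < \<rho>" and x': "\<bar>x\<bar> \<le> r" "\<bar>x\<bar> \<le> \<rho> * r" using \<rho> x by auto
  have m: "Re (psi M V U \<rho> (of_real x)) = m" unfolding m_def by (rule psi_real(4)[OF \<rho>0 x'])
  define g where "g = (\<lambda>y. m - cmod (psi M V U \<rho> (Complex x y)))"
  have "\<epsilon> * min 1 (y\<^sup>2 / (4 * \<delta>\<^sup>2)) \<le> g y"
  proof (rule gap_near_zero)
    show "g (2 * y) \<le> 4 * g y" for y
      unfolding g_def m_def psi_def by (rule weighted_transform_doubling[OF _ psi_real(1)[OF \<rho>0 x']]) measurable
    show "\<epsilon> \<le> g y" if "\<delta> < \<bar>y\<bar>" for y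
    proof -
      \<comment> \<open>Assumption (A) is parametrized by a negative number whose opposite is the
        abscissa.\<close>
      have "\<rho> \<in> {1 / 2..<1}" "- x \<in> {- \<delta>..<0}" using \<rho> x by auto
      with sep that have "cmod (psi M V U \<rho> (Complex (- (- x)) y)) < Re (psi M V U \<rho> (complex_of_real (- (- x)))) - \<epsilon>"
        unfolding separation_def by blast
      thus ?thesis using m by (simp add: g_def)
    qed
    have "Complex x 0 = of_real x" by (simp add: complex_eq_iff)
    thus "0 \<le> g 0" using psi_real(2,3)[OF \<rho>0 x'] by (simp add: g_def m_def)
  qed (use assms in auto)
  hence "cmod (psi M V U \<rho> (Complex x y)) \<le> 1 - \<epsilon> * min 1 (y\<^sup>2 / (4 * \<delta>\<^sup>2))"
    using le1 m by (simp add: g_def)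
  also have "\<dots> \<le> exp (- (\<epsilon> * min 1 (y\<^sup>2 / (4 * \<delta>\<^sup>2))))"
    using exp_ge_add_one_self[of "- (\<epsilon> * min 1 (y\<^sup>2 / (4 * \<delta>\<^sup>2)))"] by simp
  finally show ?thesis by simp
qed

lemma norm_psi_power_le:
  assumes "separation M V U \<delta> \<epsilon>" "0 < \<delta>" "0 < \<epsilon>" "1 / 2 \<le> \<rho>" "\<rho> < 1"
    and "0 < x" "x \<le> \<delta>" "x \<le> r" "x \<le> \<rho> * r" "Re (psi M V U \<rho> (of_real x)) \<le> 1"
  shows "cmod (psi M V U \<rho> (Complex x y) ^ n) \<le> exp (- \<epsilon> * min (real n) (real n * y\<^sup>2 / (4 * \<delta>\<^sup>2)))"
proof -
  have "cmod (psi M V U \<rho> (Complex x y) ^ n) \<le> exp (- \<epsilon> * min 1 (y\<^sup>2 / (4 * \<delta>\<^sup>2))) ^ n"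
    unfolding norm_power by (intro power_mono norm_psi_le_exp assms) auto
  also have "\<dots> = exp (real n * (- \<epsilon> * min 1 (y\<^sup>2 / (4 * \<delta>\<^sup>2))))" by (simp only: exp_of_nat_mult)
  also have "real n * (- \<epsilon> * min 1 (y\<^sup>2 / (4 * \<delta>\<^sup>2))) = - \<epsilon> * min (real n) (real n * y\<^sup>2 / (4 * \<delta>\<^sup>2))"
  proof -
    have "real n * min 1 (y\<^sup>2 / (4 * \<delta>\<^sup>2)) = min (real n) (real n * y\<^sup>2 / (4 * \<delta>\<^sup>2))"
      unfolding min_mult_distrib_left by simp
    thus ?thesis by (metis mult.left_commute)
  qed
  finally show ?thesis .
qed

end

section \<open>The saddle point\<close>

text \<open>\<open>K\<^sub>1\<close> and \<open>K\<^sub>2\<close> stand for the cumulant generating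
  functions of \<open>V\<close> and \<open>U\<close>, and the \<open>q\<close> of \<open>H\<close>
  for 1 / \<rho>, so that \<open>H q\<close> extends \<open>log_psi\<close> to complex arguments.
  With \<open>q\<close> at most \<open>4 / 3\<close>, a disc of radius \<open>3 / 4 * R\<close> is
  mapped into the common domain.\<close>

locale cumulant_pair =
  fixes K\<^sub>1 K\<^sub>2 :: "complex \<Rightarrow> complex" and R v\<^sub>1 v\<^sub>2 :: real
  assumes R: "0 < R" and hol: "K\<^sub>1 holomorphic_on ball 0 R" "K\<^sub>2 holomorphic_on ball 0 R"
    and K0: "K\<^sub>1 0 = 0" "K\<^sub>2 0 = 0" and K1: "deriv K\<^sub>1 0 = 1" "deriv K\<^sub>2 0 = 1"
    and K2: "(deriv ^^ 2) K\<^sub>1 0 = of_real v\<^sub>1" "(deriv ^^ 2) K\<^sub>2 0 = of_real v\<^sub>2"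
    and v: "0 \<le> v\<^sub>1" "0 \<le> v\<^sub>2" "0 < v\<^sub>1 + v\<^sub>2"
begin

definition H :: "real \<Rightarrow> complex \<Rightarrow> complex" where
  "H q z = K\<^sub>1 (- z) + K\<^sub>2 (of_real q * z)"

lemma H_0: "H q 0 = 0" by (simp add: H_def K0)

context
  fixes q :: real assumes q: "1 \<le> q" "q \<le> 4 / 3"
begin

lemma scaled_in_ball: "(z :: complex) \<in> ball 0 (3 / 4 * R) \<Longrightarrow> of_real q * z \<in> ball 0 R"
  using q mult_right_mono[of q "4 / 3" "cmod z"] by (auto simp: norm_mult)

lemma K_compose_holomorphic:
  "(\<lambda>z. K\<^sub>1 (- 1 * z)) holomorphic_on ball 0 (3 / 4 * R)" "(\<lambda>z. K\<^sub>2 (of_real q * z)) holomorphic_on ball 0 (3 / 4 * R)"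
proof -
  have "K\<^sub>1 \<circ> (\<lambda>z. - 1 * z) holomorphic_on ball 0 (3 / 4 * R)"
    by (rule holomorphic_on_compose_gen[OF _ hol(1)]) (use R in \<open>auto intro!: holomorphic_intros\<close>)
  thus "(\<lambda>z. K\<^sub>1 (- 1 * z)) holomorphic_on ball 0 (3 / 4 * R)" by (simp only: o_def)
  have "K\<^sub>2 \<circ> (\<lambda>z. of_real q * z) holomorphic_on ball 0 (3 / 4 * R)"
    by (rule holomorphic_on_compose_gen[OF _ hol(2)]) (auto intro!: holomorphic_intros scaled_in_ball[simplified])
  thus "(\<lambda>z. K\<^sub>2 (of_real q * z)) holomorphic_on ball 0 (3 / 4 * R)" by (simp only: o_def)
qed

lemma holomorphic_H: "H q holomorphic_on ball 0 (3 / 4 * R)"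
  using holomorphic_on_add[OF K_compose_holomorphic] by (simp add: H_def[abs_def])

lemma higher_deriv_H:
  assumes "z \<in> ball 0 (3 / 4 * R)"
  shows "(deriv ^^ k) (H q) z = (- 1) ^ k * (deriv ^^ k) K\<^sub>1 (- z) + of_real q ^ k * (deriv ^^ k) K\<^sub>2 (of_real q * z)"
proof -
  have "H q = (\<lambda>z. K\<^sub>1 (- 1 * z) + K\<^sub>2 (of_real q * z))" by (simp add: H_def fun_eq_iff)
  hence "(deriv ^^ k) (H q) z = (deriv ^^ k) (\<lambda>z. K\<^sub>1 (- 1 * z)) z + (deriv ^^ k) (\<lambda>z. K\<^sub>2 (of_real q * z)) z"
    using higher_deriv_add[OF K_compose_holomorphic open_ball assms, of k] by simp
  also have "(deriv ^^ k) (\<lambda>z. K\<^sub>1 (- 1 * z)) z = (- 1) ^ k * (deriv ^^ k) K\<^sub>1 (- 1 * z)"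
    by (rule higher_deriv_compose_linear[OF hol(1) open_ball open_ball assms]) (use R in auto)
  also have "(deriv ^^ k) (\<lambda>z. K\<^sub>2 (of_real q * z)) z = of_real q ^ k * (deriv ^^ k) K\<^sub>2 (of_real q * z)"
    by (rule higher_deriv_compose_linear[OF hol(2) open_ball open_ball assms]) (rule scaled_in_ball)
  finally show ?thesis by simp
qed

lemma deriv_H_0: "deriv (H q) 0 = of_real (q - 1)"
  using higher_deriv_H[of 0 1] R by (simp add: K1)

end

text \<open>The bounds are taken from \<open>K\<^sub>1\<close> and \<open>K\<^sub>2\<close> on the
  fixed disc of radius \<open>R / 2\<close> and not from \<open>H q\<close>; this makes them uniform
  in \<open>q\<close>, that is, in n. Convexity comes from the positive total variance by continuity
  of the second derivatives.\<close>

lemma uniform_bounds: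
  obtains R1 m C where "0 < R1" "R1 < 3 / 4 * R" "0 < m" "0 < C"
    "\<And>q z k. 1 \<le> q \<Longrightarrow> q \<le> 4 / 3 \<Longrightarrow> cmod z \<le> R1 \<Longrightarrow> k \<le> 4 \<Longrightarrow> cmod ((deriv ^^ k) (H q) z) \<le> C"
    "\<And>q z. 1 \<le> q \<Longrightarrow> q \<le> 4 / 3 \<Longrightarrow> cmod z \<le> R1 \<Longrightarrow> m \<le> Re ((deriv ^^ 2) (H q) z)"
proof -
  have cont: "continuous_on (ball 0 R) ((deriv ^^ k) K\<^sub>1)" "continuous_on (ball 0 R) ((deriv ^^ k) K\<^sub>2)" for k
    by (intro holomorphic_on_imp_continuous_on holomorphic_higher_deriv hol open_ball)+
  have "\<exists>b. \<forall>z\<in>cball 0 (R / 2). cmod ((deriv ^^ k) K\<^sub>1 z) \<le> b \<and> cmod ((deriv ^^ k) K\<^sub>2 z) \<le> b" for k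
  proof -
    have sub: "cball 0 (R / 2) \<subseteq> ball (0 :: complex) R" using R by auto
    have "compact ((deriv ^^ k) K\<^sub>1 ` cball 0 (R / 2))" "compact ((deriv ^^ k) K\<^sub>2 ` cball 0 (R / 2))"
      by (intro compact_continuous_image compact_cball continuous_on_subset[OF cont(1) sub] continuous_on_subset[OF cont(2) sub])+
    hence bd: "bounded ((deriv ^^ k) K\<^sub>1 ` cball 0 (R / 2))" "bounded ((deriv ^^ k) K\<^sub>2 ` cball 0 (R / 2))"
      by (simp_all add: compact_imp_bounded)
    obtain b1 where "\<forall>z\<in>cball 0 (R / 2). cmod ((deriv ^^ k) K\<^sub>1 z) \<le> b1"
      using bd(1) unfolding bounded_iff by blast
    moreover obtain b2 where "\<forall>z\<in>cball 0 (R / 2). cmod ((deriv ^^ k) K\<^sub>2 z) \<le> b2"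
      using bd(2) unfolding bounded_iff by blast
    ultimately show ?thesis by (intro exI[of _ "max b1 b2"]) (auto simp: le_max_iff_disj)
  qed
  then obtain b where b: "\<And>k z. z \<in> cball 0 (R / 2) \<Longrightarrow> cmod ((deriv ^^ k) K\<^sub>1 z) \<le> b k \<and> cmod ((deriv ^^ k) K\<^sub>2 z) \<le> b k"
    by metis
  have b0: "0 \<le> b k" for k using b[of 0 k] R order_trans[OF norm_ge_zero] by auto
  define v where "v = v\<^sub>1 + v\<^sub>2"
  have v0: "0 < v" using v by (simp add: v_def)
  have z0: "(0 :: complex) \<in> ball 0 R" using R by simp
  have "\<exists>d>0. \<forall>z. cmod z < d \<longrightarrow> cmod ((deriv ^^ 2) K z - (deriv ^^ 2) K 0) < v / 8" if "continuous_on (ball 0 R) ((deriv ^^ 2) K)" for K :: "complex \<Rightarrow> complex"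
  proof -
    have "isCont ((deriv ^^ 2) K) 0" using that z0 by (simp add: continuous_on_eq_continuous_at)
    hence "\<forall>\<epsilon>>0. \<exists>d>0. \<forall>z. dist z 0 < d \<longrightarrow> dist ((deriv ^^ 2) K z) ((deriv ^^ 2) K 0) < \<epsilon>"
      unfolding continuous_at_eps_delta .
    from this[THEN spec, of "v / 8"] show ?thesis using v0 by (simp add: dist_norm)
  qed
  from this[OF cont(1)] this[OF cont(2)] obtain d1 d2 where d: "0 < d1" "0 < d2"
    "\<And>z. cmod z < d1 \<Longrightarrow> cmod ((deriv ^^ 2) K\<^sub>1 z - of_real v\<^sub>1) < v / 8"
    "\<And>z. cmod z < d2 \<Longrightarrow> cmod ((deriv ^^ 2) K\<^sub>2 z - of_real v\<^sub>2) < v / 8"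
    unfolding K2 by metis
  \<comment> \<open>Since \<open>q\<close> is at most \<open>4 / 3\<close>, the factor
    \<open>3 / 8\<close> keeps \<open>q * z\<close> within radius \<open>R / 2\<close>, and the
    halves of \<open>d1\<close> and \<open>d2\<close> keep both arguments inside the neighbourhoods
    just found.\<close>
  define R1 where "R1 = min (3 / 8 * R) (min (d1 / 2) (d2 / 2))"
  have R1: "0 < R1" "R1 \<le> 3 / 8 * R" "R1 \<le> d1 / 2" "R1 \<le> d2 / 2" using R d by (auto simp: R1_def)
  have qz: "cmod (of_real q * z) \<le> 4 / 3 * cmod z" if "1 \<le> q" "q \<le> 4 / 3" for q :: real and z :: complex
    using that mult_right_mono[of q "4 / 3" "cmod z"] by (auto simp: norm_mult)
  show ?thesis
  proof (rule that[of R1 "v / 2" "(\<Sum>k\<le>4. b k * (1 + (4 / 3) ^ k)) + 1"])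
    show "0 < (\<Sum>k\<le>4. b k * (1 + (4 / 3) ^ k)) + (1 :: real)"
      by (intro add_nonneg_pos sum_nonneg mult_nonneg_nonneg b0) auto
    fix q :: real and z :: complex assume q: "1 \<le> q" "q \<le> 4 / 3" and z: "cmod z \<le> R1"
    have zb: "z \<in> ball 0 (3 / 4 * R)" "- z \<in> cball 0 (R / 2)" "of_real q * z \<in> cball 0 (R / 2)"
      using z R1 R qz[OF q, of z] by auto
    show "cmod ((deriv ^^ k) (H q) z) \<le> (\<Sum>k\<le>4. b k * (1 + (4 / 3) ^ k)) + 1" if "k \<le> 4" for k
    proof -
      have "cmod ((deriv ^^ k) (H q) z) \<le> cmod ((deriv ^^ k) K\<^sub>1 (- z)) + q ^ k * cmod ((deriv ^^ k) K\<^sub>2 (of_real q * z))"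
        unfolding higher_deriv_H[OF q zb(1)] using q by (intro norm_triangle_le) (simp add: norm_mult norm_power)
      also have "\<dots> \<le> b k + (4 / 3) ^ k * b k"
        using q b zb b0 by (intro add_mono mult_mono power_mono) auto
      also have "\<dots> = b k * (1 + (4 / 3) ^ k)" by (simp add: algebra_simps)
      also have "\<dots> \<le> (\<Sum>k\<le>4. b k * (1 + (4 / 3) ^ k))"
        using that b0 by (intro member_le_sum) auto
      finally show ?thesis by simp
    qed
    have "cmod ((deriv ^^ 2) K\<^sub>1 (- z) - of_real v\<^sub>1) < v / 8"
      using z R1 d(1) by (intro d) auto
    hence 1: "v\<^sub>1 - v / 8 \<le> Re ((deriv ^^ 2) K\<^sub>1 (- z))"
      using abs_Re_le_cmod[of "(deriv ^^ 2) K\<^sub>1 (- z) - of_real v\<^sub>1"] by (auto simp: abs_le_iff)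
    have "cmod ((deriv ^^ 2) K\<^sub>2 (of_real q * z) - of_real v\<^sub>2) < v / 8"
      using z R1 d(2) qz[OF q, of z] by (intro d) auto
    hence 2: "v\<^sub>2 - v / 8 \<le> Re ((deriv ^^ 2) K\<^sub>2 (of_real q * z))"
      using abs_Re_le_cmod[of "(deriv ^^ 2) K\<^sub>2 (of_real q * z) - of_real v\<^sub>2"] by (auto simp: abs_le_iff)
    have q2: "1 \<le> q\<^sup>2" "q\<^sup>2 \<le> 16 / 9" using q one_le_power[of q 2] power_mono[of q "4 / 3" 2] by (auto simp: power_divide)
    have "q\<^sup>2 * (v\<^sub>2 - v / 8) \<le> q\<^sup>2 * Re ((deriv ^^ 2) K\<^sub>2 (of_real q * z))" using 2 by (intro mult_left_mono) auto
    moreover have "v\<^sub>2 \<le> q\<^sup>2 * v\<^sub>2" using mult_right_mono[OF q2(1) v(2)] by simp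
    moreover have "q\<^sup>2 * v \<le> 16 / 9 * v" using mult_right_mono[OF q2(2), of v] v0 by simp
    moreover have "Re ((deriv ^^ 2) (H q) z) = Re ((deriv ^^ 2) K\<^sub>1 (- z)) + q\<^sup>2 * Re ((deriv ^^ 2) K\<^sub>2 (of_real q * z))"
      unfolding higher_deriv_H[OF q zb(1)] by (simp flip: of_real_power)
    moreover have "q\<^sup>2 * (v\<^sub>2 - v / 8) = q\<^sup>2 * v\<^sub>2 - q\<^sup>2 * v / 8" by (simp add: algebra_simps)
    \<comment> \<open>The loss is \<open>v / 8\<close> from the first summand and at most
      \<open>16 / 9 * v / 8\<close> from the second, together less than
      \<open>v / 2\<close>.\<close>
    ultimately show "v / 2 \<le> Re ((deriv ^^ 2) (H q) z)"
      using 1 v0 v_def by linarith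
  qed (use R1 R v0 in auto)
qed

end

text \<open>The slope \<open>d\<close> at 0 is below \<open>m * \<delta>'\<close>, and the
  derivative grows at rate at least \<open>m\<close>, so it changes sign exactly once in the
  interval. The mean value theorem locates the zero between the distances \<open>d / C\<close> and
  \<open>d / m\<close> from 0. Taylor's formula about the zero, evaluated at 0, makes the value
  there negative.\<close>

lemma saddle_point_exists:
  fixes h :: "real \<Rightarrow> real"
  assumes D: "\<And>k x. \<bar>x\<bar> \<le> R1 \<Longrightarrow> ((deriv ^^ k) h has_real_derivative (deriv ^^ Suc k) h x) (at x)"
    and h2: "\<And>x. \<bar>x\<bar> \<le> R1 \<Longrightarrow> m \<le> (deriv ^^ 2) h x \<and> (deriv ^^ 2) h x \<le> C"
    and h0: "h 0 = 0" and d: "deriv h 0 = d" "0 < d" "d < m * \<delta>'" and \<delta>': "0 < \<delta>'" "\<delta>' \<le> R1" and m: "0 < m"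
  obtains \<zeta> where "\<And>z. is_saddle_point \<delta>' h z \<longleftrightarrow> z = \<zeta>" "saddle_point \<delta>' h = \<zeta>"
    "- \<delta>' < \<zeta>" "\<zeta> < 0" "d / C \<le> - \<zeta>" "- \<zeta> \<le> d / m" "deriv h \<zeta> = 0" "h \<zeta> \<le> - (m * \<zeta>\<^sup>2 / 2)"
proof -
  have D0: "(h has_real_derivative deriv h x) (at x)" and D1: "(deriv h has_real_derivative (deriv ^^ 2) h x) (at x)"
    if "\<bar>x\<bar> \<le> R1" for x
    using D[OF that, of 0] D[OF that, of 1] by (simp_all add: numeral_2_eq_2)
  have mvt: "\<exists>\<xi>. \<bar>\<xi>\<bar> \<le> R1 \<and> deriv h y - deriv h x = (y - x) * (deriv ^^ 2) h \<xi>" if "- R1 \<le> x" "x < y" "y \<le> R1" for x y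
  proof -
    have "\<exists>z. x < z \<and> z < y \<and> deriv h y - deriv h x = (y - x) * (deriv ^^ 2) h z"
      using that by (intro MVT2 D1) (auto simp: abs_le_iff)
    then obtain z where "x < z" "z < y" "deriv h y - deriv h x = (y - x) * (deriv ^^ 2) h z" by blast
    thus ?thesis using that by (intro exI[of _ z]) (auto simp: abs_le_iff)
  qed
  have C: "0 < C" using h2[of 0] m \<delta>' by auto
  have "\<exists>x. - \<delta>' \<le> x \<and> x \<le> 0 \<and> deriv h x = 0"
  proof (rule IVT'[of "deriv h" "- \<delta>'" 0 0])
    have "\<exists>\<xi>. \<bar>\<xi>\<bar> \<le> R1 \<and> deriv h 0 - deriv h (- \<delta>') = (0 - (- \<delta>')) * (deriv ^^ 2) h \<xi>"
      by (rule mvt) (use \<delta>' in linarith)+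
    then obtain \<xi> where \<xi>: "\<bar>\<xi>\<bar> \<le> R1" "deriv h 0 - deriv h (- \<delta>') = (0 - (- \<delta>')) * (deriv ^^ 2) h \<xi>"
      by blast
    have "m * \<delta>' \<le> (deriv ^^ 2) h \<xi> * \<delta>'" using h2[OF \<xi>(1)] \<delta>' by (intro mult_right_mono) auto
    moreover have "(0 - (- \<delta>')) * (deriv ^^ 2) h \<xi> = (deriv ^^ 2) h \<xi> * \<delta>'" by simp
    ultimately show "deriv h (- \<delta>') \<le> 0" using d(1,3) \<xi>(2) by linarith
    show "continuous_on {- \<delta>'..0} (deriv h)"
      by (rule DERIV_continuous_on, rule has_field_derivative_at_within, rule D1) (use \<delta>' in \<open>auto simp: abs_le_iff\<close>)
  qed (use d \<delta>' in auto)
  then obtain \<zeta> where \<zeta>: "- \<delta>' \<le> \<zeta>" "\<zeta> \<le> 0" "deriv h \<zeta> = 0" by blast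
  have "\<zeta> < 0" using \<zeta> d by (cases "\<zeta> = 0") auto
  have \<zeta>R: "\<bar>\<zeta>\<bar> \<le> R1" "- R1 \<le> \<zeta>" using \<zeta> \<delta>' by (auto simp: abs_le_iff)
  have "\<exists>\<xi>. \<bar>\<xi>\<bar> \<le> R1 \<and> deriv h 0 - deriv h \<zeta> = (0 - \<zeta>) * (deriv ^^ 2) h \<xi>"
    by (rule mvt) (use \<zeta>R \<open>\<zeta> < 0\<close> \<delta>' in linarith)+
  then obtain \<xi> where "\<bar>\<xi>\<bar> \<le> R1" "deriv h 0 - deriv h \<zeta> = (0 - \<zeta>) * (deriv ^^ 2) h \<xi>" by blast
  hence \<xi>: "\<bar>\<xi>\<bar> \<le> R1" "d = - \<zeta> * (deriv ^^ 2) h \<xi>" unfolding d(1) \<zeta>(3) by simp_all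
  have "- \<zeta> * m \<le> d" "d \<le> - \<zeta> * C" unfolding \<xi>(2) using h2[OF \<xi>(1)] \<open>\<zeta> < 0\<close> by (intro mult_left_mono; simp)+
  hence bnds: "d / C \<le> - \<zeta>" "- \<zeta> \<le> d / m" using C m by (auto simp: field_simps)
  have "d / m < \<delta>'" using d m by (simp add: field_simps)
  hence "- \<delta>' < \<zeta>" using bnds by linarith
  have iff: "is_saddle_point \<delta>' h z \<longleftrightarrow> z = \<zeta>" for z
  proof
    assume z: "is_saddle_point \<delta>' h z"
    hence zr: "- \<delta>' \<le> z" "z \<le> 0" "deriv h z = 0" by (auto simp: is_saddle_point_def DERIV_imp_deriv)
    have ne: "\<not> (x < y \<and> deriv h x = 0 \<and> deriv h y = 0)" if "- \<delta>' \<le> x" "y \<le> 0" for x y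
    proof
      assume xy: "x < y \<and> deriv h x = 0 \<and> deriv h y = 0"
      have "\<exists>\<eta>. \<bar>\<eta>\<bar> \<le> R1 \<and> deriv h y - deriv h x = (y - x) * (deriv ^^ 2) h \<eta>"
        by (rule mvt) (use that xy \<delta>' in linarith)+
      then obtain \<eta> where \<eta>: "\<bar>\<eta>\<bar> \<le> R1" "deriv h y - deriv h x = (y - x) * (deriv ^^ 2) h \<eta>" by blast
      have "0 < (y - x) * (deriv ^^ 2) h \<eta>" using h2[OF \<eta>(1)] m xy by (intro mult_pos_pos) auto
      thus False using \<eta>(2) xy by simp
    qed
    show "z = \<zeta>" using ne[of z \<zeta>] ne[of \<zeta> z] zr \<zeta> by (meson linorder_neqE_linordered_idom)
  next
    assume "z = \<zeta>"
    thus "is_saddle_point \<delta>' h z" using D0[OF \<zeta>R(1)] \<zeta> by (auto simp: is_saddle_point_def)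
  qed
  have sp: "saddle_point \<delta>' h = \<zeta>" unfolding saddle_point_def iff by simp
  have "\<exists>t. (if 0 < \<zeta> then 0 < t \<and> t < \<zeta> else \<zeta> < t \<and> t < 0) \<and>
      h 0 = (\<Sum>k<2. (deriv ^^ k) h \<zeta> / fact k * (0 - \<zeta>) ^ k) + (deriv ^^ 2) h t / fact 2 * (0 - \<zeta>) ^ 2"
  proof (rule Taylor[where diff = "\<lambda>k. (deriv ^^ k) h" and a = "- R1" and b = R1])
    show "\<forall>k t. k < 2 \<and> - R1 \<le> t \<and> t \<le> R1 \<longrightarrow> ((deriv ^^ k) h has_real_derivative (deriv ^^ Suc k) h t) (at t)"
    proof (intro allI impI)
      fix k t assume "k < (2 :: nat) \<and> - R1 \<le> t \<and> t \<le> R1"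
      hence "\<bar>t\<bar> \<le> R1" by (simp add: abs_le_iff)
      thus "((deriv ^^ k) h has_real_derivative (deriv ^^ Suc k) h t) (at t)" by (rule D)
    qed
  qed (use \<open>\<zeta> < 0\<close> \<delta>' \<zeta>R in \<open>simp_all add: abs_le_iff\<close>)
  then obtain t where t: "\<zeta> < t" "t < 0" "h 0 = h \<zeta> + (deriv ^^ 2) h t / 2 * \<zeta>\<^sup>2"
    using \<open>\<zeta> < 0\<close> \<zeta>(3) by (auto simp: numeral_2_eq_2 split: if_splits)
  have "m * \<zeta>\<^sup>2 \<le> (deriv ^^ 2) h t * \<zeta>\<^sup>2"
    using h2[of t] t \<zeta>R by (intro mult_right_mono) (auto simp: abs_le_iff)
  moreover have "(deriv ^^ 2) h t / 2 * \<zeta>\<^sup>2 = (deriv ^^ 2) h t * \<zeta>\<^sup>2 / 2" by simp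
  ultimately have "h \<zeta> \<le> - (m * \<zeta>\<^sup>2 / 2)" using t(3) h0 by linarith
  with iff sp \<open>- \<delta>' < \<zeta>\<close> \<open>\<zeta> < 0\<close> bnds \<zeta>(3) show ?thesis using that by blast
qed

lemma norm_exp_diff_le:
  fixes x y :: complex
  assumes "Re x \<le> b" "Re y \<le> b"
  shows "cmod (exp x - exp y) \<le> exp b * cmod (x - y)"
proof (rule field_differentiable_bound[where S = "{z. Re z \<le> b}" and f' = exp])
  show "convex {z. Re z \<le> b}" by (rule convex_halfspace_Re_le)
qed (use assms in \<open>auto intro!: DERIV_subset[OF DERIV_exp]\<close>)

text \<open>The form of the map is chosen for this: \<open>1 / (1 + x)\<^sup>2\<close> and
  \<open>1 - 2 * x\<close> agree to first order, so the square reproduces the cubic term exactly and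
  leaves a quartic error.\<close>

lemma moebius_square_expansion:
  assumes "cmod (of_real \<phi> * t) \<le> 1 / 2"
  shows "cmod ((moebius \<phi> t)\<^sup>2 - (t\<^sup>2 - 2 * of_real \<phi> * t ^ 3)) \<le> 16 * \<phi>\<^sup>2 * cmod t ^ 4"
proof -
  define x where "x = of_real \<phi> * t"
  note d = norm_moebius_denominator[OF assms, folded x_def]
  have "(moebius \<phi> t)\<^sup>2 - (t\<^sup>2 - 2 * of_real \<phi> * t ^ 3) = t\<^sup>2 * (1 / (1 + x)\<^sup>2 - (1 - 2 * x))"
    unfolding moebius_def x_def[symmetric] by (simp add: power_divide x_def algebra_simps power2_eq_square power3_eq_cube)
  also have "1 / (1 + x)\<^sup>2 - (1 - 2 * x) = x\<^sup>2 * (3 + 2 * x) / (1 + x)\<^sup>2"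
  proof -
    have "1 / (1 + x)\<^sup>2 - (1 - 2 * x) = (1 - (1 - 2 * x) * (1 + x)\<^sup>2) / (1 + x)\<^sup>2"
      using d(2) by (simp add: diff_divide_distrib)
    also have "1 - (1 - 2 * x) * (1 + x)\<^sup>2 = x\<^sup>2 * (3 + 2 * x)"
      by (simp add: power2_eq_square algebra_simps)
    finally show ?thesis .
  qed
  finally have "cmod ((moebius \<phi> t)\<^sup>2 - (t\<^sup>2 - 2 * of_real \<phi> * t ^ 3)) = (cmod t)\<^sup>2 * ((cmod x)\<^sup>2 * cmod (3 + 2 * x) / (cmod (1 + x))\<^sup>2)"
    by (simp add: norm_mult norm_divide norm_power)
  also have "\<dots> \<le> (cmod t)\<^sup>2 * ((cmod x)\<^sup>2 * 4 / (1 / 2)\<^sup>2)"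
  proof (intro mult_left_mono frac_le power_mono)
    show "cmod (3 + 2 * x) \<le> 4"
      using norm_triangle_ineq[of 3 "2 * x"] assms by (simp add: norm_mult x_def)
  qed (use d in auto)
  also have "\<dots> = 16 * \<phi>\<^sup>2 * cmod t ^ 4"
    by (simp add: x_def norm_mult power_mult_distrib power2_eq_square power4_eq_xxxx)
  finally show ?thesis .
qed

text \<open>The constant \<open>N\<close> is eliminated: the exponent vanishes at t = \<beta>, which
  expresses \<open>N\<close> through \<beta> up to a quartic error. Applying the square expansion at
  both points leaves a difference of two squares.\<close>

lemma gaussian_exponent_error:
  assumes X: "cmod (X - (of_real N + t\<^sup>2 / 2 - of_real \<phi> * t ^ 3)) \<le> e * cmod t ^ 4"
    and N: "\<bar>N + \<beta>\<^sup>2 / 2 - \<phi> * \<beta> ^ 3\<bar> \<le> e * \<beta> ^ 4"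
    and small: "cmod (of_real \<phi> * t) \<le> 1 / 2" "\<bar>\<phi> * \<beta>\<bar> \<le> 1 / 2"
  shows "cmod (X - ((moebius \<phi> t)\<^sup>2 - (moebius \<phi> (of_real \<beta>))\<^sup>2) / 2) \<le> (e + 8 * \<phi>\<^sup>2) * (cmod t ^ 4 + \<beta> ^ 4)"
proof -
  let ?a = "X - (of_real N + t\<^sup>2 / 2 - of_real \<phi> * t ^ 3)"
  let ?b = "complex_of_real (N + \<beta>\<^sup>2 / 2 - \<phi> * \<beta> ^ 3)"
  let ?c = "((moebius \<phi> t)\<^sup>2 - (t\<^sup>2 - 2 * of_real \<phi> * t ^ 3)) / 2"
  let ?d = "((moebius \<phi> (of_real \<beta>))\<^sup>2 - ((of_real \<beta>)\<^sup>2 - 2 * of_real \<phi> * (of_real \<beta>) ^ 3)) / 2"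
  have s2: "cmod (of_real \<phi> * of_real \<beta>) \<le> 1 / 2" using small(2) by (simp add: norm_mult abs_mult)
  have "X - ((moebius \<phi> t)\<^sup>2 - (moebius \<phi> (of_real \<beta>))\<^sup>2) / 2 = (?a + ?b) + (?d - ?c)"
    by (simp add: field_simps)
  hence "cmod (X - ((moebius \<phi> t)\<^sup>2 - (moebius \<phi> (of_real \<beta>))\<^sup>2) / 2) \<le> (cmod ?a + cmod ?b) + (cmod ?d + cmod ?c)"
    by (metis norm_triangle_le add_mono norm_triangle_ineq norm_triangle_ineq4)
  also have "\<dots> \<le> (e * cmod t ^ 4 + e * \<beta> ^ 4) + (8 * \<phi>\<^sup>2 * \<beta> ^ 4 + 8 * \<phi>\<^sup>2 * cmod t ^ 4)"
  proof (intro add_mono X)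
    show "cmod ?b \<le> e * \<beta> ^ 4" unfolding norm_of_real using N .
    show "cmod ?c \<le> 8 * \<phi>\<^sup>2 * cmod t ^ 4" using moebius_square_expansion[OF small(1)] by (simp add: norm_divide)
    show "cmod ?d \<le> 8 * \<phi>\<^sup>2 * \<beta> ^ 4" using moebius_square_expansion[OF s2] by (simp add: norm_divide)
  qed
  also have "\<dots> = (e + 8 * \<phi>\<^sup>2) * (cmod t ^ 4 + \<beta> ^ 4)" by (simp add: algebra_simps)
  finally show ?thesis .
qed

section \<open>Expansion at the saddle point\<close>

context queue_data
begin

lemma holomorphic_psi:
  assumes "0 < \<rho>" "\<rho> \<le> 1" "0 \<le> r"
  shows "psi M V U \<rho> holomorphic_on {s. - (\<rho> * r) < Re s \<and> Re s < \<rho> * r}"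
proof -
  have *: "\<rho> * r \<le> r" "0 \<le> \<rho> * r" using mult_right_mono[OF assms(2,3)] assms by auto
  have "(\<lambda>s. \<integral>\<omega>. exp (s * complex_of_real (V \<omega> - U \<omega> / \<rho>)) \<partial>M) holomorphic_on {s. - (\<rho> * r) < Re s \<and> Re s < \<rho> * r}"
    using psi_real(1)[OF assms(1), of "- (\<rho> * r)"] psi_real(1)[OF assms(1), of "\<rho> * r"] *
    by (intro holomorphic_on_exp_moment) auto
  thus ?thesis by (simp add: psi_def[abs_def])
qed

lemma norm_psi_le:
  assumes "0 < \<rho>" "\<bar>x\<bar> \<le> r" "\<bar>x\<bar> \<le> \<rho> * r"
  shows "cmod (psi M V U \<rho> (Complex x y)) \<le> Re (psi M V U \<rho> (of_real x))"
proof -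
  have "cmod (psi M V U \<rho> (Complex x y)) \<le> (\<integral>\<omega>. norm (exp (Complex x y * complex_of_real (V \<omega> - U \<omega> / \<rho>))) \<partial>M)"
    unfolding psi_def by (rule integral_norm_bound)
  also have "\<dots> = Re (psi M V U \<rho> (of_real x))"
    unfolding psi_real(4)[OF assms] by simp
  finally show ?thesis .
qed

end

text \<open>All data for one fixed \<open>n\<close>. \<open>H\<close> is the logarithm of
  \<open>psi\<close> at the reflected argument, holomorphic on the disc of radius \<open>R2\<close>,
  with its fourth derivative bounded on the smaller closed disc of radius \<open>R1\<close>. The
  parameters \<open>m\<close>, \<open>C\<close> and \<open>R1\<close> will be the same for all large
  \<open>n\<close>.\<close>

locale saddle_queue = queue_data M V U r for M :: "'a measure" and V U r +
  fixes \<delta> \<epsilon> \<rho> R1 R2 m C \<zeta> :: real and H :: "complex \<Rightarrow> complex" and h :: "real \<Rightarrow> real"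
    and n :: nat and W :: "'a \<Rightarrow> real"
  assumes sep: "separation M V U \<delta> \<epsilon>" "0 < \<delta>" "0 < \<epsilon>"
    and \<rho>: "1 / 2 \<le> \<rho>" "\<rho> < 1" and n: "1 \<le> n"
    and Rs: "0 < R1" "R1 < R2" "R2 \<le> \<rho> * r"
    and hol: "H holomorphic_on ball 0 R2"
    and exp_H: "\<And>z. z \<in> ball 0 R2 \<Longrightarrow> exp (H z) = psi M V U \<rho> (- z)"
    and H_real: "\<And>x. \<bar>x\<bar> < R2 \<Longrightarrow> H (of_real x) = of_real (h x)" and H_0: "H 0 = 0"
    and H_4: "\<And>z. cmod z \<le> R1 \<Longrightarrow> cmod ((deriv ^^ 4) H z) \<le> C"
    and \<zeta>: "- R1 < \<zeta>" "\<zeta> < 0" "- \<zeta> \<le> \<delta>" "deriv h \<zeta> = 0" "h \<zeta> \<le> - (m * \<zeta>\<^sup>2 / 2)"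
    and m: "0 < m" "m \<le> (deriv ^^ 2) h \<zeta>" "(deriv ^^ 2) h \<zeta> \<le> C" "\<bar>(deriv ^^ 3) h \<zeta>\<bar> \<le> C"
    and W: "steady_state_waiting_time M V U n \<rho> W"
begin

definition "\<sigma> = sqrt ((deriv ^^ 2) h \<zeta>)"
definition "\<beta> = - \<zeta> * \<sigma> * sqrt (real n)"
definition "d\<^sub>2 = - (deriv ^^ 3) h \<zeta> / (6 * (deriv ^^ 2) h \<zeta>)"
definition "\<phi> = d\<^sub>2 / (\<sigma> * sqrt (real n))"
text \<open>The unit of length at the saddle point: the scaled variable t corresponds to the
  argument \<open>\<zeta> + l * t\<close> of \<open>H\<close>.\<close>

definition "l = 1 / (\<sigma> * sqrt (real n))"

lemma r_bounds: "0 < \<rho>" "R2 \<le> r" "0 < r" "R2 \<le> \<rho> * r"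
proof -
  show "0 < \<rho>" using \<rho> by simp
  have "0 < \<rho> * r" using Rs by linarith
  thus "0 < r" using \<rho> by (simp add: zero_less_mult_iff)
  hence "\<rho> * r \<le> 1 * r" using \<rho> by (intro mult_right_mono) auto
  thus "R2 \<le> r" "R2 \<le> \<rho> * r" using Rs by auto
qed

lemma pos: "0 < \<sigma>" "0 < sqrt (real n)" "\<sigma>\<^sup>2 = (deriv ^^ 2) h \<zeta>" "0 < l" "0 < \<beta>" "(sqrt (real n))\<^sup>2 = real n" "0 < real n"
  using m n \<zeta> by (auto simp: \<sigma>_def l_def \<beta>_def intro!: mult_pos_pos mult_neg_pos)

lemma l_eqs: "l * \<beta> = - \<zeta>" "real n * l\<^sup>2 = 1 / \<sigma>\<^sup>2" "\<phi> = d\<^sub>2 * l"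
  using pos by (auto simp: l_def \<beta>_def \<phi>_def power_divide power_mult_distrib)

lemma C_pos: "0 < C" "m \<le> C" using m by auto

lemma \<sigma>_bounds: "sqrt m \<le> \<sigma>" "\<sigma> \<le> sqrt C" "m \<le> \<sigma>\<^sup>2" "\<sigma>\<^sup>2 \<le> C"
  using m pos(3) by (auto simp: \<sigma>_def)

lemma abs_d2_le: "\<bar>d\<^sub>2\<bar> \<le> C / (6 * m)"
proof -
  have "\<bar>d\<^sub>2\<bar> = \<bar>(deriv ^^ 3) h \<zeta>\<bar> / (6 * (deriv ^^ 2) h \<zeta>)" using m by (simp add: d\<^sub>2_def)
  also have "\<dots> \<le> C / (6 * m)" using m by (intro frac_le) auto
  finally show ?thesis .
qed

lemma abs_\<phi>_le: "\<bar>\<phi>\<bar> \<le> C / (6 * m) / sqrt m / sqrt (real n)"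
proof -
  have "\<bar>\<phi>\<bar> = \<bar>d\<^sub>2\<bar> / (\<sigma> * sqrt (real n))" using pos by (simp add: \<phi>_def abs_mult)
  also have "\<dots> \<le> (C / (6 * m)) / (sqrt m * sqrt (real n))"
    using abs_d2_le \<sigma>_bounds m pos by (intro frac_le mult_right_mono mult_pos_pos) auto
  finally show ?thesis by simp
qed

lemma real_psi: "\<bar>x\<bar> < R2 \<Longrightarrow> Re (psi M V U \<rho> (of_real (- x))) = exp (h x)"
proof -
  assume x: "\<bar>x\<bar> < R2"
  have "psi M V U \<rho> (of_real (- x)) = of_real (exp (h x))"
    using exp_H[of "of_real x"] H_real[OF x] x by (simp add: exp_of_real)
  thus ?thesis by simp
qed

lemma h_isCont: "\<bar>x\<bar> < R2 \<Longrightarrow> isCont h x"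
  using higher_deriv_real_restriction(2)[OF hol H_real, of x 0] by (auto intro: DERIV_isCont)

text \<open>Pollaczek's integral needs a step transform below 1 on a closed strip around the line.
  At the saddle point \<open>h\<close> is negative, and continuity gives a neighbourhood where it
  stays so.\<close>

lemma log_transform_W:
  obtains L :: "complex \<Rightarrow> complex" where "is_log_transform M (\<lambda>\<omega>. sqrt (real n) / \<sigma> * W \<omega>) \<beta> L"
    "\<And>s. - \<beta> < Re s \<Longrightarrow> (LBINT y. Ln (1 - psi M V U \<rho> (of_real l * Complex \<beta> (- y)) ^ n) *
        cauchy_kernel (s + of_real \<beta>) (of_real \<beta>) (Complex 0 y)) = 2 * pi * L s"
proof -
  have h\<zeta>: "h \<zeta> < 0"
  proof -
    have "0 < m * \<zeta>\<^sup>2 / 2" using m \<zeta> by simp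
    thus ?thesis using \<zeta> by linarith
  qed
  have "isCont h \<zeta>" using \<zeta> Rs by (intro h_isCont) auto
  then obtain e where e: "0 < e" "\<And>x. \<bar>x - \<zeta>\<bar> < e \<Longrightarrow> \<bar>h x - h \<zeta>\<bar> < - h \<zeta>"
    unfolding continuous_at_eps_delta dist_real_def using h\<zeta> by (metis neg_0_less_iff_less)
  \<comment> \<open>Half of each of three margins around \<open>\<zeta>\<close>: the radius of
    continuity, the distance to 0, and the distance to \<open>- R1\<close>. The second keeps the
    left end of the strip positive.\<close>
  define g where "g = min (e / 2) (min (- \<zeta> / 2) ((R1 + \<zeta>) / 2))"
  have g: "0 < g" "g < e" "g < - \<zeta>" "g < R1 + \<zeta>" 
  proof -
    have "g \<le> e / 2" unfolding g_def by (rule min.cobounded1)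
    moreover have "g \<le> - \<zeta> / 2" unfolding g_def by (rule order_trans[OF min.cobounded2 min.cobounded1])
    moreover have "g \<le> (R1 + \<zeta>) / 2" unfolding g_def by (rule order_trans[OF min.cobounded2 min.cobounded2])
    ultimately show "g < e" "g < - \<zeta>" "g < R1 + \<zeta>" using e(1) \<zeta>(1,2) by argo+
  qed (use e(1) \<zeta>(1,2) in \<open>simp add: g_def\<close>)
  define c1 c2 where "c1 = \<beta> + g / l" and "c2 = \<beta> - g / l"
  have kl: "sqrt (real n) / \<sigma> / real n = l"
  proof -
    have "w / \<sigma> / w\<^sup>2 = 1 / (\<sigma> * w)" if "0 < w" for w :: real
      using that by (simp add: power2_eq_square)
    from this[OF pos(2)] show ?thesis by (simp only: pos(6) l_def)
  qed
  have lc: "l * c1 = - \<zeta> + g" "l * c2 = - \<zeta> - g"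
    using pos l_eqs by (simp_all add: c1_def c2_def algebra_simps)
  have c: "0 < c2" "c2 < \<beta>" "\<beta> < c1"
  proof -
    have "0 < l * c2" using lc g by simp
    thus "0 < c2" using pos by (simp add: zero_less_mult_iff)
  qed (use pos g in \<open>simp_all add: c1_def c2_def\<close>)
  have dom: "l * c1 \<le> r" "l * c1 \<le> \<rho> * r" using lc g Rs r_bounds by linarith+
  have less: "Re (psi M V U \<rho> (of_real (l * \<theta>))) < 1" if \<theta>: "c2 \<le> \<theta>" "\<theta> \<le> c1" for \<theta>
  proof -
    have t: "- \<zeta> - g \<le> l * \<theta>" "l * \<theta> \<le> - \<zeta> + g"
      using mult_left_mono[OF \<theta>(1), of l] mult_left_mono[OF \<theta>(2), of l] pos unfolding lc by auto
    have "\<bar>- (l * \<theta>)\<bar> < R2" using t g Rs \<zeta> unfolding abs_less_iff by linarith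
    hence "Re (psi M V U \<rho> (of_real (- (- (l * \<theta>))))) = exp (h (- (l * \<theta>)))" by (rule real_psi)
    moreover have "\<bar>- (l * \<theta>) - \<zeta>\<bar> < e" using t g unfolding abs_less_iff by linarith
    hence "h (- (l * \<theta>)) < 0" using e(2)[of "- (l * \<theta>)"] unfolding abs_less_iff by linarith
    ultimately show ?thesis by simp
  qed
  have "0 < sqrt (real n) / \<sigma>" using pos by simp
  from queue_log_transform[OF W n r_bounds(1) this c, unfolded kl, OF dom less]
  show ?thesis using that by blast
qed

text \<open>The first bound, from assumption (A), decays in \<open>y\<close> and serves on the
  middle part and in the tail. The second compares with the value on the real axis; it keeps the
  modulus below a fixed number less than 1 once n \<zeta>^2 is bounded below.\<close>

lemma norm_psi_n_le:
  "cmod (psi M V U \<rho> (of_real l * Complex \<beta> (- y)) ^ n) \<le> exp (- \<epsilon> * min (real n) (y\<^sup>2 / (4 * \<delta>\<^sup>2 * C)))"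
  "cmod (psi M V U \<rho> (of_real l * Complex \<beta> (- y)) ^ n) \<le> exp (- (m * (real n * \<zeta>\<^sup>2) / 2))"
proof -
  have x: "0 < - \<zeta>" "- \<zeta> \<le> \<delta>" "- \<zeta> \<le> r" "- \<zeta> \<le> \<rho> * r" "\<bar>\<zeta>\<bar> < R2" using \<zeta> Rs r_bounds by auto
  have a: "of_real l * Complex \<beta> (- y) = Complex (- \<zeta>) (- (l * y))" using l_eqs by (simp add: complex_eq_iff)
  have re: "Re (psi M V U \<rho> (of_real (- \<zeta>))) = exp (h \<zeta>)" by (rule real_psi) (rule x)
  have "h \<zeta> \<le> 0"
  proof -
    have "0 \<le> m * \<zeta>\<^sup>2 / 2" using m by simp
    thus ?thesis using \<zeta>(5) by linarith
  qed
  hence "cmod (psi M V U \<rho> (Complex (- \<zeta>) (- (l * y))) ^ n) \<le> exp (- \<epsilon> * min (real n) (real n * (- (l * y))\<^sup>2 / (4 * \<delta>\<^sup>2)))"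
    using sep \<rho> x re by (intro norm_psi_power_le) auto
  also have "real n * (- (l * y))\<^sup>2 = y\<^sup>2 / \<sigma>\<^sup>2"
    using l_eqs(2) by (simp add: power_mult_distrib mult.assoc[symmetric])
  also have "exp (- \<epsilon> * min (real n) (y\<^sup>2 / \<sigma>\<^sup>2 / (4 * \<delta>\<^sup>2))) \<le> exp (- \<epsilon> * min (real n) (y\<^sup>2 / (4 * \<delta>\<^sup>2 * C)))"
  proof -
    have "y\<^sup>2 / (4 * \<delta>\<^sup>2 * C) \<le> y\<^sup>2 / (4 * \<delta>\<^sup>2 * \<sigma>\<^sup>2)"
      using \<sigma>_bounds(4) pos(1) C_pos sep by (intro divide_left_mono mult_left_mono mult_pos_pos) auto
    hence "min (real n) (y\<^sup>2 / (4 * \<delta>\<^sup>2 * C)) \<le> min (real n) (y\<^sup>2 / \<sigma>\<^sup>2 / (4 * \<delta>\<^sup>2))"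
      by (intro min.mono) (simp_all add: mult.commute)
    thus ?thesis using sep(3) by simp
  qed
  finally show "cmod (psi M V U \<rho> (of_real l * Complex \<beta> (- y)) ^ n) \<le> exp (- \<epsilon> * min (real n) (y\<^sup>2 / (4 * \<delta>\<^sup>2 * C)))"
    unfolding a .
  have "cmod (psi M V U \<rho> (Complex (- \<zeta>) (- (l * y)))) \<le> exp (h \<zeta>)"
    unfolding re[symmetric] using x by (intro norm_psi_le r_bounds) auto
  hence "cmod (psi M V U \<rho> (Complex (- \<zeta>) (- (l * y))) ^ n) \<le> exp (h \<zeta>) ^ n"
    unfolding norm_power by (intro power_mono) auto
  also have "\<dots> = exp (real n * h \<zeta>)" by (simp only: exp_of_nat_mult)
  also have "\<dots> \<le> exp (- (m * (real n * \<zeta>\<^sup>2) / 2))"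
    using mult_left_mono[OF \<zeta>(5), of "real n"] by (simp add: algebra_simps)
  finally show "cmod (psi M V U \<rho> (of_real l * Complex \<beta> (- y)) ^ n) \<le> exp (- (m * (real n * \<zeta>\<^sup>2) / 2))"
    unfolding a .
qed

lemma continuous_psi_n: "continuous_on UNIV (\<lambda>y. psi M V U \<rho> (of_real l * Complex \<beta> (- y)) ^ n)"
proof -
  have a: "of_real l * Complex \<beta> (- y) = of_real (- \<zeta>) - \<i> * of_real (l * y)" for y using l_eqs by (simp add: complex_eq_iff)
  have "\<rho> \<le> 1" "0 \<le> r" using \<rho> r_bounds by auto
  have "continuous_on UNIV (\<lambda>y. psi M V U \<rho> (of_real (- \<zeta>) - \<i> * of_real (l * y)))"
    by (rule continuous_on_compose2[OF holomorphic_on_imp_continuous_on[OF holomorphic_psi[OF r_bounds(1) \<open>\<rho> \<le> 1\<close> \<open>0 \<le> r\<close>]]])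
       (use \<zeta> Rs r_bounds in \<open>auto intro!: continuous_intros\<close>)
  thus ?thesis unfolding a by (intro continuous_intros)
qed

text \<open>The linear term vanishes at the saddle point. Since \<open>real n * l\<^sup>2\<close> is
  \<open>1 / \<sigma>\<^sup>2\<close>, the quadratic coefficient becomes \<open>1 / 2\<close> and
  the cubic one \<open>- \<phi>\<close>, while the remainder carries n l^4, which is O(1/n). The 6
  is the \<open>fact 3\<close> of the complex Taylor bound.\<close>

lemma taylor:
  assumes "cmod (of_real \<zeta> + of_real l * t) \<le> R1"
  shows "cmod (of_nat n * H (of_real \<zeta> + of_real l * t) - (of_real (real n * h \<zeta>) + t\<^sup>2 / 2 - of_real \<phi> * t ^ 3)) \<le> C / (6 * m\<^sup>2) / real n * cmod t ^ 4"
proof -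
  let ?w = "of_real l * t"
  have \<zeta>R: "\<bar>\<zeta>\<bar> < R2" using \<zeta> Rs by auto
  have "cmod ((deriv ^^ 0) H (of_real \<zeta> + ?w) - (\<Sum>i\<le>3. (deriv ^^ i) H (of_real \<zeta>) * ((of_real \<zeta> + ?w) - of_real \<zeta>) ^ i / fact i))
     \<le> C * cmod ((of_real \<zeta> + ?w) - of_real \<zeta>) ^ Suc 3 / fact 3"
  proof (rule complex_Taylor)
    show "convex (cball (0 :: complex) R1)" by (rule convex_cball)
    fix i x assume x: "x \<in> cball (0 :: complex) R1"
    hence xb: "x \<in> ball 0 R2" using Rs by auto
    show "((deriv ^^ i) H has_field_derivative (deriv ^^ Suc i) H x) (at x within cball 0 R1)"
      unfolding funpow.simps o_def
      by (rule holomorphic_derivI[OF holomorphic_higher_deriv[OF hol open_ball, of i] open_ball xb])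
  next
    fix x assume "x \<in> cball (0 :: complex) R1"
    thus "cmod ((deriv ^^ Suc 3) H x) \<le> C" using H_4[of x] by simp
  qed (use \<zeta> assms in auto)
  hence T: "cmod (H (of_real \<zeta> + ?w) - (\<Sum>i\<le>3. (deriv ^^ i) H (of_real \<zeta>) * ?w ^ i / fact i)) \<le> C * cmod ?w ^ 4 / 6"
    by (simp add: fact_numeral)
  have D: "(deriv ^^ i) H (of_real \<zeta>) = of_real ((deriv ^^ i) h \<zeta>)" for i
    by (rule higher_deriv_real_restriction(1)[OF hol H_real \<zeta>R])
  have sum3: "(\<Sum>i\<le>3. (deriv ^^ i) H (of_real \<zeta>) * ?w ^ i / fact i) =
     of_real (h \<zeta>) + of_real ((deriv ^^ 2) h \<zeta>) * ?w\<^sup>2 / 2 + of_real ((deriv ^^ 3) h \<zeta>) * ?w ^ 3 / 6"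
  proof -
    have "{..3 :: nat} = {0, 1, 2, 3}" by auto
    thus ?thesis unfolding D using \<zeta>(4) by (simp add: fact_numeral)
  qed
  have scale: "of_nat n * (of_real (h \<zeta>) + of_real ((deriv ^^ 2) h \<zeta>) * ?w\<^sup>2 / 2 + of_real ((deriv ^^ 3) h \<zeta>) * ?w ^ 3 / 6) = of_real (real n * h \<zeta>) + of_real ((deriv ^^ 2) h \<zeta> * (real n * l\<^sup>2)) * t\<^sup>2 / 2 + of_real ((deriv ^^ 3) h \<zeta> * l / 6 * (real n * l\<^sup>2)) * t ^ 3"
  proof -
    have "N * (a + b * (L * t)\<^sup>2 / 2 + c * (L * t) ^ 3 / 6) = N * a + b * (N * L\<^sup>2) * t\<^sup>2 / 2 + c * L / 6 * (N * L\<^sup>2) * t ^ 3"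
      for N a b c L :: complex by (simp add: field_simps power2_eq_square power3_eq_cube)
    thus ?thesis by (simp only: of_real_mult of_real_divide of_real_power of_real_numeral of_real_of_nat_eq)
  qed
  have b2: "(deriv ^^ 2) h \<zeta> * (real n * l\<^sup>2) = 1" unfolding l_eqs(2) pos(3)[symmetric] using pos(1) by simp
  have b3: "(deriv ^^ 3) h \<zeta> * l / 6 * (real n * l\<^sup>2) = - \<phi>"
    unfolding l_eqs(2,3) d\<^sub>2_def pos(3)[symmetric] using pos(1) by simp
  have S: "of_nat n * (\<Sum>i\<le>3. (deriv ^^ i) H (of_real \<zeta>) * ?w ^ i / fact i) = of_real (real n * h \<zeta>) + t\<^sup>2 / 2 - of_real \<phi> * t ^ 3"
    unfolding sum3 scale b2 b3 by simp
  have "cmod (of_nat n * H (of_real \<zeta> + ?w) - of_nat n * (\<Sum>i\<le>3. (deriv ^^ i) H (of_real \<zeta>) * ?w ^ i / fact i)) \<le> real n * (C * cmod ?w ^ 4 / 6)"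
    unfolding right_diff_distrib[symmetric]
    by (subst norm_mult, subst norm_of_nat) (rule mult_left_mono[OF T], simp)
  also have "\<dots> = C / 6 * ((real n * l\<^sup>2)\<^sup>2 / real n) * cmod t ^ 4"
    using pos(4,7) by (simp add: norm_mult power_mult_distrib power2_eq_square power4_eq_xxxx)
  also have "(real n * l\<^sup>2)\<^sup>2 / real n \<le> 1 / m\<^sup>2 / real n"
    unfolding l_eqs(2) using \<sigma>_bounds m pos by (intro divide_right_mono) (auto simp: power_divide intro!: divide_left_mono power_mono)
  hence "C / 6 * ((real n * l\<^sup>2)\<^sup>2 / real n) * cmod t ^ 4 \<le> C / 6 * (1 / m\<^sup>2 / real n) * cmod t ^ 4"
    using C_pos by (intro mult_right_mono mult_left_mono) auto
  finally show ?thesis unfolding S by simp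
qed

text \<open>Both sides are exponentials whose exponents have real part at most
  \<open>- (c0 * y\<^sup>2)\<close>, so the quartic difference of the exponents is damped by a
  Gaussian factor. The bound \<open>1 / 8\<close> on \<open>c0\<close> comes from the Gaussian side,
  where the imaginary part is at worst halved; the other two match the two cases of the minimum in
  \<open>norm_psi_n_le\<close>.\<close>

lemma psi_n_near_gauss:
  assumes comp: "gaussian_comparison b\<^sub>1 b\<^sub>2 S \<beta> \<phi> Y s" and y: "\<bar>y\<bar> \<le> Y" and Y: "Y\<^sup>2 \<le> real n" "- \<zeta> + l * Y \<le> R1" and \<phi>Y: "\<bar>\<phi>\<bar> * Y \<le> 1 / 2"
    and c0: "0 < c0" "c0 \<le> 1 / 8" "c0 \<le> \<epsilon>" "c0 \<le> \<epsilon> / (4 * \<delta>\<^sup>2 * C)"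
    and e: "C / (6 * m\<^sup>2) / real n + 8 * \<phi>\<^sup>2 \<le> e"
  shows "cmod (psi M V U \<rho> (of_real l * Complex \<beta> (- y)) ^ n - gaussian_comparison.gauss \<beta> \<phi> (moebius \<phi> (Complex 0 y))) \<le> e * (2 / c0\<^sup>2 + b\<^sub>2 ^ 4)"
proof -
  interpret G: gaussian_comparison b\<^sub>1 b\<^sub>2 S \<beta> \<phi> Y s by (rule comp)
  define t where "t = Complex 0 y"
  have t: "t = \<i> * of_real y" "cmod t = \<bar>y\<bar>" "cmod t ^ 4 = y ^ 4" by (auto simp: t_def complex_eq_iff cmod_def power_even_abs)
  define z where "z = of_real \<zeta> + of_real l * t"
  have zR: "cmod z \<le> R1"
  proof -
    have "cmod z \<le> - \<zeta> + l * \<bar>y\<bar>"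
      using norm_triangle_ineq[of "of_real \<zeta>" "of_real l * t"] \<zeta> pos t by (simp add: z_def norm_mult)
    also have "l * \<bar>y\<bar> \<le> l * Y" using y pos by (intro mult_left_mono) auto
    finally show ?thesis using Y by simp
  qed
  define X where "X = of_nat n * H z"
  have "- z = of_real l * Complex \<beta> (- y)" using l_eqs by (simp add: z_def t_def complex_eq_iff)
  hence "psi M V U \<rho> (of_real l * Complex \<beta> (- y)) = exp (H z)" using exp_H[of z] zR Rs by simp
  hence \<Psi>: "psi M V U \<rho> (of_real l * Complex \<beta> (- y)) ^ n = exp X" by (simp only: X_def exp_of_nat_mult)
  have y2: "y\<^sup>2 \<le> Y\<^sup>2" using y G.Y by (intro abs_le_square_iff[THEN iffD1]) auto
  have "cmod (exp X) \<le> exp (- (c0 * y\<^sup>2))"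
  proof -
    have "c0 * y\<^sup>2 \<le> \<epsilon> * min (real n) (y\<^sup>2 / (4 * \<delta>\<^sup>2 * C))"
    proof -
      \<comment> \<open>Where the decay saturates at a multiple of \<open>n\<close>, the condition
        that \<open>Y\<^sup>2\<close> is at most \<open>n\<close> still yields decay in
        \<open>y\<^sup>2\<close>.\<close>
      have "c0 * y\<^sup>2 \<le> \<epsilon> * real n" using c0 y2 Y sep by (intro mult_mono) auto
      moreover have "c0 * y\<^sup>2 \<le> \<epsilon> / (4 * \<delta>\<^sup>2 * C) * y\<^sup>2" using c0 by (intro mult_right_mono) auto
      ultimately show ?thesis by (simp add: min_def)
    qed
    thus ?thesis using norm_psi_n_le(1)[of y] unfolding \<Psi> by (elim order_trans) simp
  qed
  hence ReX: "Re X \<le> - (c0 * y\<^sup>2)" by simp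
  define Q where "Q = ((moebius \<phi> t)\<^sup>2 - (moebius \<phi> (of_real \<beta>))\<^sup>2) / 2"
  have gQ: "G.gauss (moebius \<phi> t) = exp Q" by (simp add: G.gauss_def Q_def G.moebius_\<beta>)
  have "exp (Re Q) \<le> exp (- (c0 * y\<^sup>2))"
  proof -
    have "\<bar>Re (moebius \<phi> t)\<bar> \<le> b\<^sub>1 / 4" using G.Re_curve[OF y] G.b unfolding t_def by linarith
    hence "cmod (exp Q) \<le> exp (- (Im (moebius \<phi> t))\<^sup>2 / 2)" using G.norm_gauss_le(2) unfolding gQ[symmetric] by blast
    also have "\<dots> \<le> exp (- (c0 * y\<^sup>2))"
    proof -
      have "\<bar>\<phi>\<bar> * \<bar>y\<bar> \<le> \<bar>\<phi>\<bar> * Y" using y by (intro mult_left_mono) auto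
      hence "(\<phi> * y)\<^sup>2 \<le> 1\<^sup>2" using G.Y by (intro abs_le_square_iff[THEN iffD1]) (auto simp: abs_mult)
      hence "\<bar>y\<bar> / 2 \<le> \<bar>y\<bar> / (1 + (\<phi> * y)\<^sup>2)" by (intro divide_left_mono mult_pos_pos) (auto intro: add_pos_nonneg)
      also have "\<dots> = \<bar>Im (moebius \<phi> t)\<bar>" unfolding t_def moebius_imaginary by (simp add: add_nonneg_nonneg)
      finally have "(y / 2)\<^sup>2 \<le> (Im (moebius \<phi> t))\<^sup>2" by (intro abs_le_square_iff[THEN iffD1]) auto
      moreover have "c0 * y\<^sup>2 \<le> 1 / 8 * y\<^sup>2" using c0 by (intro mult_right_mono) auto
      ultimately show ?thesis by (simp add: power_divide)
    qed
    finally show ?thesis by simp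
  qed
  hence ReQ: "Re Q \<le> - (c0 * y\<^sup>2)" by simp
  have s1: "cmod (of_real \<phi> * t) \<le> 1 / 2"
    using mult_left_mono[OF y, of "\<bar>\<phi>\<bar>"] \<phi>Y t by (simp add: norm_mult)
  have s2: "\<bar>\<phi> * \<beta>\<bar> \<le> 1 / 2" using G.small(2) by (simp add: norm_mult abs_mult)
  \<comment> \<open>The point \<open>t = \<beta>\<close> corresponds to the argument 0, where
    \<open>H\<close> vanishes; the expansion there determines
    \<open>real n * h \<zeta>\<close>.\<close>
  have N: "\<bar>real n * h \<zeta> + \<beta>\<^sup>2 / 2 - \<phi> * \<beta> ^ 3\<bar> \<le> C / (6 * m\<^sup>2) / real n * \<beta> ^ 4"
  proof -
    have z0: "of_real \<zeta> + of_real l * complex_of_real \<beta> = 0" using l_eqs(1) by (simp flip: of_real_mult of_real_add)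
    have "cmod (of_nat n * H 0 - (of_real (real n * h \<zeta>) + (of_real \<beta>)\<^sup>2 / 2 - of_real \<phi> * of_real \<beta> ^ 3)) \<le> C / (6 * m\<^sup>2) / real n * cmod (of_real \<beta>) ^ 4"
      using taylor[of "of_real \<beta>", unfolded z0] Rs by simp
    also have "of_nat n * H 0 - (of_real (real n * h \<zeta>) + (of_real \<beta>)\<^sup>2 / 2 - of_real \<phi> * of_real \<beta> ^ 3) = - complex_of_real (real n * h \<zeta> + \<beta>\<^sup>2 / 2 - \<phi> * \<beta> ^ 3)"
      by (simp add: H_0)
    finally show ?thesis unfolding norm_minus_cancel norm_of_real using pos by simp
  qed
  have "0 \<le> C / (6 * m\<^sup>2) / real n + 8 * \<phi>\<^sup>2" using C_pos by (intro add_nonneg_nonneg divide_nonneg_nonneg) auto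
  hence e0: "0 \<le> e" using e by linarith
  note TX = taylor[of t, folded z_def, OF zR, folded X_def]
  have "cmod (X - Q) \<le> (C / (6 * m\<^sup>2) / real n + 8 * \<phi>\<^sup>2) * (cmod t ^ 4 + \<beta> ^ 4)"
    unfolding Q_def by (rule gaussian_exponent_error[OF TX N s1 s2])
  also have "\<dots> \<le> e * (y ^ 4 + b\<^sub>2 ^ 4)"
  proof -
    have "\<beta> ^ 4 \<le> b\<^sub>2 ^ 4" using pos(5) G.b by (intro power_mono) auto
    thus ?thesis unfolding t(3) using e e0 by (intro mult_mono add_mono order_refl) auto
  qed
  finally have XQ: "cmod (X - Q) \<le> e * (y ^ 4 + b\<^sub>2 ^ 4)" .
  \<comment> \<open>The quartic factor is absorbed by the Gaussian damping, at the price of the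
    constant \<open>2 / c0\<^sup>2\<close>.\<close>
  have "(y\<^sup>2) ^ 2 \<le> fact 2 / c0 ^ 2 * exp (c0 * y\<^sup>2)" by (rule power_le_exp) (use c0 in auto)
  hence y4: "exp (- (c0 * y\<^sup>2)) * y ^ 4 \<le> 2 / c0\<^sup>2" by (simp add: exp_minus field_simps)
  have "cmod (exp X - exp Q) \<le> exp (- (c0 * y\<^sup>2)) * cmod (X - Q)" by (rule norm_exp_diff_le) fact+
  also have "\<dots> \<le> exp (- (c0 * y\<^sup>2)) * (e * (y ^ 4 + b\<^sub>2 ^ 4))" using XQ by (intro mult_left_mono) auto
  also have "\<dots> = e * (exp (- (c0 * y\<^sup>2)) * y ^ 4 + exp (- (c0 * y\<^sup>2)) * b\<^sub>2 ^ 4)" by (simp add: algebra_simps)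
  also have "\<dots> \<le> e * (2 / c0\<^sup>2 + 1 * b\<^sub>2 ^ 4)"
    using y4 e0 c0 by (intro mult_left_mono add_mono mult_right_mono) auto
  finally show ?thesis unfolding \<Psi> using gQ by (simp add: t_def)
qed

text \<open>Inside the cutoff the queue is compared with the Gaussian transform, outside it is small
  by itself. The formula for \<open>LM\<close> is assumed on every admissible line because the line
  in use, at \<open>G.a\<close>, depends on \<phi> and \<open>Y\<close>.\<close>

lemma log_transforms_close:
  fixes LW LM :: "complex \<Rightarrow> complex"
  assumes comp: "gaussian_comparison b\<^sub>1 b\<^sub>2 S \<beta> \<phi> Y s" and Y: "Y\<^sup>2 \<le> real n" "- \<zeta> + l * Y \<le> R1" "\<bar>\<phi>\<bar> * Y \<le> 1 / 2"
    and c0: "0 < c0" "c0 \<le> 1 / 8" "c0 \<le> \<epsilon>" "c0 \<le> \<epsilon> / (4 * \<delta>\<^sup>2 * C)"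
    and e: "C / (6 * m\<^sup>2) / real n + 8 * \<phi>\<^sup>2 \<le> e"
    and q: "q < 1" "exp (- b\<^sub>1\<^sup>2 / 4) \<le> q" "exp (- (m * (real n * \<zeta>\<^sup>2) / 2)) \<le> q"
    and E: "e * (2 / c0\<^sup>2 + b\<^sub>2 ^ 4) \<le> E" "exp (- (c0 * Y\<^sup>2)) \<le> E"
    and B: "B = \<beta> / (1 + \<beta> * \<phi>)"
    and R: "R = s / ((1 + complex_of_real (\<beta> * \<phi>)) * (1 + (s + complex_of_real \<beta>) * complex_of_real \<phi>))"
    and LW: "\<And>s. - \<beta> < Re s \<Longrightarrow> (LBINT y. Ln (1 - psi M V U \<rho> (of_real l * Complex \<beta> (- y)) ^ n) *
        cauchy_kernel (s + of_real \<beta>) (of_real \<beta>) (Complex 0 y)) = 2 * pi * LW s"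
    and LM: "\<And>a r. \<bar>a\<bar> < 3 / 4 * B \<Longrightarrow> a < Re r + B \<Longrightarrow>
      (LBINT y. Ln (1 - exp (((Complex a y)\<^sup>2 - of_real (B\<^sup>2)) / 2)) * cauchy_kernel (r + of_real B) (of_real B) (Complex a y)) = 2 * pi * LM r"
  shows "cmod (LW s - LM R) \<le> 1 / (1 - q) * E * (4 * S * ((1 + (S + b\<^sub>1)) / (b\<^sub>1 / 4) + 1)\<^sup>2) * (LBINT y. inverse (1 + y\<^sup>2))"
proof -
  interpret G: gaussian_comparison b\<^sub>1 b\<^sub>2 S \<beta> \<phi> Y s by (rule comp)
  define \<Psi> where "\<Psi> = (\<lambda>y. psi M V U \<rho> (of_real l * Complex \<beta> (- y)) ^ n)"
  show ?thesis unfolding R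
  proof (rule G.pollaczek_integrals_close[where \<Psi> = \<Psi>])
    show "continuous_on UNIV \<Psi>" unfolding \<Psi>_def by (rule continuous_psi_n)
    show "cmod (\<Psi> y) \<le> q" for y using norm_psi_n_le(2)[of y] q(3) unfolding \<Psi>_def by (rule order_trans)
    show "cmod (\<Psi> y - G.gauss (moebius \<phi> (Complex 0 y))) \<le> E" if "\<bar>y\<bar> \<le> Y" for y
      unfolding \<Psi>_def by (rule order_trans[OF psi_n_near_gauss[OF comp that Y c0 e] E(1)])
    show "cmod (\<Psi> y) \<le> E" if "Y < \<bar>y\<bar>" for y
    proof -
      have y2: "Y\<^sup>2 \<le> y\<^sup>2" using that G.Y by (intro abs_le_square_iff[THEN iffD1]) auto
      have "c0 * Y\<^sup>2 \<le> \<epsilon> * real n" using c0 Y sep by (intro mult_mono) auto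
      moreover have "c0 * Y\<^sup>2 \<le> \<epsilon> / (4 * \<delta>\<^sup>2 * C) * y\<^sup>2" using c0 y2 by (intro mult_mono) auto
      ultimately have "c0 * Y\<^sup>2 \<le> \<epsilon> * min (real n) (y\<^sup>2 / (4 * \<delta>\<^sup>2 * C))" by (simp add: min_def)
      hence "exp (- \<epsilon> * min (real n) (y\<^sup>2 / (4 * \<delta>\<^sup>2 * C))) \<le> exp (- (c0 * Y\<^sup>2))" by simp
      thus ?thesis unfolding \<Psi>_def by (rule order_trans[OF norm_psi_n_le(1) order_trans[OF _ E(2)]])
    qed
    have "c0 * Y\<^sup>2 \<le> 1 / 8 * Y\<^sup>2" using c0 by (intro mult_right_mono) auto
    hence "exp (- Y\<^sup>2 / 8) \<le> exp (- (c0 * Y\<^sup>2))" by simp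
    thus "exp (- Y\<^sup>2 / 8) \<le> E" using E(2) by (rule order_trans)
    show "(LBINT y. Ln (1 - \<Psi> y) * cauchy_kernel (s + complex_of_real \<beta>) (of_real \<beta>) (Complex 0 y)) = 2 * pi * LW s"
      unfolding \<Psi>_def using G.s G.b by (intro LW) linarith
    have "\<bar>G.a\<bar> < 3 / 4 * G.B" using G.a_le G.B_bounds G.b by argo
    moreover have "G.a < Re G.R + G.B" using G.separated(4) unfolding G.moebius_p by (simp only: plus_complex.sel Re_complex_of_real)
    ultimately show "(LBINT y. Ln (1 - G.gauss (Complex G.a y)) * cauchy_kernel (G.R + of_real G.B) (of_real G.B) (Complex G.a y)) = 2 * pi * LM G.R"
      unfolding G.gauss_def using LM[of G.a G.R] unfolding B by blast
  qed (use q in auto)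
qed

end

section \<open>Uniformity in n and the conclusion\<close>

theorem theorem4:
  fixes M :: "'a measure"
    and V U :: "'a \<Rightarrow> real"
    and W :: "nat \<Rightarrow> 'a \<Rightarrow> real"
    and \<rho> :: "nat \<Rightarrow> real"
    and \<delta>\<^sub>0 \<delta> \<epsilon> \<beta>\<^sub>1 \<beta>\<^sub>2 :: real
  assumes "prob_space M"
    and "prob_space.indep_var M borel V borel U"
    and "AE \<omega> in M. 0 \<le> V \<omega>" and "AE \<omega> in M. 0 \<le> U \<omega>"
    and "prob_space.expectation M V = 1" and "prob_space.expectation M U = 1"
    and "integrable M (\<lambda>\<omega>. (V \<omega>)\<^sup>2)" and "integrable M (\<lambda>\<omega>. (U \<omega>)\<^sup>2)"
    and "0 < prob_space.variance M V + prob_space.variance M U"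
    and "0 < \<delta>\<^sub>0"
    and "mgf_analytic_near_strip M V \<delta>\<^sub>0" and "mgf_analytic_near_strip M U \<delta>\<^sub>0"
    and "0 < \<delta>" and "0 < \<epsilon>" and "separation M V U \<delta> \<epsilon>"
    and "\<And>n. 1 \<le> n \<Longrightarrow> 0 < \<rho> n \<and> \<rho> n < 1"
    and "0 < \<beta>\<^sub>1" and "\<beta>\<^sub>1 \<le> \<beta>\<^sub>2"
    and "\<And>n. 1 \<le> n \<Longrightarrow> (1 - \<rho> n) * sqrt (real n) \<in> {\<beta>\<^sub>1..\<beta>\<^sub>2}"
    and "\<And>n. 1 \<le> n \<Longrightarrow> steady_state_waiting_time M V U n (\<rho> n) (W n)"
  shows "\<exists>\<delta>\<^sub>1>0. \<forall>\<delta>'. 0 < \<delta>' \<and> \<delta>' \<le> \<delta>\<^sub>1 \<longrightarrow>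
    (let h = (\<lambda>n. log_psi M V U (\<rho> n));
         \<zeta> = (\<lambda>n. saddle_point \<delta>' (h n));
         \<sigma> = (\<lambda>n. sqrt ((deriv ^^ 2) (h n) (\<zeta> n)));
         \<beta> = (\<lambda>n. - \<zeta> n * \<sigma> n * sqrt (real n));
         d\<^sub>2 = (\<lambda>n. - (deriv ^^ 3) (h n) (\<zeta> n) / (6 * (deriv ^^ 2) (h n) (\<zeta> n)));
         \<phi> = (\<lambda>n. d\<^sub>2 n / (\<sigma> n * sqrt (real n)));
         B = (\<lambda>n. \<beta> n / (1 + \<beta> n * \<phi> n));
         R = (\<lambda>n s. s / ((1 + complex_of_real (\<beta> n * \<phi> n)) *
                         (1 + (s + complex_of_real (\<beta> n)) * complex_of_real (\<phi> n))))
     in (\<forall>\<^sub>F n in sequentially. \<exists>!z. is_saddle_point \<delta>' (h n) z) \<and>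
        d\<^sub>2 \<in> O(\<lambda>_. 1) \<and>
        \<phi> \<in> O(\<lambda>n. 1 / sqrt (real n)) \<and>
        (\<forall>S. bounded S \<longrightarrow>
           (\<exists>K n\<^sub>0. \<forall>n\<ge>n\<^sub>0.
              0 < \<sigma> n \<and> 0 < \<beta> n \<and> 0 < B n \<and>
              (\<exists>L\<^sub>W L\<^sub>M.
                 is_log_transform M (\<lambda>\<omega>. sqrt (real n) / \<sigma> n * W n \<omega>) (\<beta> n) L\<^sub>W \<and>
                 is_log_transform (gaussian_steps (B n)) walk_max (B n) L\<^sub>M \<and>
                 (\<forall>s\<in>S. - \<beta> n / 2 \<le> Re s \<longrightarrow>
                    1 + (s + complex_of_real (\<beta> n)) * complex_of_real (\<phi> n) \<noteq> 0 \<and>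
                    - B n < Re (R n s) \<and>
                    cmod (L\<^sub>W s - L\<^sub>M (R n s)) \<le> K / real n)))))"
proof -
  interpret prob_space M by (rule assms(1))
  note sep = assms(15) and \<beta>12 = assms(17,18)
  have measurable_VU [measurable]: "V \<in> borel_measurable M" "U \<in> borel_measurable M"
    using indep_var_rv1[OF assms(2)] indep_var_rv2[OF assms(2)] by auto
  interpret queue_data M V U \<delta>\<^sub>0
  proof unfold_locales
    show "integrable M (\<lambda>\<omega>. exp (z * complex_of_real (V \<omega>)))" if "\<bar>Re z\<bar> \<le> \<delta>\<^sub>0" for z
    proof -
      obtain a b where "\<delta>\<^sub>0 < a" "\<delta>\<^sub>0 < b" "\<forall>z. - a < Re z \<and> Re z < b \<longrightarrow> integrable M (\<lambda>\<omega>. exp (z * complex_of_real (V \<omega>)))"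
        using assms(11) unfolding mgf_analytic_near_strip_def by blast
      moreover from this have "- a < Re z \<and> Re z < b" using that unfolding abs_le_iff by linarith
      ultimately show ?thesis by blast
    qed
    show "integrable M (\<lambda>\<omega>. exp (z * complex_of_real (U \<omega>)))" if "\<bar>Re z\<bar> \<le> \<delta>\<^sub>0" for z
    proof -
      obtain a b where "\<delta>\<^sub>0 < a" "\<delta>\<^sub>0 < b" "\<forall>z. - a < Re z \<and> Re z < b \<longrightarrow> integrable M (\<lambda>\<omega>. exp (z * complex_of_real (U \<omega>)))"
        using assms(12) unfolding mgf_analytic_near_strip_def by blast
      moreover from this have "- a < Re z \<and> Re z < b" using that unfolding abs_le_iff by linarith
      ultimately show ?thesis by blast
    qed
  qed (rule assms(2))
  \<comment> \<open>A nonzero expectation implies integrability, since the Bochner integral of a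
    nonintegrable function is 0.\<close>
  have "integrable M V" "integrable M U"
    using assms(5,6) not_integrable_integral_eq[of M V] not_integrable_integral_eq[of M U] by (metis zero_neq_one)+
  define K\<^sub>1 where "K\<^sub>1 = (\<lambda>z. Ln (mgf_V z))"
  define K\<^sub>2 where "K\<^sub>2 = (\<lambda>z. Ln (mgf_U z))"
  obtain RV where RV: "0 < RV" "RV \<le> \<delta>\<^sub>0" "K\<^sub>1 holomorphic_on ball 0 RV" "\<forall>z\<in>ball 0 RV. exp (K\<^sub>1 z) = mgf_V z"
    "\<forall>x. \<bar>x\<bar> < RV \<longrightarrow> K\<^sub>1 (of_real x) \<in> \<real>" "deriv K\<^sub>1 0 = of_real (expectation V)" "(deriv ^^ 2) K\<^sub>1 0 = of_real (variance V)"
    by (rule cumulant_generating_function[OF measurable_VU(1) assms(10) V_exp \<open>integrable M V\<close> assms(7)], assumption)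
      (rule that, assumption, simp_all only: K\<^sub>1_def mgf_V_def)
  obtain RU where RU: "0 < RU" "RU \<le> \<delta>\<^sub>0" "K\<^sub>2 holomorphic_on ball 0 RU" "\<forall>z\<in>ball 0 RU. exp (K\<^sub>2 z) = mgf_U z"
    "\<forall>x. \<bar>x\<bar> < RU \<longrightarrow> K\<^sub>2 (of_real x) \<in> \<real>" "deriv K\<^sub>2 0 = of_real (expectation U)" "(deriv ^^ 2) K\<^sub>2 0 = of_real (variance U)"
    by (rule cumulant_generating_function[OF measurable_VU(2) assms(10) U_exp \<open>integrable M U\<close> assms(8)], assumption)
      (rule that, assumption, simp_all only: K\<^sub>2_def mgf_U_def)
  define R where "R = min RV RU"
  have Rb: "0 < R" "R \<le> RV" "R \<le> RU" "R \<le> \<delta>\<^sub>0" using RV(1,2) RU(1,2) by (auto simp: R_def)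
  interpret cumulant_pair K\<^sub>1 K\<^sub>2 R "variance V" "variance U"
  proof unfold_locales
    show "K\<^sub>1 holomorphic_on ball 0 R" "K\<^sub>2 holomorphic_on ball 0 R"
      using Rb by (auto intro: holomorphic_on_subset[OF RV(3)] holomorphic_on_subset[OF RU(3)])
    show "K\<^sub>1 0 = 0" "K\<^sub>2 0 = 0" by (simp_all add: K\<^sub>1_def K\<^sub>2_def mgf_V_def mgf_U_def prob_space)
  qed (use Rb RV RU assms(5,6,9) variance_positive in auto)
  obtain R1 m C where R1: "0 < R1" "R1 < 3 / 4 * R" and m: "0 < m" and C: "0 < C"
    and bound: "\<And>q z k. 1 \<le> q \<Longrightarrow> q \<le> 4 / 3 \<Longrightarrow> cmod z \<le> R1 \<Longrightarrow> k \<le> 4 \<Longrightarrow> cmod ((deriv ^^ k) (H q) z) \<le> C"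
    and convex: "\<And>q z. 1 \<le> q \<Longrightarrow> q \<le> 4 / 3 \<Longrightarrow> cmod z \<le> R1 \<Longrightarrow> m \<le> Re ((deriv ^^ 2) (H q) z)"
    using uniform_bounds by metis
  \<comment> \<open>The witness for \<open>\<delta>\<^sub>1\<close> is \<open>R1\<close>, the radius
    on which convexity is uniform in n.\<close>
  have main: "\<exists>\<delta>\<^sub>1>0. \<forall>\<delta>'. 0 < \<delta>' \<and> \<delta>' \<le> \<delta>\<^sub>1 \<longrightarrow> Q \<delta>'" if "\<And>\<delta>'. 0 < \<delta>' \<Longrightarrow> \<delta>' \<le> R1 \<Longrightarrow> Q \<delta>'" for Q
    using that R1(1) by blast
  show ?thesis
  proof (rule main)
    fix \<delta>' assume \<delta>': "0 < \<delta>'" "\<delta>' \<le> R1"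
    define h where "h = (\<lambda>n. log_psi M V U (\<rho> n))"
    define \<zeta> where "\<zeta> = (\<lambda>n. saddle_point \<delta>' (h n))"
    define \<sigma> where "\<sigma> = (\<lambda>n. sqrt ((deriv ^^ 2) (h n) (\<zeta> n)))"
    define \<beta> where "\<beta> = (\<lambda>n. - \<zeta> n * \<sigma> n * sqrt (real n))"
    define d\<^sub>2 where "d\<^sub>2 = (\<lambda>n. - (deriv ^^ 3) (h n) (\<zeta> n) / (6 * (deriv ^^ 2) (h n) (\<zeta> n)))"
    define \<phi> where "\<phi> = (\<lambda>n. d\<^sub>2 n / (\<sigma> n * sqrt (real n)))"
    define B where "B = (\<lambda>n. \<beta> n / (1 + \<beta> n * \<phi> n))"
    define Rn where "Rn = (\<lambda>n s. s / ((1 + complex_of_real (\<beta> n * \<phi> n)) *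
                         (1 + (s + complex_of_real (\<beta> n)) * complex_of_real (\<phi> n))))"
    \<comment> \<open>All small quantities become powers of \<open>t n\<close>: 1 / sqrt n is its
      fourth power, 1 / n its eighth, and the cutoff is its inverse. Every condition "for n large"
      takes the form \<open>K * t n < c\<close>.\<close>
    define t where "t = (\<lambda>n. 1 / real n powr (1 / 8))"
    have "t \<longlonglongrightarrow> 0" unfolding t_def by real_asymp
    hence ev: "\<forall>\<^sub>F n in sequentially. K * t n < c" if "0 < c" for K c
      using that by (intro order_tendstoD(2)[OF tendsto_mult_right_zero]) auto
    have t: "0 < t n" "t n \<le> 1" "1 / sqrt (real n) = t n ^ 4" "1 / real n = t n ^ 8" if "1 \<le> n" for n
    proof -
      show "0 < t n" using that by (simp add: t_def)
      have "1 \<le> real n powr (1 / 8)" using that by (intro ge_one_powr_ge_zero) auto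
      thus "t n \<le> 1" unfolding t_def using that by (subst divide_le_eq_1_pos) auto
      have p: "(real n powr (1 / 8)) ^ k = real n powr (real k / 8)" for k
        using that by (simp add: powr_realpow[symmetric] powr_powr)
      show "1 / sqrt (real n) = t n ^ 4" "1 / real n = t n ^ 8"
        using that by (simp_all add: t_def power_divide p powr_half_sqrt)
    qed
    \<comment> \<open>The three inequalities yield, in this order, \<rho> at least 3/4, a slope at 0
      small enough for a saddle point in the interval of length \<open>\<delta>'\<close>, and a
      saddle point within the range of assumption (A).\<close>
    define good where "good = (\<lambda>n. 1 \<le> n \<and> \<beta>\<^sub>2 * t n < 1 / 4 \<and> 4 / 3 * \<beta>\<^sub>2 * t n < m * \<delta>' \<and> 4 / 3 * \<beta>\<^sub>2 / m * t n < \<delta>)"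
    have ev_good: "\<forall>\<^sub>F n in sequentially. good n"
      unfolding good_def using m \<delta>' assms(13) by (intro eventually_conj eventually_ge_at_top ev) auto
    have G: "(\<forall>z. is_saddle_point \<delta>' (h n) z \<longleftrightarrow> z = \<zeta> n) \<and> \<beta>\<^sub>1 / C / sqrt (real n) \<le> - \<zeta> n \<and> - \<zeta> n \<le> 4 / 3 * \<beta>\<^sub>2 / m / sqrt (real n) \<and>
        saddle_queue M V U \<delta>\<^sub>0 \<delta> \<epsilon> (\<rho> n) R1 (3 / 4 * R) m C (\<zeta> n) (H (1 / \<rho> n)) (h n) n (W n)" if good: "good n" for n
    proof -
      have n: "1 \<le> n" using good by (simp add: good_def)
      note tn = t[OF n]
      have t4: "t n ^ 4 \<le> t n" using tn power_decreasing[of 1 4 "t n"] by simp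
      have sq: "0 < sqrt (real n)" using n by simp
      have rho: "0 < \<rho> n" "\<rho> n < 1" "\<beta>\<^sub>1 / sqrt (real n) \<le> 1 - \<rho> n" "1 - \<rho> n \<le> \<beta>\<^sub>2 / sqrt (real n)"
        using assms(16,19)[OF n] sq by (auto simp: field_simps)
      have sq_t: "x / sqrt (real n) \<le> x * t n" if "0 \<le> x" for x
        using mult_left_mono[OF t4 that] unfolding tn(3)[symmetric] by simp
      have b2: "0 \<le> \<beta>\<^sub>2" using \<beta>12 by simp
      have rho34: "3 / 4 \<le> \<rho> n" using rho(4) sq_t[OF b2] good unfolding good_def by linarith
      define q where "q = 1 / \<rho> n"
      have q: "1 \<le> q" "q \<le> 4 / 3" using rho rho34 by (auto simp: q_def field_simps)
      have d: "\<beta>\<^sub>1 / sqrt (real n) \<le> q - 1" "q - 1 \<le> 4 / 3 * \<beta>\<^sub>2 / sqrt (real n)" "0 < q - 1"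
      proof -
        have e: "q - 1 = (1 - \<rho> n) * q" using rho by (simp add: q_def field_simps)
        have "(1 - \<rho> n) * 1 \<le> (1 - \<rho> n) * q" "(1 - \<rho> n) * q \<le> (1 - \<rho> n) * (4 / 3)"
          using q rho by (intro mult_left_mono; simp)+
        thus "\<beta>\<^sub>1 / sqrt (real n) \<le> q - 1" "q - 1 \<le> 4 / 3 * \<beta>\<^sub>2 / sqrt (real n)"
          using rho(3,4) unfolding e by argo+
        show "0 < q - 1" using rho by (simp add: q_def field_simps)
      qed
      have dom: "3 / 4 * R \<le> \<rho> n * \<delta>\<^sub>0" using mult_mono[OF rho34 Rb(4)] rho Rb by simp
      have exp_H: "exp (H q z) = psi M V U (\<rho> n) (- z)" if z: "z \<in> ball 0 (3 / 4 * R)" for z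
      proof -
        have zR: "cmod z < 3 / 4 * R" using z by simp
        have "\<bar>Re (- z)\<bar> \<le> \<rho> n * \<delta>\<^sub>0" using zR dom abs_Re_le_cmod[of z] by simp
        moreover have "\<bar>Re (- z)\<bar> \<le> \<delta>\<^sub>0" using zR Rb abs_Re_le_cmod[of z] by simp
        ultimately have p: "psi M V U (\<rho> n) (- z) = mgf_V (- z) * mgf_U (- (- z) / of_real (\<rho> n))"
          using rho by (intro psi_eq)
        have "of_real q * z \<in> ball 0 RU" using scaled_in_ball[OF q z] Rb by simp
        moreover have "- z \<in> ball 0 RV" using zR Rb by simp
        ultimately have "exp (H q z) = mgf_V (- z) * mgf_U (of_real q * z)"
          by (simp only: H_def exp_add RV(4)[rule_format] RU(4)[rule_format])
        thus ?thesis unfolding p by (simp add: q_def)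
      qed
      have H_real: "H q (of_real x) = of_real (h n x)" if x: "\<bar>x\<bar> < 3 / 4 * R" for x
      proof -
        have xb: "complex_of_real x \<in> ball 0 (3 / 4 * R)" using x by simp
        have "\<bar>- x\<bar> < RV" using x Rb by simp
        moreover have "\<bar>q * x\<bar> < RU" using scaled_in_ball[OF q xb] Rb by (simp add: norm_mult abs_mult)
        ultimately have "K\<^sub>1 (of_real (- x)) \<in> \<real>" "K\<^sub>2 (of_real (q * x)) \<in> \<real>" using RV(5) RU(5) by blast+
        hence "H q (of_real x) \<in> \<real>" by (simp add: H_def)
        then obtain y where y: "H q (of_real x) = of_real y" by (rule Reals_cases)
        have "psi M V U (\<rho> n) (of_real (- x)) = of_real (exp y)"
          using exp_H[OF xb] unfolding y by (simp add: exp_of_real)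
        hence "h n x = y" by (simp add: h_def log_psi_def)
        thus ?thesis using y by simp
      qed
      have D: "(deriv ^^ k) (H q) (of_real x) = of_real ((deriv ^^ k) (h n) x)"
        "((deriv ^^ k) (h n) has_real_derivative (deriv ^^ Suc k) (h n) x) (at x)" if "\<bar>x\<bar> < 3 / 4 * R" for k x
        using higher_deriv_real_restriction[OF holomorphic_H[OF q] H_real that] by blast+
      have in_R: "\<bar>x\<bar> < 3 / 4 * R" if "\<bar>x\<bar> \<le> R1" for x using that R1 by linarith
      have habs: "\<bar>(deriv ^^ k) (h n) x\<bar> \<le> C" if "\<bar>x\<bar> \<le> R1" "k \<le> 4" for x k
        using bound[OF q _ that(2), of "of_real x"] that(1) unfolding D(1)[OF in_R[OF that(1)]] by simp
      have h2: "m \<le> (deriv ^^ 2) (h n) x \<and> (deriv ^^ 2) (h n) x \<le> C" if "\<bar>x\<bar> \<le> R1" for x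
        using convex[OF q, of "of_real x"] habs[OF that, of 2] that unfolding D(1)[OF in_R[OF that]] by auto
      have h0: "h n 0 = 0" using H_real[of 0] Rb H_0[of q] by simp
      have hd: "deriv (h n) 0 = q - 1"
      proof -
        have "complex_of_real (deriv (h n) 0) = of_real (q - 1)"
          using D(1)[of 0 1] deriv_H_0[OF q] Rb by simp
        thus ?thesis by (simp only: of_real_eq_iff)
      qed
      have dm: "q - 1 < m * \<delta>'" using d(2) sq_t[of "4 / 3 * \<beta>\<^sub>2"] b2 good unfolding good_def by simp
      obtain z where z: "\<And>x. is_saddle_point \<delta>' (h n) x \<longleftrightarrow> x = z" "saddle_point \<delta>' (h n) = z" "- \<delta>' < z" "z < 0"
        "(q - 1) / C \<le> - z" "- z \<le> (q - 1) / m" "deriv (h n) z = 0" "h n z \<le> - (m * z\<^sup>2 / 2)"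
      proof (rule saddle_point_exists[of R1 "h n" m C "q - 1" \<delta>', OF D(2)[OF in_R] h2 h0 hd d(3) dm \<delta>' m])
        fix z assume a: "\<And>x. is_saddle_point \<delta>' (h n) x \<longleftrightarrow> x = z"
          and b: "saddle_point \<delta>' (h n) = z" "- \<delta>' < z" "z < 0" "(q - 1) / C \<le> - z" "- z \<le> (q - 1) / m"
            "deriv (h n) z = 0" "h n z \<le> - (m * z\<^sup>2 / 2)"
        show thesis by (rule that[OF a b])
      qed
      have zz: "z = \<zeta> n" using z(2) by (simp add: \<zeta>_def)
      have lower: "\<beta>\<^sub>1 / C / sqrt (real n) \<le> - z"
        using divide_right_mono[OF d(1), of C] C z(5) by (simp add: divide_divide_eq_left mult.commute)
      have upper: "- z \<le> 4 / 3 * \<beta>\<^sub>2 / m / sqrt (real n)"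
      proof -
        have "- z \<le> 4 / 3 * \<beta>\<^sub>2 / sqrt (real n) / m"
          by (rule order_trans[OF z(6) divide_right_mono[OF d(2)]]) (use m in simp)
        moreover have "x / y / w = x / w / y" for x y w :: real by (simp add: mult.commute)
        ultimately show ?thesis by metis
      qed
      have zR1: "\<bar>z\<bar> \<le> R1" using z(3,4) \<delta>' by (simp add: abs_le_iff)
      have "saddle_queue M V U \<delta>\<^sub>0 \<delta> \<epsilon> (\<rho> n) R1 (3 / 4 * R) m C z (H q) (h n) n (W n)"
      proof unfold_locales
        show "- z \<le> \<delta>"
          using upper sq_t[of "4 / 3 * \<beta>\<^sub>2 / m"] b2 m good unfolding good_def by simp
        show "cmod ((deriv ^^ 4) (H q) w) \<le> C" if "cmod w \<le> R1" for w using bound[OF q that, of 4] by simp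
        show "H q holomorphic_on ball 0 (3 / 4 * R)" by (rule holomorphic_H[OF q])
        show "steady_state_waiting_time M V U n (\<rho> n) (W n)" using assms(20)[OF n] .
        show "m \<le> (deriv ^^ 2) (h n) z" "(deriv ^^ 2) (h n) z \<le> C" using h2[OF zR1] by auto
        show "\<bar>(deriv ^^ 3) (h n) z\<bar> \<le> C" using habs[OF zR1, of 3] by simp
        show "- R1 < z" using z(3) \<delta>' by linarith
        show "H q 0 = 0" by (rule H_0)
      qed (use sep assms(13,14) rho rho34 n R1 dom exp_H H_real z m in \<open>auto\<close>)
      thus ?thesis using z(1) lower upper unfolding zz q_def by blast
    qed
    \<comment> \<open>\<beta> is the product of \<sigma>, which lies between \<open>sqrt m\<close>
      and \<open>sqrt C\<close>, and of - \<zeta> sqrt n, which lies between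
      \<open>\<beta>\<^sub>1 / C\<close> and \<open>4 / 3 * \<beta>\<^sub>2 / m\<close>.\<close>
    define b\<^sub>1 where "b\<^sub>1 = sqrt m * (\<beta>\<^sub>1 / C)"
    define b\<^sub>2 where "b\<^sub>2 = sqrt C * (4 / 3 * \<beta>\<^sub>2 / m)"
    define C\<phi> where "C\<phi> = C / (6 * m) / sqrt m"
    have b1: "0 < b\<^sub>1" using m C \<beta>12 by (simp add: b\<^sub>1_def)
    have C\<phi>: "0 < C\<phi>" using m C by (simp add: C\<phi>_def)
    have good_bounds: "0 < \<sigma> n \<and> 0 < \<beta> n \<and> b\<^sub>1 \<le> \<beta> n \<and> \<beta> n \<le> b\<^sub>2 \<and> \<bar>d\<^sub>2 n\<bar> \<le> C / (6 * m) \<and> \<bar>\<phi> n\<bar> \<le> C\<phi> / sqrt (real n) \<and> sqrt m \<le> \<sigma> n"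
      if "good n" for n
    proof -
      note Gn = G[OF that]
      interpret Q: saddle_queue M V U \<delta>\<^sub>0 \<delta> \<epsilon> "\<rho> n" R1 "3 / 4 * R" m C "\<zeta> n" "H (1 / \<rho> n)" "h n" n "W n" using Gn by blast
      have e: "Q.\<sigma> = \<sigma> n" "Q.\<beta> = \<beta> n" "Q.d\<^sub>2 = d\<^sub>2 n" "Q.\<phi> = \<phi> n"
        by (simp_all add: Q.\<sigma>_def Q.\<beta>_def Q.d\<^sub>2_def Q.\<phi>_def \<sigma>_def \<beta>_def d\<^sub>2_def \<phi>_def)
      have s: "sqrt m \<le> \<sigma> n" "\<sigma> n \<le> sqrt C" "0 < \<sigma> n" using Q.\<sigma>_bounds Q.pos unfolding e by auto
      have z: "\<beta>\<^sub>1 / C \<le> - \<zeta> n * sqrt (real n)" "- \<zeta> n * sqrt (real n) \<le> 4 / 3 * \<beta>\<^sub>2 / m"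
      proof -
        have g: "\<beta>\<^sub>1 / C / sqrt (real n) \<le> - \<zeta> n" "- \<zeta> n \<le> 4 / 3 * \<beta>\<^sub>2 / m / sqrt (real n)" using Gn by blast+
        show "\<beta>\<^sub>1 / C \<le> - \<zeta> n * sqrt (real n)" using g(1) unfolding pos_divide_le_eq[OF Q.pos(2)] .
        show "- \<zeta> n * sqrt (real n) \<le> 4 / 3 * \<beta>\<^sub>2 / m" using g(2) unfolding pos_le_divide_eq[OF Q.pos(2)] .
      qed
      have zn: "0 \<le> - \<zeta> n * sqrt (real n)" by (rule order_trans[OF _ z(1)]) (use C \<beta>12 in simp)
      have \<beta>e: "\<beta> n = \<sigma> n * (- \<zeta> n * sqrt (real n))" by (simp add: \<beta>_def)
      have "b\<^sub>1 \<le> \<beta> n" unfolding b\<^sub>1_def \<beta>e using s z m C \<beta>12 by (intro mult_mono) auto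
      moreover have "\<beta> n \<le> b\<^sub>2" unfolding b\<^sub>2_def \<beta>e by (intro mult_mono s z zn) (use C in simp)
      ultimately show ?thesis using Q.abs_d2_le Q.abs_\<phi>_le Q.pos(5) s unfolding e C\<phi>_def by blast
    qed
    have part1: "\<forall>\<^sub>F n in sequentially. \<exists>!z. is_saddle_point \<delta>' (h n) z"
    proof (rule eventually_mono[OF ev_good])
      fix n assume "good n"
      hence "is_saddle_point \<delta>' (h n) z \<longleftrightarrow> z = \<zeta> n" for z using G by blast
      thus "\<exists>!z. is_saddle_point \<delta>' (h n) z" by simp
    qed
    have part2: "d\<^sub>2 \<in> O(\<lambda>_. 1)"
      by (rule bigoI[where c = "C / (6 * m)"]) (use ev_good good_bounds in \<open>auto elim!: eventually_mono\<close>)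
    have part3: "\<phi> \<in> O(\<lambda>n. 1 / sqrt (real n))"
      by (rule bigoI[where c = C\<phi>]) (use ev_good good_bounds in \<open>auto elim!: eventually_mono\<close>)
    have part4: "\<exists>K n\<^sub>0. \<forall>n\<ge>n\<^sub>0. 0 < \<sigma> n \<and> 0 < \<beta> n \<and> 0 < B n \<and>
              (\<exists>L\<^sub>W L\<^sub>M.
                 is_log_transform M (\<lambda>\<omega>. sqrt (real n) / \<sigma> n * W n \<omega>) (\<beta> n) L\<^sub>W \<and>
                 is_log_transform (gaussian_steps (B n)) walk_max (B n) L\<^sub>M \<and>
                 (\<forall>s\<in>S. - \<beta> n / 2 \<le> Re s \<longrightarrow>
                    1 + (s + complex_of_real (\<beta> n)) * complex_of_real (\<phi> n) \<noteq> 0 \<and>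
                    - B n < Re (Rn n s) \<and>
                    cmod (L\<^sub>W s - L\<^sub>M (Rn n s)) \<le> K / real n))" if "bounded S" for S
    proof -
      obtain S0 where S0: "0 < S0" "\<And>s. s \<in> S \<Longrightarrow> cmod s \<le> S0" using \<open>bounded S\<close> unfolding bounded_pos by blast
      have b12: "0 \<le> b\<^sub>2" using C m \<beta>12 by (simp add: b\<^sub>2_def)
      define c0 where "c0 = min (1 / 8) (min \<epsilon> (\<epsilon> / (4 * \<delta>\<^sup>2 * C)))"
      have c0: "0 < c0" "c0 \<le> 1 / 8" "c0 \<le> \<epsilon>" "c0 \<le> \<epsilon> / (4 * \<delta>\<^sup>2 * C)"
        using assms(13,14) C unfolding c0_def by (auto intro: min.coboundedI1 min.coboundedI2)
      \<comment> \<open>The first entry bounds the Gaussian transform, the second that of the queue,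
        for which \<open>real n * (\<zeta> n)\<^sup>2\<close> is at least
        \<open>(\<beta>\<^sub>1 / C)\<^sup>2\<close>.\<close>
      define q where "q = max (exp (- b\<^sub>1\<^sup>2 / 4)) (exp (- (m * (\<beta>\<^sub>1 / C)\<^sup>2 / 2)))"
      have q: "q < 1" using b1 m C \<beta>12 by (simp add: q_def)
      define e0 where "e0 = C / (6 * m\<^sup>2) + 8 * C\<phi>\<^sup>2"
      \<comment> \<open>The first summand covers the middle part; \<open>24 / c0 ^ 4\<close> covers
        the tails, with 24 = 4! because \<open>n\<close> is the fourth power of the squared
        cutoff.\<close>
      define E0 where "E0 = e0 * (2 / c0\<^sup>2 + b\<^sub>2 ^ 4) + 24 / c0 ^ 4"
      have e0: "0 \<le> e0" using C by (simp add: e0_def)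
      define K where "K = 1 / (1 - q) * E0 * (4 * S0 * ((1 + (S0 + b\<^sub>1)) / (b\<^sub>1 / 4) + 1)\<^sup>2) * (LBINT y. inverse (1 + y\<^sup>2))"
      have "\<forall>\<^sub>F n in sequentially. good n \<and> C\<phi> * (S0 + b\<^sub>2) * t n < 1 / 2 \<and> 2 * C\<phi> * (S0 + b\<^sub>2)\<^sup>2 * t n < b\<^sub>1 / 8 \<and>
          C\<phi> * t n < b\<^sub>1 / 8 \<and> C\<phi> * t n < 1 / 2 \<and> (4 / 3 * \<beta>\<^sub>2 / m + 1 / sqrt m) * t n < R1"
        using b1 R1 by (intro eventually_conj ev ev_good) auto
      then obtain n0 where n0: "\<And>n. n0 \<le> n \<Longrightarrow> good n \<and> C\<phi> * (S0 + b\<^sub>2) * t n < 1 / 2 \<and> 2 * C\<phi> * (S0 + b\<^sub>2)\<^sup>2 * t n < b\<^sub>1 / 8 \<and>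
          C\<phi> * t n < b\<^sub>1 / 8 \<and> C\<phi> * t n < 1 / 2 \<and> (4 / 3 * \<beta>\<^sub>2 / m + 1 / sqrt m) * t n < R1"
        unfolding eventually_sequentially by blast
      show ?thesis
      proof (intro exI[of _ K] exI[of _ n0] allI impI)
        fix n assume "n0 \<le> n"
        note nn = n0[OF this]
        hence gn: "good n" by blast
        have n: "1 \<le> n" using gn by (simp add: good_def)
        note tn = t[OF n]
        note gb = good_bounds[OF gn]
        have Gn: "\<beta>\<^sub>1 / C / sqrt (real n) \<le> - \<zeta> n" "- \<zeta> n \<le> 4 / 3 * \<beta>\<^sub>2 / m / sqrt (real n)" using G[OF gn] by blast+
        interpret Q: saddle_queue M V U \<delta>\<^sub>0 \<delta> \<epsilon> "\<rho> n" R1 "3 / 4 * R" m C "\<zeta> n" "H (1 / \<rho> n)" "h n" n "W n" using G[OF gn] by blast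
        have qe: "Q.\<sigma> = \<sigma> n" "Q.\<beta> = \<beta> n" "Q.\<phi> = \<phi> n"
          by (simp_all add: Q.\<sigma>_def Q.\<beta>_def Q.d\<^sub>2_def Q.\<phi>_def \<sigma>_def \<beta>_def d\<^sub>2_def \<phi>_def)
        define Y where "Y = 1 / t n"
        have Y: "0 < Y" "1 \<le> Y" using tn by (auto simp: Y_def)
        have tp: "t n ^ j \<le> t n ^ i" if "i \<le> j" for i j using that tn by (intro power_decreasing) auto
        have \<phi>t: "\<bar>\<phi> n\<bar> \<le> C\<phi> * t n ^ 4" using gb tn(3) by (metis divide_inverse inverse_eq_divide)
        \<comment> \<open>\<phi> is of order \<open>t n ^ 4\<close>, so up to three factors
          \<open>Y\<close> leave at least one factor \<open>t n\<close>.\<close>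
        have \<phi>Y: "\<bar>\<phi> n\<bar> * Y ^ k \<le> C\<phi> * t n" if "k \<le> 3" for k
        proof -
          have "\<bar>\<phi> n\<bar> * Y ^ k \<le> C\<phi> * t n ^ 4 * Y ^ k" using \<phi>t Y by (intro mult_right_mono) auto
          also have "t n ^ 4 = t n ^ (4 - k) * t n ^ k" using that by (simp add: power_add[symmetric])
          also have "C\<phi> * (t n ^ (4 - k) * t n ^ k) * Y ^ k = C\<phi> * t n ^ (4 - k)"
            using tn(1) by (simp add: Y_def power_divide)
          also have "\<dots> \<le> C\<phi> * t n ^ 1" using that C\<phi> by (intro mult_left_mono tp) auto
          finally show ?thesis by simp
        qed
        have comp: "gaussian_comparison b\<^sub>1 b\<^sub>2 S0 (\<beta> n) (\<phi> n) Y s" if s: "cmod s \<le> S0" "- \<beta> n / 2 \<le> Re s" for s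
        proof
          have p: "\<bar>\<phi> n\<bar> \<le> C\<phi> * t n" using \<phi>Y[of 0] by simp
          show "\<bar>\<phi> n\<bar> * (S0 + b\<^sub>2) \<le> 1 / 2"
          proof -
            have "\<bar>\<phi> n\<bar> * (S0 + b\<^sub>2) \<le> C\<phi> * t n * (S0 + b\<^sub>2)" using S0(1) b12 by (intro mult_right_mono p) simp
            also have "\<dots> = C\<phi> * (S0 + b\<^sub>2) * t n" by (simp only: mult_ac)
            finally show ?thesis using nn by linarith
          qed
          show "2 * \<bar>\<phi> n\<bar> * (S0 + b\<^sub>2)\<^sup>2 \<le> b\<^sub>1 / 8"
            using mult_right_mono[OF p, of "2 * (S0 + b\<^sub>2)\<^sup>2"] nn by (simp add: mult_ac)
          show "\<bar>\<phi> n\<bar> * Y\<^sup>2 \<le> b\<^sub>1 / 8" using \<phi>Y[of 2] nn by simp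
          show "\<bar>\<phi> n\<bar> * Y \<le> 1" using \<phi>Y[of 1] nn by simp
        qed (use b1 gb s Y in auto)
        have nY: "real n = Y ^ 8" using tn(4) n tn(1) by (simp add: Y_def power_divide field_simps)
        have Y2n: "Y\<^sup>2 \<le> real n" unfolding nY using Y by (intro power_increasing) auto
        have lY: "- \<zeta> n + Q.l * Y \<le> R1"
        proof -
          have "- \<zeta> n \<le> 4 / 3 * \<beta>\<^sub>2 / m * t n ^ 4" using Gn(2) tn(3) by (metis divide_inverse inverse_eq_divide)
          also have "\<dots> \<le> 4 / 3 * \<beta>\<^sub>2 / m * t n ^ 1" using m \<beta>12 by (intro mult_left_mono tp) auto
          finally have 1: "- \<zeta> n \<le> 4 / 3 * \<beta>\<^sub>2 / m * t n" by simp
          have "Q.l = 1 / \<sigma> n * t n ^ 4" unfolding Q.l_def qe tn(3)[symmetric] by simp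
          also have "\<dots> \<le> 1 / sqrt m * t n ^ 4" using gb m tn by (intro mult_right_mono divide_left_mono mult_pos_pos) auto
          finally have "Q.l * Y \<le> 1 / sqrt m * t n ^ 4 * Y" using Y by (intro mult_right_mono) auto
          also have "\<dots> = 1 / sqrt m * t n ^ 3" using tn(1) by (simp add: Y_def power4_eq_xxxx power3_eq_cube)
          also have "\<dots> \<le> 1 / sqrt m * t n ^ 1" using m by (intro mult_left_mono tp) auto
          finally have 2: "Q.l * Y \<le> 1 / sqrt m * t n" by simp
          have "(4 / 3 * \<beta>\<^sub>2 / m + 1 / sqrt m) * t n < R1" using nn by blast
          thus ?thesis using 1 2 unfolding distrib_right by linarith
        qed
        have \<phi>half: "\<bar>\<phi> n\<bar> * Y \<le> 1 / 2" using \<phi>Y[of 1] nn by simp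
        have \<phi>sq: "(\<phi> n)\<^sup>2 \<le> C\<phi>\<^sup>2 / real n"
        proof -
          have "\<bar>\<phi> n\<bar>\<^sup>2 \<le> (C\<phi> / sqrt (real n))\<^sup>2" using gb by (intro power_mono) auto
          thus ?thesis by (simp add: power_divide)
        qed
        have e': "C / (6 * m\<^sup>2) / real n + 8 * (\<phi> n)\<^sup>2 \<le> e0 / real n"
          using \<phi>sq by (simp add: e0_def add_divide_distrib)
        have exp_small: "exp (- (c0 * Y\<^sup>2)) \<le> 24 / c0 ^ 4 / real n"
        proof -
          have "(Y\<^sup>2) ^ 4 \<le> fact 4 / c0 ^ 4 * exp (c0 * Y\<^sup>2)" by (rule power_le_exp) (use c0 in auto)
          moreover have "(Y\<^sup>2) ^ 4 = real n" unfolding nY by (simp add: power_mult[symmetric])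
          moreover have "fact 4 = (24 :: real)" by (simp add: fact_numeral)
          ultimately have "real n \<le> 24 / c0 ^ 4 * exp (c0 * Y\<^sup>2)" by simp
          thus ?thesis using n c0 by (simp add: exp_minus field_simps)
        qed
        have E: "e0 / real n * (2 / c0\<^sup>2 + b\<^sub>2 ^ 4) \<le> E0 / real n" "exp (- (c0 * Y\<^sup>2)) \<le> E0 / real n"
        proof -
          have x: "E0 / real n = e0 / real n * (2 / c0\<^sup>2 + b\<^sub>2 ^ 4) + 24 / c0 ^ 4 / real n"
            by (simp add: E0_def add_divide_distrib)
          have "0 \<le> 24 / c0 ^ 4 / real n" "0 \<le> e0 / real n * (2 / c0\<^sup>2 + b\<^sub>2 ^ 4)" using c0 e0 by auto
          thus "e0 / real n * (2 / c0\<^sup>2 + b\<^sub>2 ^ 4) \<le> E0 / real n" "exp (- (c0 * Y\<^sup>2)) \<le> E0 / real n"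
            unfolding x using exp_small by linarith+
        qed
        have q3: "exp (- (m * (real n * (\<zeta> n)\<^sup>2) / 2)) \<le> q"
        proof -
          have "(\<beta>\<^sub>1 / C / sqrt (real n))\<^sup>2 \<le> (- \<zeta> n)\<^sup>2" using Gn(1) C \<beta>12 by (intro power_mono) auto
          moreover have "(\<beta>\<^sub>1 / C / sqrt (real n))\<^sup>2 = (\<beta>\<^sub>1 / C)\<^sup>2 / real n"
            unfolding power_divide[of "\<beta>\<^sub>1 / C"] by simp
          ultimately have "(\<beta>\<^sub>1 / C)\<^sup>2 / real n \<le> (\<zeta> n)\<^sup>2" by (simp only: power2_minus)
          hence "(\<beta>\<^sub>1 / C)\<^sup>2 \<le> real n * (\<zeta> n)\<^sup>2"
            unfolding pos_divide_le_eq[OF Q.pos(7)] by (subst mult.commute)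
          hence "m * (\<beta>\<^sub>1 / C)\<^sup>2 \<le> m * (real n * (\<zeta> n)\<^sup>2)" using m by (intro mult_left_mono) auto
          thus ?thesis by (simp add: q_def le_max_iff_disj)
        qed
        have q2: "exp (- b\<^sub>1\<^sup>2 / 4) \<le> q" by (simp add: q_def)
        \<comment> \<open>Positivity of \<open>B n\<close> does not involve \<open>s\<close> and is
          wanted even for empty \<open>S\<close>, so the comparison is instantiated at
          \<open>s = 0\<close>.\<close>
        interpret G0: gaussian_comparison b\<^sub>1 b\<^sub>2 S0 "\<beta> n" "\<phi> n" Y 0
          by (rule comp) (use S0 gb in auto)
        have Bpos: "0 < B n" using G0.B_bounds(2) by (simp only: B_def)
        obtain LW :: "complex \<Rightarrow> complex" where LW: "is_log_transform M (\<lambda>\<omega>. sqrt (real n) / \<sigma> n * W n \<omega>) (\<beta> n) LW"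
          "\<And>s. - \<beta> n < Re s \<Longrightarrow> (LBINT y. Ln (1 - psi M V U (\<rho> n) (of_real Q.l * Complex (\<beta> n) (- y)) ^ n) *
            cauchy_kernel (s + of_real (\<beta> n)) (of_real (\<beta> n)) (Complex 0 y)) = 2 * pi * LW s"
        proof (rule Q.log_transform_W[unfolded qe])
          fix L :: "complex \<Rightarrow> complex" assume a: "is_log_transform M (\<lambda>\<omega>. sqrt (real n) / \<sigma> n * W n \<omega>) (\<beta> n) L"
            and b: "\<And>s. - \<beta> n < Re s \<Longrightarrow> (LBINT y. Ln (1 - psi M V U (\<rho> n) (of_real Q.l * Complex (\<beta> n) (- y)) ^ n) *
              cauchy_kernel (s + of_real (\<beta> n)) (of_real (\<beta> n)) (Complex 0 y)) = 2 * pi * L s"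
          show thesis by (rule that[OF a b])
        qed
        obtain LM :: "complex \<Rightarrow> complex" where LM: "is_log_transform (gaussian_steps (B n)) walk_max (B n) LM"
          "\<And>a r. \<bar>a\<bar> < 3 / 4 * B n \<Longrightarrow> a < Re r + B n \<Longrightarrow>
            (LBINT y. Ln (1 - exp (((Complex a y)\<^sup>2 - of_real ((B n)\<^sup>2)) / 2)) * cauchy_kernel (r + of_real (B n)) (of_real (B n)) (Complex a y)) = 2 * pi * LM r"
        proof (rule gaussian_walk_log_transform[OF Bpos])
          fix L :: "complex \<Rightarrow> complex" assume a: "is_log_transform (gaussian_steps (B n)) walk_max (B n) L"
            and b: "\<And>a r. \<bar>a\<bar> < 3 / 4 * B n \<Longrightarrow> a < Re r + B n \<Longrightarrow>
              (LBINT y. Ln (1 - exp (((Complex a y)\<^sup>2 - of_real ((B n)\<^sup>2)) / 2)) * cauchy_kernel (r + of_real (B n)) (of_real (B n)) (Complex a y)) = 2 * pi * L r"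
          show thesis by (rule that[OF a b])
        qed
        have close: "1 + (s + complex_of_real (\<beta> n)) * complex_of_real (\<phi> n) \<noteq> 0 \<and> - B n < Re (Rn n s) \<and> cmod (LW s - LM (Rn n s)) \<le> K / real n"
          if s: "s \<in> S" "- \<beta> n / 2 \<le> Re s" for s
        proof (intro conjI)
          have c: "gaussian_comparison b\<^sub>1 b\<^sub>2 S0 (\<beta> n) (\<phi> n) Y s" using S0(2) s by (intro comp) auto
          interpret G1: gaussian_comparison b\<^sub>1 b\<^sub>2 S0 "\<beta> n" "\<phi> n" Y s by (rule c)
          show "1 + (s + complex_of_real (\<beta> n)) * complex_of_real (\<phi> n) \<noteq> 0" by (rule G1.denominators(3))
          show "- B n < Re (Rn n s)" using G1.Re_R by (simp only: B_def Rn_def)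
          have "cmod (LW s - LM (Rn n s)) \<le> 1 / (1 - q) * (E0 / real n) * (4 * S0 * ((1 + (S0 + b\<^sub>1)) / (b\<^sub>1 / 4) + 1)\<^sup>2) * (LBINT y. inverse (1 + y\<^sup>2))"
            by (rule Q.log_transforms_close[unfolded qe, OF c Y2n lY \<phi>half c0 e' q q2 q3 E _ _ LW(2) LM(2)])
               (simp_all only: B_def Rn_def)
          thus "cmod (LW s - LM (Rn n s)) \<le> K / real n" by (simp add: K_def)
        qed
        show "0 < \<sigma> n \<and> 0 < \<beta> n \<and> 0 < B n \<and>
              (\<exists>L\<^sub>W L\<^sub>M.
                 is_log_transform M (\<lambda>\<omega>. sqrt (real n) / \<sigma> n * W n \<omega>) (\<beta> n) L\<^sub>W \<and>
                 is_log_transform (gaussian_steps (B n)) walk_max (B n) L\<^sub>M \<and>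
                 (\<forall>s\<in>S. - \<beta> n / 2 \<le> Re s \<longrightarrow>
                    1 + (s + complex_of_real (\<beta> n)) * complex_of_real (\<phi> n) \<noteq> 0 \<and>
                    - B n < Re (Rn n s) \<and>
                    cmod (L\<^sub>W s - L\<^sub>M (Rn n s)) \<le> K / real n))"
          using gb Bpos LW(1) LM(1) close by blast
      qed
    qed
    have all: "(\<forall>\<^sub>F n in sequentially. \<exists>!z. is_saddle_point \<delta>' (h n) z) \<and>
        d\<^sub>2 \<in> O(\<lambda>_. 1) \<and>
        \<phi> \<in> O(\<lambda>n. 1 / sqrt (real n)) \<and>
        (\<forall>S. bounded S \<longrightarrow>
           (\<exists>K n\<^sub>0. \<forall>n\<ge>n\<^sub>0.
              0 < \<sigma> n \<and> 0 < \<beta> n \<and> 0 < B n \<and>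
              (\<exists>L\<^sub>W L\<^sub>M.
                 is_log_transform M (\<lambda>\<omega>. sqrt (real n) / \<sigma> n * W n \<omega>) (\<beta> n) L\<^sub>W \<and>
                 is_log_transform (gaussian_steps (B n)) walk_max (B n) L\<^sub>M \<and>
                 (\<forall>s\<in>S. - \<beta> n / 2 \<le> Re s \<longrightarrow>
                    1 + (s + complex_of_real (\<beta> n)) * complex_of_real (\<phi> n) \<noteq> 0 \<and>
                    - B n < Re (Rn n s) \<and>
                    cmod (L\<^sub>W s - L\<^sub>M (Rn n s)) \<le> K / real n))))"
      by (intro conjI allI impI part1 part2 part3 part4)
    show "let h = (\<lambda>n. log_psi M V U (\<rho> n));
         \<zeta> = (\<lambda>n. saddle_point \<delta>' (h n));
         \<sigma> = (\<lambda>n. sqrt ((deriv ^^ 2) (h n) (\<zeta> n)));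
         \<beta> = (\<lambda>n. - \<zeta> n * \<sigma> n * sqrt (real n));
         d\<^sub>2 = (\<lambda>n. - (deriv ^^ 3) (h n) (\<zeta> n) / (6 * (deriv ^^ 2) (h n) (\<zeta> n)));
         \<phi> = (\<lambda>n. d\<^sub>2 n / (\<sigma> n * sqrt (real n)));
         B = (\<lambda>n. \<beta> n / (1 + \<beta> n * \<phi> n));
         R = (\<lambda>n s. s / ((1 + complex_of_real (\<beta> n * \<phi> n)) *
                         (1 + (s + complex_of_real (\<beta> n)) * complex_of_real (\<phi> n))))
     in (\<forall>\<^sub>F n in sequentially. \<exists>!z. is_saddle_point \<delta>' (h n) z) \<and>
        d\<^sub>2 \<in> O(\<lambda>_. 1) \<and>
        \<phi> \<in> O(\<lambda>n. 1 / sqrt (real n)) \<and>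
        (\<forall>S. bounded S \<longrightarrow>
           (\<exists>K n\<^sub>0. \<forall>n\<ge>n\<^sub>0.
              0 < \<sigma> n \<and> 0 < \<beta> n \<and> 0 < B n \<and>
              (\<exists>L\<^sub>W L\<^sub>M.
                 is_log_transform M (\<lambda>\<omega>. sqrt (real n) / \<sigma> n * W n \<omega>) (\<beta> n) L\<^sub>W \<and>
                 is_log_transform (gaussian_steps (B n)) walk_max (B n) L\<^sub>M \<and>
                 (\<forall>s\<in>S. - \<beta> n / 2 \<le> Re s \<longrightarrow>
                    1 + (s + complex_of_real (\<beta> n)) * complex_of_real (\<phi> n) \<noteq> 0 \<and>
                    - B n < Re (R n s) \<and>
                    cmod (L\<^sub>W s - L\<^sub>M (R n s)) \<le> K / real n))))"
      unfolding Let_def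
      by (rule all[unfolded Rn_def B_def \<phi>_def d\<^sub>2_def \<beta>_def \<sigma>_def \<zeta>_def h_def])
  qed
qed

end
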